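(* Let $n \geqslant 2$, let $\omega$ be the primitive $n$th root of unity used to define the Taft algebra $T_n$, and suppose that $T_n$ acts inner faithfully and homogeneously on a noetherian graded down-up algebra $A(\alpha,\beta)$ (so $\beta \neq 0$). Then, writing the actions of $g$ and $x$ on the degree one piece as $2\times 2$ matrices with respect to the basis $(u,v)$, one of the following holds: (1) For some $0 \leqslant k \leqslant n-1$ and $q \in \Bbbk^\times$, $$g = \begin{pmatrix} \omega^{k+1} & 0 \\ 0 & \omega^k \end{pmatrix}, \quad x = \begin{pmatrix} 0 & q \\ 0 & 0 \end{pmatrix}, \quad \alpha = \omega^{-(k+1)}(1+\sqrt{\omega}), \quad \beta = -\omega^{-2(k+1)}\sqrt{\omega},$$ where $\sqrt{\omega}$ denotes a choice of either one of the square roots of $\omega$; or (2) For some $0 \leqslant k \leqslant n-1$ and $r \in \Bbbk^\times$, $$g = \begin{pmatrix} \omega^{k} & 0 \\ 0 & \omega^{k+1} \end{pmatrix}, \quad x = \begin{pmatrix} 0 & 0 \\ r & 0 \end{pmatrix}, \quad \alpha = \omega^{k+1}(1+\sqrt{\omega^{-1}}), \quad \beta = -\omega^{2(k+1)}\sqrt{\omega^{-1}},$$ where $\sqrt{\omega^{-1}}$ denotes a choice of either one of the square roots of $\omega^{-1}$. Conversely, every choice of an integer $0 \leqslant k \leqslant n-1$, a scalar $q \in \Bbbk^\times$ and a square root $\sqrt{\omega}$ of $\omega$ in (1), and every choice of an integer $0 \leqslant k \leqslant n-1$, a scalar $r \in \Bbbk^\times$ and a square root $\sqrt{\omega^{-1}}$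 of $\omega^{-1}$ in (2), gives rise, via the matrices for $g$ and $x$ displayed in (1), respectively (2), to an inner faithful (homogeneous) action of $T_n$ on the down-up algebra $A(\alpha,\beta)$ with the indicated $\alpha,\beta$.
   Context: $\Bbbk$ is an algebraically closed field of characteristic $0$; all algebras are associative $\Bbbk$-algebras. Taft algebra: for $n\geqslant 2$ and $\omega\in\Bbbk$ a primitive $n$th root of unity, $T_n = \Bbbk\langle x,g \mid g^n-1,\ x^n,\ gx-\omega xg\rangle$, a Hopf algebra with $\varepsilon(g)=1$, $\Delta(g)=g\otimes g$, $S(g)=g^{n-1}$, $\varepsilon(x)=0$, $\Delta(x)=g\otimes x+x\otimes 1$, $S(x)=-g^{n-1}x$. Graded down-up algebra: $A(\alpha,\beta)=\Bbbk\langle u,v\rangle/(v^2u-\alpha vuv-\beta uv^2,\ vu^2-\alpha uvu-\beta u^2v)$, graded with $\deg u=\deg v=1$. It is noetherian if and only if $\beta\neq 0$, and $\beta \neq 0$ is assumed throughout. A Hopf algebra $H$ acts on an algebra $A$ if $A$ is a left $H$-module with $h\cdot 1=\varepsilon(h)1$ and $h\cdot(ab)=\sum (h_1\cdot a)(h_2\cdot b)$. If $A$ is graded, the action is homogeneous if each $A_i$ is an $H$-submodule. The action is inner faithful if there is no nonzero Hopf ideal $I$ of $H$ with $I\cdot A=0$. Matrix convention: matrices act on column vectors with respect to the ordered basis $(u,v)$ of $A_1$; e.g. in (1), $g\cdot u=\omega^{k+1}u$, $g\cdot v=\omega^k v$, $x\cdot u=0$, $x\cdot v=qu$. *)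

theory Defs
  imports
    "HOL-Library.Poly_Mapping"
    "HOL-Computational_Algebra.Polynomial"
    "HOL-Algebra.Module"
    "HOL-Algebra.QuotRing"
begin

section \<open>Algebras given by generators and relations\<close>

text \<open>Words form the free monoid under concatenation. It is written additively because
  \<^theory>\<open>HOL-Library.Poly_Mapping\<close> turns the finitely supported functions on an additive monoid into
  its monoid algebra; for words this is the free algebra.\<close>

instantiation list :: (type) monoid_add
begin

definition zero_list :: "'a list" where "zero_list = []"

definition plus_list :: "'a list \<Rightarrow> 'a list \<Rightarrow> 'a list" where "plus_list = (@)"

instance
  by standard (simp_all add: zero_list_def plus_list_def)

end

type_synonym ('k, 'g) free = "'g list \<Rightarrow>\<^sub>0 'k"

definition gen :: "'g \<Rightarrow> ('k::field, 'g) free" where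
  "gen l = Poly_Mapping.single [l] 1"

definition const :: "'k \<Rightarrow> ('k::field, 'g) free" where
  "const c = Poly_Mapping.single [] c"

text \<open>A \<open>'k\<close>-algebra is a record of type \<^type>\<open>module\<close>, which is a ring together with a scalar
  multiplication. The scalars are the elements of the type \<open>'k\<close>.\<close>

definition free_algebra :: "('k::field, ('k, 'g) free) module" where
  "free_algebra = \<lparr>carrier = UNIV, mult = (*), one = 1, zero = 0, add = (+),
     smult = (\<lambda>c p. const c * p)\<rparr>"

definition quotient_algebra :: "('k, 'a) module \<Rightarrow> 'a set \<Rightarrow> ('k, 'a set) module" where
  "quotient_algebra A I = \<lparr>carrier = carrier (A Quot I), mult = mult (A Quot I),
     one = one (A Quot I), zero = zero (A Quot I), add = add (A Quot I),
     smult = (\<lambda>c X. \<Union>a\<in>X. I +>\<^bsub>A\<^esub> (c \<odot>\<^bsub>A\<^esub> a))\<rparr>"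

text \<open>The ideals of \<^theory>\<open>HOL-Algebra.Ideal\<close> are two-sided.\<close>

definition relation_ideal :: "('k::field, 'g) free set \<Rightarrow> ('k, 'g) free set" where
  "relation_ideal R = Idl\<^bsub>free_algebra\<^esub> R"

definition presented :: "('k::field, 'g) free set \<Rightarrow> ('k, ('k, 'g) free set) module" where
  "presented R = quotient_algebra free_algebra (relation_ideal R)"

definition cls :: "('k::field, 'g) free set \<Rightarrow> ('k, 'g) free \<Rightarrow> ('k, 'g) free set" where
  "cls R p = relation_ideal R +>\<^bsub>free_algebra\<^esub> p"


section \<open>Tensor products\<close>

text \<open>\<open>V \<otimes> W\<close> is the space of formal linear combinations of pairs in \<open>V \<times> W\<close> modulo the bilinearity
  relations. The scalar \<open>r\<close> in the rules makes \<open>tensor_null\<close> a subspace.\<close>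

inductive_set tensor_null ::
    "('k::field, 'v) module \<Rightarrow> ('k, 'w) module \<Rightarrow> ('v \<times> 'w \<Rightarrow>\<^sub>0 'k) set"
  for V :: "('k::field, 'v) module" and W :: "('k, 'w) module" where
  zero: "0 \<in> tensor_null V W"
| diff: "s \<in> tensor_null V W \<Longrightarrow> t \<in> tensor_null V W \<Longrightarrow> s - t \<in> tensor_null V W"
| add_left: "a \<in> carrier V \<Longrightarrow> a' \<in> carrier V \<Longrightarrow> b \<in> carrier W \<Longrightarrow>
    Poly_Mapping.single (a \<oplus>\<^bsub>V\<^esub> a', b) r - Poly_Mapping.single (a, b) r
      - Poly_Mapping.single (a', b) r \<in> tensor_null V W"
| add_right: "a \<in> carrier V \<Longrightarrow> b \<in> carrier W \<Longrightarrow> b' \<in> carrier W \<Longrightarrow>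
    Poly_Mapping.single (a, b \<oplus>\<^bsub>W\<^esub> b') r - Poly_Mapping.single (a, b) r
      - Poly_Mapping.single (a, b') r \<in> tensor_null V W"
| smult_left: "a \<in> carrier V \<Longrightarrow> b \<in> carrier W \<Longrightarrow>
    Poly_Mapping.single (c \<odot>\<^bsub>V\<^esub> a, b) r - Poly_Mapping.single (a, b) (c * r) \<in> tensor_null V W"
| smult_right: "a \<in> carrier V \<Longrightarrow> b \<in> carrier W \<Longrightarrow>
    Poly_Mapping.single (a, c \<odot>\<^bsub>W\<^esub> b) r - Poly_Mapping.single (a, b) (c * r) \<in> tensor_null V W"

definition tensor_class ::
    "('k::field, 'v) module \<Rightarrow> ('k, 'w) module \<Rightarrow> ('v \<times> 'w \<Rightarrow>\<^sub>0 'k) \<Rightarrow> ('v \<times> 'w \<Rightarrow>\<^sub>0 'k) set" where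
  "tensor_class V W t = (+) t ` tensor_null V W"

text \<open>The product \<open>(a \<otimes> b)(c \<otimes> d) = ac \<otimes> bd\<close> on representatives.\<close>

definition tensor_mult ::
    "('k::field, 'v) module \<Rightarrow> ('k, 'w) module \<Rightarrow>
     ('v \<times> 'w \<Rightarrow>\<^sub>0 'k) \<Rightarrow> ('v \<times> 'w \<Rightarrow>\<^sub>0 'k) \<Rightarrow> ('v \<times> 'w \<Rightarrow>\<^sub>0 'k)" where
  "tensor_mult V W s t =
     (\<Sum>(a, b)\<in>Poly_Mapping.keys s. \<Sum>(c, d)\<in>Poly_Mapping.keys t.
        Poly_Mapping.single (a \<otimes>\<^bsub>V\<^esub> c, b \<otimes>\<^bsub>W\<^esub> d)
          (Poly_Mapping.lookup s (a, b) * Poly_Mapping.lookup t (c, d)))"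


section \<open>Hopf algebras and their actions\<close>

text \<open>The comultiplication takes values in \<open>H \<otimes> H\<close>, whose elements are the sets
  \<open>tensor_class H H t\<close> with \<open>t\<close> supported on \<open>carrier H \<times> carrier H\<close>.\<close>

record (overloaded) ('k::zero, 'h) hopf = "('k, 'h) module" +
  comult :: "'h \<Rightarrow> ('h \<times> 'h \<Rightarrow>\<^sub>0 'k) set"
  counit :: "'h \<Rightarrow> 'k"
  antipode :: "'h \<Rightarrow> 'h"

definition underlying_algebra :: "('k::zero, 'h) hopf \<Rightarrow> ('k, 'h) module" where
  "underlying_algebra H = module.truncate H"

definition left_module :: "('k::field, 'h) hopf \<Rightarrow> ('k, 'a) module \<Rightarrow> ('h \<Rightarrow> 'a \<Rightarrow> 'a) \<Rightarrow> bool" where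
  "left_module H A act \<longleftrightarrow>
     (\<forall>h\<in>carrier H. \<forall>a\<in>carrier A. act h a \<in> carrier A) \<and>
     (\<forall>h\<in>carrier H. \<forall>a\<in>carrier A. \<forall>b\<in>carrier A. act h (a \<oplus>\<^bsub>A\<^esub> b) = act h a \<oplus>\<^bsub>A\<^esub> act h b) \<and>
     (\<forall>h\<in>carrier H. \<forall>c. \<forall>a\<in>carrier A. act h (c \<odot>\<^bsub>A\<^esub> a) = c \<odot>\<^bsub>A\<^esub> act h a) \<and>
     (\<forall>h\<in>carrier H. \<forall>k\<in>carrier H. \<forall>a\<in>carrier A. act (h \<oplus>\<^bsub>H\<^esub> k) a = act h a \<oplus>\<^bsub>A\<^esub> act k a) \<and>
     (\<forall>c. \<forall>h\<in>carrier H. \<forall>a\<in>carrier A. act (c \<odot>\<^bsub>H\<^esub> h) a = c \<odot>\<^bsub>A\<^esub> act h a) \<and>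
     (\<forall>h\<in>carrier H. \<forall>k\<in>carrier H. \<forall>a\<in>carrier A. act (h \<otimes>\<^bsub>H\<^esub> k) a = act h (act k a)) \<and>
     (\<forall>a\<in>carrier A. act \<one>\<^bsub>H\<^esub> a = a)"

text \<open>In the last condition \<open>t\<close> runs over the representatives
  \<open>\<Sum> h\<^sub>1 \<otimes> h\<^sub>2\<close> of the comultiplication of \<open>h\<close>; the right-hand side does not depend on the choice.\<close>

definition hopf_action :: "('k::field, 'h) hopf \<Rightarrow> ('k, 'a) module \<Rightarrow> ('h \<Rightarrow> 'a \<Rightarrow> 'a) \<Rightarrow> bool" where
  "hopf_action H A act \<longleftrightarrow>
     left_module H A act \<and>
     (\<forall>h\<in>carrier H. act h \<one>\<^bsub>A\<^esub> = counit H h \<odot>\<^bsub>A\<^esub> \<one>\<^bsub>A\<^esub>) \<and>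
     (\<forall>h\<in>carrier H. \<forall>a\<in>carrier A. \<forall>b\<in>carrier A. \<forall>t\<in>comult H h.
        act h (a \<otimes>\<^bsub>A\<^esub> b) =
          (\<Oplus>\<^bsub>A\<^esub>p\<in>Poly_Mapping.keys t.
             Poly_Mapping.lookup t p \<odot>\<^bsub>A\<^esub> (act (fst p) a \<otimes>\<^bsub>A\<^esub> act (snd p) b)))"

definition homogeneous_action ::
    "('k::field, 'h) hopf \<Rightarrow> (nat \<Rightarrow> 'a set) \<Rightarrow> ('h \<Rightarrow> 'a \<Rightarrow> 'a) \<Rightarrow> bool" where
  "homogeneous_action H grade act \<longleftrightarrow> (\<forall>i. \<forall>h\<in>carrier H. \<forall>a\<in>grade i. act h a \<in> grade i)"

definition hopf_ideal :: "('k::field, 'h) hopf \<Rightarrow> 'h set \<Rightarrow> bool" where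
  "hopf_ideal H I \<longleftrightarrow>
     ideal I H \<and>
     (\<forall>h\<in>I. comult H h \<subseteq>
        (\<Union>t\<in>{t. Poly_Mapping.keys t \<subseteq> I \<times> carrier H \<union> carrier H \<times> I}.
           tensor_class (underlying_algebra H) (underlying_algebra H) t)) \<and>
     (\<forall>h\<in>I. counit H h = 0) \<and>
     (\<forall>h\<in>I. antipode H h \<in> I)"

definition inner_faithful :: "('k::field, 'h) hopf \<Rightarrow> ('k, 'a) module \<Rightarrow> ('h \<Rightarrow> 'a \<Rightarrow> 'a) \<Rightarrow> bool" where
  "inner_faithful H A act \<longleftrightarrow>
     \<not> (\<exists>I. hopf_ideal H I \<and> I \<noteq> {\<zero>\<^bsub>H\<^esub>} \<and> (\<forall>h\<in>I. \<forall>a\<in>carrier A. act h a = \<zero>\<^bsub>A\<^esub>))"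


section \<open>Taft algebras\<close>

definition primitive_root :: "nat \<Rightarrow> 'k::field \<Rightarrow> bool" where
  "primitive_root n \<omega> \<longleftrightarrow> n > 0 \<and> \<omega> ^ n = 1 \<and> (\<forall>m. 0 < m \<and> m < n \<longrightarrow> \<omega> ^ m \<noteq> 1)"

datatype taft_gen = Taft_x | Taft_g

definition taft_relations :: "nat \<Rightarrow> 'k::field \<Rightarrow> ('k, taft_gen) free set" where
  "taft_relations n \<omega> = (let x = gen Taft_x; g = gen Taft_g in
     {g ^ n - 1, x ^ n, g * x - const \<omega> * x * g})"

definition taft_algebra :: "nat \<Rightarrow> 'k::field \<Rightarrow> ('k, ('k, taft_gen) free set) module" where
  "taft_algebra n \<omega> = presented (taft_relations n \<omega>)"

definition taft_x :: "nat \<Rightarrow> 'k::field \<Rightarrow> ('k, taft_gen) free set" where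
  "taft_x n \<omega> = cls (taft_relations n \<omega>) (gen Taft_x)"

definition taft_g :: "nat \<Rightarrow> 'k::field \<Rightarrow> ('k, taft_gen) free set" where
  "taft_g n \<omega> = cls (taft_relations n \<omega>) (gen Taft_g)"

text \<open>The structure maps are given on generators and extended to the free algebra, as algebra
  homomorphisms for the comultiplication and the counit and as an anti-homomorphism for the
  antipode. They respect the relations, so the union over all representatives of an element
  of the Taft algebra is a single class, and the counit has a single value on them.\<close>

fun taft_comult_gen ::
    "nat \<Rightarrow> 'k::field \<Rightarrow> taft_gen \<Rightarrow> (('k, taft_gen) free set \<times> ('k, taft_gen) free set \<Rightarrow>\<^sub>0 'k)" where
  "taft_comult_gen n \<omega> Taft_g = Poly_Mapping.single (taft_g n \<omega>, taft_g n \<omega>) 1"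
| "taft_comult_gen n \<omega> Taft_x =
     Poly_Mapping.single (taft_g n \<omega>, taft_x n \<omega>) 1
     + Poly_Mapping.single (taft_x n \<omega>, \<one>\<^bsub>taft_algebra n \<omega>\<^esub>) 1"

fun taft_comult_word ::
    "nat \<Rightarrow> 'k::field \<Rightarrow> taft_gen list \<Rightarrow> (('k, taft_gen) free set \<times> ('k, taft_gen) free set \<Rightarrow>\<^sub>0 'k)" where
  "taft_comult_word n \<omega> [] = Poly_Mapping.single (\<one>\<^bsub>taft_algebra n \<omega>\<^esub>, \<one>\<^bsub>taft_algebra n \<omega>\<^esub>) 1"
| "taft_comult_word n \<omega> (l # w) =
     tensor_mult (taft_algebra n \<omega>) (taft_algebra n \<omega>) (taft_comult_gen n \<omega> l) (taft_comult_word n \<omega> w)"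

definition taft_comult_free ::
    "nat \<Rightarrow> 'k::field \<Rightarrow> ('k, taft_gen) free \<Rightarrow>
     (('k, taft_gen) free set \<times> ('k, taft_gen) free set \<Rightarrow>\<^sub>0 'k)" where
  "taft_comult_free n \<omega> p =
     (\<Sum>w\<in>Poly_Mapping.keys p.
        Poly_Mapping.map ((*) (Poly_Mapping.lookup p w)) (taft_comult_word n \<omega> w))"

fun taft_counit_gen :: "taft_gen \<Rightarrow> 'k::field" where
  "taft_counit_gen Taft_g = 1"
| "taft_counit_gen Taft_x = 0"

definition taft_counit_free :: "('k::field, taft_gen) free \<Rightarrow> 'k" where
  "taft_counit_free p =
     (\<Sum>w\<in>Poly_Mapping.keys p. Poly_Mapping.lookup p w * prod_list (map taft_counit_gen w))"

fun taft_antipode_gen :: "nat \<Rightarrow> taft_gen \<Rightarrow> ('k::field, taft_gen) free" where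
  "taft_antipode_gen n Taft_g = gen Taft_g ^ (n - 1)"
| "taft_antipode_gen n Taft_x = - (gen Taft_g ^ (n - 1) * gen Taft_x)"

definition taft_antipode_free :: "nat \<Rightarrow> ('k::field, taft_gen) free \<Rightarrow> ('k, taft_gen) free" where
  "taft_antipode_free n p =
     (\<Sum>w\<in>Poly_Mapping.keys p.
        const (Poly_Mapping.lookup p w) * prod_list (map (taft_antipode_gen n) (rev w)))"

definition taft :: "nat \<Rightarrow> 'k::field \<Rightarrow> ('k, ('k, taft_gen) free set) hopf" where
  "taft n \<omega> = (let T = taft_algebra n \<omega> in
     \<lparr>carrier = carrier T, mult = mult T, one = one T, zero = zero T, add = add T, smult = smult T,
      comult = (\<lambda>h. \<Union>p\<in>h. tensor_class T T (taft_comult_free n \<omega> p)),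
      counit = (\<lambda>h. the_elem (taft_counit_free ` h)),
      antipode = (\<lambda>h. \<Union>p\<in>h. cls (taft_relations n \<omega>) (taft_antipode_free n p))\<rparr>)"


section \<open>Graded down-up algebras\<close>

datatype down_up_gen = DU_u | DU_v

definition down_up_relations :: "'k::field \<Rightarrow> 'k \<Rightarrow> ('k, down_up_gen) free set" where
  "down_up_relations \<alpha> \<beta> = (let u = gen DU_u; v = gen DU_v in
     {v * v * u - const \<alpha> * v * u * v - const \<beta> * u * v * v,
      v * u * u - const \<alpha> * u * v * u - const \<beta> * u * u * v})"

definition down_up :: "'k::field \<Rightarrow> 'k \<Rightarrow> ('k, ('k, down_up_gen) free set) module" where
  "down_up \<alpha> \<beta> = presented (down_up_relations \<alpha> \<beta>)"

definition down_up_u :: "'k::field \<Rightarrow> 'k \<Rightarrow> ('k, down_up_gen) free set" where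
  "down_up_u \<alpha> \<beta> = cls (down_up_relations \<alpha> \<beta>) (gen DU_u)"

definition down_up_v :: "'k::field \<Rightarrow> 'k \<Rightarrow> ('k, down_up_gen) free set" where
  "down_up_v \<alpha> \<beta> = cls (down_up_relations \<alpha> \<beta>) (gen DU_v)"

definition down_up_grade :: "'k::field \<Rightarrow> 'k \<Rightarrow> nat \<Rightarrow> ('k, down_up_gen) free set set" where
  "down_up_grade \<alpha> \<beta> i =
     cls (down_up_relations \<alpha> \<beta>) ` {p. \<forall>w\<in>Poly_Mapping.keys p. length w = i}"

text \<open>\<open>T\<close> acts on the degree one piece by the matrix with rows \<open>(a, b)\<close> and \<open>(c, d)\<close>, matrices
  acting on column vectors with respect to the ordered basis \<open>(u, v)\<close>.\<close>

definition has_matrix ::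
    "'k::field \<Rightarrow> 'k \<Rightarrow> (('k, down_up_gen) free set \<Rightarrow> ('k, down_up_gen) free set) \<Rightarrow>
     ('k \<times> 'k) \<times> ('k \<times> 'k) \<Rightarrow> bool" where
  "has_matrix \<alpha> \<beta> T = (\<lambda>((a, b), (c, d)).
     let A = down_up \<alpha> \<beta>; u = down_up_u \<alpha> \<beta>; v = down_up_v \<alpha> \<beta> in
       T u = a \<odot>\<^bsub>A\<^esub> u \<oplus>\<^bsub>A\<^esub> c \<odot>\<^bsub>A\<^esub> v \<and> T v = b \<odot>\<^bsub>A\<^esub> u \<oplus>\<^bsub>A\<^esub> d \<odot>\<^bsub>A\<^esub> v)"

definition taft_acts_on_down_up ::
    "nat \<Rightarrow> 'k::field \<Rightarrow> 'k \<Rightarrow> 'k \<Rightarrow>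
     (('k, taft_gen) free set \<Rightarrow> ('k, down_up_gen) free set \<Rightarrow> ('k, down_up_gen) free set) \<Rightarrow> bool" where
  "taft_acts_on_down_up n \<omega> \<alpha> \<beta> act \<longleftrightarrow>
     hopf_action (taft n \<omega>) (down_up \<alpha> \<beta>) act \<and>
     homogeneous_action (taft n \<omega>) (down_up_grade \<alpha> \<beta>) act \<and>
     inner_faithful (taft n \<omega>) (down_up \<alpha> \<beta>) act"

end

(* If the Taft algebra acts on a down-up algebra A, then g and x lift to an algebra endomorphism G and a
   G-skew derivation X of the free algebra, both of degree zero and preserving the ideal of relations. X is
   nonzero, since otherwise the Hopf ideal generated by x annihilates A, and its square is zero on the span
   of u and v. Comparing coefficients in degree three, G is diagonal, or antidiagonal (which is impossible),
   or (alpha, beta) is (0, 1) or (2, -1). In the last case every linear change of the generators preserves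
   the relations, so G may be taken triangular, and the equations force omega = 1. The diagonal case gives
   the two families.

   Conversely, the matrices define G and X on the free algebra, where G^n = 1, GX = omega XG and X^n = 0 hold
   because a q-binomial coefficient vanishes. The resulting module A is not only inner faithful but faithful:
   x^(n-1) is nonzero on every eigenspace of g, which is detected in a quantum plane that is a quotient of A. *)

theory Submission
  imports Defs
begin

section \<open>Formal linear combinations\<close>

text \<open>One quadratic governs the parameters: T^2 - \<alpha> T - \<beta>. If X maps one
  generator to a multiple of the other, then the eigenvalue of G on the image, or its inverse, is a
  root; the other root is s times this one, and s^2 is \<omega> or its inverse. For (0, 1) and (2,
  -1) the ratio of the roots is -1 and 1, whence \<omega> = 1. Neither algebra is given a basis.
  That an element is nonzero is always detected from outside: below degree three because the
  relators have degree three, in degree three by the coefficients at v v u and v u u, and elsewhere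
  by a module on which the relators vanish. For the Taft algebra only the spanning half of the
  normal form is proved; independence comes out of faithfulness. The coproduct of a class is a whole
  coset of formal tensors. The classification evaluates it at one explicit representative for g and
  one for x; the converse has to treat all representatives, which is done by one bilinear map that
  kills the bilinearity relations.\<close>

lemma poly_mapping_induct_single [case_names single add]:
  fixes p :: "'a \<Rightarrow>\<^sub>0 'b::comm_monoid_add"
  assumes single: "\<And>w c. P (Poly_Mapping.single w c)"
    and add: "\<And>p q. P p \<Longrightarrow> P q \<Longrightarrow> P (p + q)"
  shows "P p"
proof (induction p rule: update_induct)
  case const
  show ?case using single[of undefined 0] by simp
next
  case (update f a b)
  have "Poly_Mapping.update a b f = f + Poly_Mapping.single a b"
    using update(1)
    by (intro poly_mapping_eqI) (auto simp: lookup_update lookup_add lookup_single in_keys_iff)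
  then show ?case using update(3) single add by metis
qed

text \<open>Linear extension from a basis. The scalar action is an argument because the same lemmas
  serve free algebras, formal tensors, scalars (for the counit) and arbitrary modules.\<close>

definition lin :: "('k \<Rightarrow> 'v \<Rightarrow> 'v::comm_monoid_add) \<Rightarrow> ('a \<Rightarrow> 'v) \<Rightarrow> ('a \<Rightarrow>\<^sub>0 'k::zero) \<Rightarrow> 'v" where
  "lin sc f t = (\<Sum>w\<in>Poly_Mapping.keys t. sc (Poly_Mapping.lookup t w) (f w))"

context vector_space
begin

lemma lin_add: "lin scale f (s + t) = lin scale f s + lin scale f t"
  unfolding lin_def
  by (rule setsum_keys_plus_distrib) (simp_all add: scale_left_distrib)

lemma lin_single [simp]: "lin scale f (Poly_Mapping.single w c) = scale c (f w)"
  by (cases "c = 0") (simp_all add: lin_def)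

lemma lin_zero [simp]: "lin scale f 0 = 0"
  by (simp add: lin_def)

lemma lin_minus: "lin scale f (- t) = - lin scale f t"
  using lin_add[of f t "- t"] by (simp add: eq_neg_iff_add_eq_0 add.commute)

lemma lin_diff: "lin scale f (s - t) = lin scale f s - lin scale f t"
  using lin_add[of f s "- t"] by (simp add: lin_minus)

lemma lin_fun_add: "lin scale (\<lambda>w. f w + g w) t = lin scale f t + lin scale g t"
  by (simp add: lin_def scale_right_distrib sum.distrib)

end

lemma vector_space_mult: "vector_space ((*) :: 'k::field \<Rightarrow> 'k \<Rightarrow> 'k)"
  by unfold_locales (simp_all add: algebra_simps)

lemma lookup_scale [simp]:
  "Poly_Mapping.lookup (Poly_Mapping.map ((*) c) t) w = (c::'k::semiring_0) * Poly_Mapping.lookup t w"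
  by (simp add: Poly_Mapping.map.rep_eq when_def)

lemma vector_space_scale:
  "vector_space (\<lambda>c. Poly_Mapping.map ((*) c) :: ('a \<Rightarrow>\<^sub>0 'k::field) \<Rightarrow> _)"
  by unfold_locales (auto intro!: poly_mapping_eqI simp: lookup_add algebra_simps)


section \<open>The free algebra\<close>

lemma const_mult_single [simp]:
  "const c * Poly_Mapping.single w d = Poly_Mapping.single w (c * d)"
  by (simp add: const_def mult_single plus_list_def)

lemma single_mult_const [simp]:
  "Poly_Mapping.single w d * const c = Poly_Mapping.single w (c * d)"
  by (simp add: const_def mult_single plus_list_def mult.commute)

lemma const_commute: "p * const c = const c * p"
  by (induction p rule: poly_mapping_induct_single) (simp_all add: algebra_simps)

lemma const_left_commute: "p * (const c * q) = const c * (p * q)"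
  by (metis const_commute mult.assoc)

lemma const_add: "const (c + d) = const c + const d"
  by (simp add: const_def single_add)

lemma const_minus: "const (- c) = - const c"
  by (simp add: const_def single_uminus)

lemma const_mult: "const (c * d) = const c * const d"
  by (simp add: const_def mult_single plus_list_def)

lemma single_Nil_one: "Poly_Mapping.single [] (1::'k::field) = 1"
  by (metis single_one zero_list_def)

lemma const_one [simp]: "const 1 = 1"
  by (simp add: const_def single_Nil_one)

lemma const_zero [simp]: "const 0 = 0"
  by (simp add: const_def)

lemma single_eq_const: "Poly_Mapping.single w c = const c * Poly_Mapping.single w 1"
  by simp

lemma single_append:
  "Poly_Mapping.single (v @ w) (1::'k::field) = Poly_Mapping.single v 1 * Poly_Mapping.single w 1"
  by (simp add: mult_single plus_list_def)

lemma single_Cons: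
  "Poly_Mapping.single (l # w) (1::'k::field) = gen l * Poly_Mapping.single w 1"
  by (simp add: gen_def mult_single plus_list_def)

lemma gen_power: "gen l ^ m = Poly_Mapping.single (replicate m l) (1::'k::field)"
  by (induction m) (simp_all add: single_Cons single_Nil_one)

lemma vector_space_const: "vector_space (\<lambda>c p. const c * p :: ('k::field, 'g) free)"
  by unfold_locales (simp_all add: const_add const_mult algebra_simps)

lemma ring_free_algebra: "ring (free_algebra :: ('k::field, ('k, 'g) free) module)"
proof (rule ringI)
  show "abelian_group (free_algebra :: ('k, ('k, 'g) free) module)"
  proof (rule abelian_groupI)
    fix p :: "('k, 'g) free"
    show "\<exists>q\<in>carrier free_algebra. q \<oplus>\<^bsub>free_algebra\<^esub> p = \<zero>\<^bsub>free_algebra\<^esub>"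
      by (intro bexI[of _ "- p"]) (simp_all add: free_algebra_def)
  qed (simp_all add: free_algebra_def algebra_simps)
  show "Group.monoid (free_algebra :: ('k, ('k, 'g) free) module)"
    by unfold_locales (simp_all add: free_algebra_def algebra_simps)
qed (simp_all add: free_algebra_def algebra_simps)

lemma a_inv_free_algebra [simp]: "\<ominus>\<^bsub>free_algebra\<^esub> (p :: ('k::field, 'g) free) = - p"
  using ring.ring_simprules(3)[OF ring_free_algebra]
  by (intro abelian_group.minus_equality[OF ring.is_abelian_group[OF ring_free_algebra]])
     (simp_all add: free_algebra_def)

lemma ideal_free_algebraI:
  fixes J :: "('k::field, 'g) free set"
  assumes "0 \<in> J" and "\<And>p q. p \<in> J \<Longrightarrow> q \<in> J \<Longrightarrow> p + q \<in> J"
    and "\<And>p q. p \<in> J \<Longrightarrow> q * p \<in> J" and "\<And>p q. p \<in> J \<Longrightarrow> p * q \<in> J"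
  shows "ideal J free_algebra"
proof (rule idealI[OF ring_free_algebra])
  have "inv\<^bsub>add_monoid free_algebra\<^esub> p \<in> J" if "p \<in> J" for p
    using assms(3)[OF that, of "- 1"] a_inv_free_algebra[of p] by (simp add: a_inv_def)
  then show "subgroup J (add_monoid free_algebra)"
    using assms(1,2) by unfold_locales (auto simp: free_algebra_def)
qed (use assms in \<open>auto simp: free_algebra_def\<close>)

lemma ideal_relation_ideal: "ideal (relation_ideal R) free_algebra"
  unfolding relation_ideal_def
  by (rule ring.genideal_ideal[OF ring_free_algebra]) (simp add: free_algebra_def)

lemma relation_idealI: "r \<in> R \<Longrightarrow> r \<in> relation_ideal R"
  unfolding relation_ideal_def
  using ring.genideal_self[OF ring_free_algebra, of R] by (auto simp: free_algebra_def)

lemma relation_ideal_zero [simp]: "0 \<in> relation_ideal R"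
  using additive_subgroup.zero_closed[OF ideal.axioms(1)[OF ideal_relation_ideal[of R]]]
  by (simp add: free_algebra_def)

lemma relation_ideal_add:
  "p \<in> relation_ideal R \<Longrightarrow> q \<in> relation_ideal R \<Longrightarrow> p + q \<in> relation_ideal R"
  using additive_subgroup.a_closed[OF ideal.axioms(1)[OF ideal_relation_ideal[of R]], of p q]
  by (simp add: free_algebra_def)

lemma relation_ideal_mult_left: "p \<in> relation_ideal R \<Longrightarrow> q * p \<in> relation_ideal R"
  using ideal.I_l_closed[OF ideal_relation_ideal[of R], of p q] by (simp add: free_algebra_def)

lemma relation_ideal_mult_right: "p \<in> relation_ideal R \<Longrightarrow> p * q \<in> relation_ideal R"
  using ideal.I_r_closed[OF ideal_relation_ideal[of R], of p q] by (simp add: free_algebra_def)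

lemma relation_ideal_minus: "p \<in> relation_ideal R \<Longrightarrow> - p \<in> relation_ideal R"
  using relation_ideal_mult_left[of p R "- 1"] by simp

lemma relation_ideal_minus_iff: "- p \<in> relation_ideal R \<longleftrightarrow> p \<in> relation_ideal R"
  using relation_ideal_minus[of p R] relation_ideal_minus[of "- p" R] by auto

lemma relation_ideal_diff:
  "p \<in> relation_ideal R \<Longrightarrow> q \<in> relation_ideal R \<Longrightarrow> p - q \<in> relation_ideal R"
  using relation_ideal_add[of p R "- q"] relation_ideal_minus[of q R] by simp

lemma relation_ideal_sum:
  "(\<And>i. i \<in> A \<Longrightarrow> f i \<in> relation_ideal R) \<Longrightarrow> sum f A \<in> relation_ideal R"
  by (induction A rule: infinite_finite_induct) (auto intro: relation_ideal_add)

lemma relation_ideal_const_iff: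
  assumes "c \<noteq> 0"
  shows "const c * p \<in> relation_ideal R \<longleftrightarrow> p \<in> relation_ideal R"
proof
  assume "const c * p \<in> relation_ideal R"
  then have "const (inverse c) * (const c * p) \<in> relation_ideal R"
    by (rule relation_ideal_mult_left)
  then show "p \<in> relation_ideal R"
    using assms by (simp add: mult.assoc[symmetric] const_mult[symmetric])
qed (rule relation_ideal_mult_left)

lemma relation_ideal_minimal:
  assumes "ideal J free_algebra" and "R \<subseteq> J"
  shows "relation_ideal R \<subseteq> J"
  unfolding relation_ideal_def
  by (rule ring.genideal_minimal[OF ring_free_algebra assms])

text \<open>The two-sided ideal is the additive span of the relators multiplied by a word on each
  side. One scalar, collected in the left factor, is enough because scalars are central.\<close>

lemma relation_ideal_induct [consumes 1, case_names zero add sandwich]: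
  fixes p :: "('k::field, 'g) free"
  assumes "p \<in> relation_ideal R" and zero: "P 0"
    and add: "\<And>p q. P p \<Longrightarrow> P q \<Longrightarrow> P (p + q)"
    and sandwich: "\<And>r v w c. r \<in> R \<Longrightarrow>
      P (Poly_Mapping.single v c * r * Poly_Mapping.single w 1)"
  shows "P p"
proof -
  \<comment> \<open>Quantifying over both outer factors makes this set an ideal, although
    \<open>P\<close> itself is closed only under sums.\<close>
  define J where "J = {q. \<forall>a b. P (a * q * b)}"
  have "ideal J free_algebra"
  proof (rule ideal_free_algebraI)
    show "p * q \<in> J" if "p \<in> J" for p q
      using that unfolding J_def by (simp add: mult.assoc) 
    show "q * p \<in> J" if "p \<in> J" for p q
      using that unfolding J_def by (simp flip: mult.assoc)
  qed (auto simp: J_def zero algebra_simps intro: add)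
  moreover have "P (a * r * b)" if "r \<in> R" for a r b
  proof (induction a rule: poly_mapping_induct_single)
    case (single v c)
    show ?case
    proof (induction b rule: poly_mapping_induct_single)
      case (single w d)
      have "Poly_Mapping.single v c * r * Poly_Mapping.single w d
          = Poly_Mapping.single v (d * c) * r * Poly_Mapping.single w 1"
        unfolding single_eq_const[of w d] const_mult_single[of d v c, symmetric]
          mult.assoc const_left_commute[of _ d] ..
      then show ?case using sandwich[OF that] by simp
    qed (auto simp: algebra_simps intro: add)
  qed (auto simp: algebra_simps intro: add)
  ultimately have "relation_ideal R \<subseteq> J"
    by (intro relation_ideal_minimal) (auto simp: J_def)
  then have "P (1 * p * 1)"
    using assms(1) unfolding J_def by blast
  then show ?thesis by simp
qed


section \<open>Presented algebras\<close>

lemma in_cls_iff: "q \<in> cls R p \<longleftrightarrow> q - p \<in> relation_ideal R"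
proof -
  have "q \<in> cls R p \<longleftrightarrow> (\<exists>i\<in>relation_ideal R. q = i + p)"
    by (simp add: cls_def a_r_coset_def' free_algebra_def)
  also have "\<dots> \<longleftrightarrow> q - p \<in> relation_ideal R"
    by (metis add_diff_cancel_right' diff_add_cancel)
  finally show ?thesis .
qed

lemma cls_eq_iff: "cls R p = cls R q \<longleftrightarrow> p - q \<in> relation_ideal R"
proof
  assume "cls R p = cls R q"
  then have "p \<in> cls R q" using in_cls_iff[of p R p] by simp
  then show "p - q \<in> relation_ideal R" by (simp add: in_cls_iff)
next
  assume pq: "p - q \<in> relation_ideal R"
  have "r - p \<in> relation_ideal R \<longleftrightarrow> r - q \<in> relation_ideal R" for r
    using relation_ideal_add[OF pq, of "r - p"] relation_ideal_diff[OF _ pq, of "r - q"]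
    by (auto simp: algebra_simps)
  then show "cls R p = cls R q" by (auto simp: in_cls_iff)
qed

lemma self_in_cls: "p \<in> cls R p"
  by (simp add: in_cls_iff)

lemma cls_eq_zero_iff: "cls R p = cls R 0 \<longleftrightarrow> p \<in> relation_ideal R"
  by (simp add: cls_eq_iff)

lemma carrier_presented: "carrier (presented R) = range (cls R)"
  by (auto simp: presented_def quotient_algebra_def FactRing_def A_RCOSETS_def' cls_def free_algebra_def)

lemma cls_in_carrier [simp]: "cls R p \<in> carrier (presented R)"
  by (simp add: carrier_presented)

lemma carrier_presentedE:
  assumes "h \<in> carrier (presented R)" obtains p where "h = cls R p"
  using assms by (auto simp: carrier_presented)

lemma zero_presented: "\<zero>\<^bsub>presented R\<^esub> = cls R 0"
  by (auto simp: presented_def quotient_algebra_def FactRing_def in_cls_iff)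

lemma one_presented: "\<one>\<^bsub>presented R\<^esub> = cls R 1"
  by (simp add: presented_def quotient_algebra_def FactRing_def cls_def free_algebra_def)

lemma mult_presented: "cls R p \<otimes>\<^bsub>presented R\<^esub> cls R q = cls R (p * q)"
  using ideal.rcoset_mult_add[OF ideal_relation_ideal, of p q R]
  by (simp add: presented_def quotient_algebra_def FactRing_def cls_def free_algebra_def)

lemma add_presented: "cls R p \<oplus>\<^bsub>presented R\<^esub> cls R q = cls R (p + q)"
  using abelian_subgroup.a_rcos_sum[OF ideal.axioms(1)[OF ideal_relation_ideal, THEN abelian_subgroupI3, OF ring.is_abelian_group[OF ring_free_algebra]], of p q R]
  by (simp add: presented_def quotient_algebra_def FactRing_def cls_def free_algebra_def)

lemma smult_presented: "c \<odot>\<^bsub>presented R\<^esub> cls R p = cls R (const c * p)"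
proof -
  have "c \<odot>\<^bsub>presented R\<^esub> cls R p = (\<Union>a\<in>cls R p. cls R (const c * a))"
    by (simp add: presented_def quotient_algebra_def cls_def free_algebra_def)
  moreover have "cls R (const c * a) = cls R (const c * p)" if "a \<in> cls R p" for a
    using that relation_ideal_mult_left[of "a - p" R "const c"]
    by (simp add: in_cls_iff cls_eq_iff algebra_simps)
  then have "(\<Union>a\<in>cls R p. cls R (const c * a)) = (\<Union>a\<in>cls R p. cls R (const c * p))"
    by simp
  moreover have "cls R p \<noteq> {}" using self_in_cls[of p R] by blast
  ultimately show ?thesis by simp
qed

lemmas presented_cls = zero_presented one_presented mult_presented add_presented smult_presented

lemma ring_presented: "ring (presented R)"
proof (rule ringI)
  show "abelian_group (presented R)"
  proof (rule abelian_groupI)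
    fix h assume "h \<in> carrier (presented R)"
    then obtain p where "h = cls R p" by (rule carrier_presentedE)
    then show "\<exists>k\<in>carrier (presented R). k \<oplus>\<^bsub>presented R\<^esub> h = \<zero>\<^bsub>presented R\<^esub>"
      by (intro bexI[of _ "cls R (- p)"]) (simp_all add: presented_cls)
  qed (auto elim!: carrier_presentedE simp: presented_cls algebra_simps)
  show "Group.monoid (presented R)"
    by unfold_locales (auto elim!: carrier_presentedE simp: presented_cls algebra_simps)
qed (auto elim!: carrier_presentedE simp: presented_cls algebra_simps)

lemma finsum_presented:
  assumes "finite A"
  shows "(\<Oplus>\<^bsub>presented R\<^esub>i\<in>A. cls R (f i)) = cls R (\<Sum>i\<in>A. f i)"
proof -
  interpret ring "presented R" by (rule ring_presented)
  show ?thesis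
    using assms by (induction A) (auto simp: presented_cls)
qed

lemma ideal_presentedI:
  assumes "ideal J free_algebra"
  shows "ideal (cls R ` J) (presented R)"
proof (rule idealI[OF ring_presented])
  have J: "0 \<in> J" "p \<in> J \<Longrightarrow> q \<in> J \<Longrightarrow> p + q \<in> J" "p \<in> J \<Longrightarrow> q * p \<in> J" "p \<in> J \<Longrightarrow> p * q \<in> J" for p q
    using additive_subgroup.zero_closed[OF ideal.axioms(1)[OF assms]]
      additive_subgroup.a_closed[OF ideal.axioms(1)[OF assms]]
      ideal.I_l_closed[OF assms] ideal.I_r_closed[OF assms]
    by (simp_all add: free_algebra_def)
  interpret P: ring "presented R" by (rule ring_presented)
  have inv: "\<ominus>\<^bsub>presented R\<^esub> cls R p = cls R (- p)" for p
    by (rule P.minus_equality) (simp_all add: presented_cls)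
  have "inv\<^bsub>add_monoid (presented R)\<^esub> cls R p \<in> cls R ` J" if "p \<in> J" for p
    using J(3)[OF that, of "- 1"] inv[of p] by (simp add: a_inv_def)
  then show "subgroup (cls R ` J) (add_monoid (presented R))"
    using J(1,2) by unfold_locales (auto simp: presented_cls)
  show "x \<otimes>\<^bsub>presented R\<^esub> a \<in> cls R ` J" if "a \<in> cls R ` J" "x \<in> carrier (presented R)" for a x
    using that J by (auto elim!: carrier_presentedE simp: presented_cls)
  show "a \<otimes>\<^bsub>presented R\<^esub> x \<in> cls R ` J" if "a \<in> cls R ` J" "x \<in> carrier (presented R)" for a x
    using that J by (auto elim!: carrier_presentedE simp: presented_cls)
qed

section \<open>Homomorphisms and skew derivations of free algebras\<close>

interpretation const_scale: vector_space "\<lambda>c p. const c * p :: ('k::field, 'g) free"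
  by (rule vector_space_const)

lemma const_mult_mult: "(const c * p) * (const d * q) = const (c * d) * (p * q)"
  by (simp only: mult.assoc const_left_commute[of p d q] const_mult)

definition subst :: "('g \<Rightarrow> ('k::field, 'h) free) \<Rightarrow> ('k, 'g) free \<Rightarrow> ('k, 'h) free" where
  "subst \<phi> = lin (\<lambda>c p. const c * p) (\<lambda>w. prod_list (map \<phi> w))"

lemma subst_single: "subst \<phi> (Poly_Mapping.single w c) = const c * prod_list (map \<phi> w)"
  by (simp add: subst_def)

lemma subst_add: "subst \<phi> (p + q) = subst \<phi> p + subst \<phi> q"
  by (simp add: subst_def const_scale.lin_add)

lemma subst_diff: "subst \<phi> (p - q) = subst \<phi> p - subst \<phi> q"
  by (simp add: subst_def const_scale.lin_diff)

lemma subst_zero [simp]: "subst \<phi> 0 = 0"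
  by (simp add: subst_def)

lemma subst_const [simp]: "subst \<phi> (const c) = const c"
  by (simp add: const_def[of c] subst_single)

lemma subst_one [simp]: "subst \<phi> 1 = 1"
  using subst_const[of \<phi> 1] by simp

lemma subst_gen [simp]: "subst \<phi> (gen l) = \<phi> l"
  by (simp add: gen_def subst_single)

lemma subst_mult: "subst \<phi> (p * q) = subst \<phi> p * subst \<phi> q"
proof (induction p rule: poly_mapping_induct_single)
  case (single v c)
  show ?case
  proof (induction q rule: poly_mapping_induct_single)
    case (single w d)
    show ?case
      by (simp add: mult_single plus_list_def subst_single const_mult_mult del: const_mult_single)
  qed (simp add: subst_add algebra_simps)
qed (simp add: subst_add algebra_simps)

lemma subst_power: "subst \<phi> (p ^ m) = subst \<phi> p ^ m"
  by (induction m) (simp_all add: subst_mult)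

lemma subst_subst: "subst \<phi> (subst \<psi> p) = subst (\<lambda>l. subst \<phi> (\<psi> l)) p"
proof (induction p rule: poly_mapping_induct_single)
  case (single w c)
  have "subst \<phi> (prod_list (map \<psi> w)) = prod_list (map (\<lambda>l. subst \<phi> (\<psi> l)) w)"
    by (induction w) (simp_all add: subst_mult)
  then show ?case by (simp add: subst_single subst_mult)
qed (simp add: subst_add)

lemma prod_list_gen: "prod_list (map gen w) = Poly_Mapping.single w 1"
  by (induction w) (simp_all add: single_Nil_one single_Cons)

lemma subst_id: "subst gen p = p"
  by (induction p rule: poly_mapping_induct_single) (simp_all add: subst_single subst_add prod_list_gen)

lemma subst_relation_ideal:
  assumes "p \<in> relation_ideal R" and "\<And>r. r \<in> R \<Longrightarrow> subst \<phi> r \<in> relation_ideal R'"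
  shows "subst \<phi> p \<in> relation_ideal R'"
  using assms(1)
proof (induction rule: relation_ideal_induct)
  case (sandwich r v w c)
  then show ?case
    unfolding subst_mult by (intro relation_ideal_mult_right relation_ideal_mult_left assms(2))
qed (simp_all add: subst_add relation_ideal_add)

text \<open>The recursion is the coproduct g tensor x + x tensor 1 evaluated on a product. It yields
  the skew derivation, twisted by \<open>\<phi>\<close> on the left, with the values
  \<open>\<delta>\<close> on the generators.\<close>

primrec skew_word :: "('g \<Rightarrow> ('k::field, 'g) free) \<Rightarrow> ('g \<Rightarrow> ('k, 'g) free) \<Rightarrow> 'g list \<Rightarrow> ('k, 'g) free" where
  "skew_word \<phi> \<delta> [] = 0"
| "skew_word \<phi> \<delta> (l # w) = \<phi> l * skew_word \<phi> \<delta> w + \<delta> l * Poly_Mapping.single w 1"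

definition skew :: "('g \<Rightarrow> ('k::field, 'g) free) \<Rightarrow> ('g \<Rightarrow> ('k, 'g) free) \<Rightarrow> ('k, 'g) free \<Rightarrow> ('k, 'g) free" where
  "skew \<phi> \<delta> = lin (\<lambda>c p. const c * p) (skew_word \<phi> \<delta>)"

lemma skew_single: "skew \<phi> \<delta> (Poly_Mapping.single w c) = const c * skew_word \<phi> \<delta> w"
  by (simp add: skew_def)

lemma skew_add: "skew \<phi> \<delta> (p + q) = skew \<phi> \<delta> p + skew \<phi> \<delta> q"
  by (simp add: skew_def const_scale.lin_add)

lemma skew_diff: "skew \<phi> \<delta> (p - q) = skew \<phi> \<delta> p - skew \<phi> \<delta> q"
  by (simp add: skew_def const_scale.lin_diff)

lemma skew_zero [simp]: "skew \<phi> \<delta> 0 = 0"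
  by (simp add: skew_def)

lemma skew_const [simp]: "skew \<phi> \<delta> (const c) = 0"
  by (simp add: const_def skew_single)

lemma skew_one [simp]: "skew \<phi> \<delta> 1 = 0"
  using skew_const[of \<phi> \<delta> 1] by simp

lemma skew_gen [simp]: "skew \<phi> \<delta> (gen l) = \<delta> l"
  by (simp add: gen_def skew_single single_Nil_one)

lemma skew_word_append:
  "skew_word \<phi> \<delta> (v @ w) =
    prod_list (map \<phi> v) * skew_word \<phi> \<delta> w + skew_word \<phi> \<delta> v * Poly_Mapping.single w 1"
  by (induction v) (simp_all add: single_append algebra_simps)

lemma skew_mult: "skew \<phi> \<delta> (p * q) = subst \<phi> p * skew \<phi> \<delta> q + skew \<phi> \<delta> p * q"
proof (induction p rule: poly_mapping_induct_single)
  case (single v c)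
  show ?case
  proof (induction q rule: poly_mapping_induct_single)
    case (single w d)
    have "Poly_Mapping.single w d = const d * Poly_Mapping.single w 1" by simp
    then show ?case
      unfolding mult_single plus_list_def skew_single subst_single skew_word_append
      by (simp only: distrib_left const_mult mult.assoc const_left_commute[of "prod_list (map \<phi> v)" d]
          const_left_commute[of "skew_word \<phi> \<delta> v" d])
  qed (simp add: skew_add algebra_simps)
qed (simp add: skew_add subst_add algebra_simps)

lemma skew_const_mult [simp]: "skew \<phi> \<delta> (const c * p) = const c * skew \<phi> \<delta> p"
  by (simp add: skew_mult)

text \<open>By the twisted product rule the image of v r w is a sum of three products whose middle
  factors are \<open>subst \<phi> r\<close>, \<open>skew \<phi> \<delta> r\<close> and r. Hence the
  twisting map must respect the relators as well.\<close>

lemma skew_relation_ideal: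
  assumes "p \<in> relation_ideal R" and "\<And>r. r \<in> R \<Longrightarrow> subst \<phi> r \<in> relation_ideal R"
    and "\<And>r. r \<in> R \<Longrightarrow> skew \<phi> \<delta> r \<in> relation_ideal R"
  shows "skew \<phi> \<delta> p \<in> relation_ideal R"
  using assms(1)
proof (induction rule: relation_ideal_induct)
  case (sandwich r v w c)
  show ?case
    unfolding skew_mult subst_mult distrib_right
    by (intro relation_ideal_add)
      (intro relation_ideal_mult_right relation_ideal_mult_left assms(2,3) sandwich
        relation_idealI; fail)+
qed (simp_all add: skew_add relation_ideal_add)

text \<open>Both sides obey the same product rule along \<open>\<psi>\<close>, so it suffices to
  compare generators. For an invertible linear \<open>\<psi>\<close> this is the conjugation of the
  pair (G, X) by a change of basis.\<close>

lemma skew_subst: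
  assumes "\<And>l. subst \<phi> (\<psi> l) = subst \<psi> (\<phi>' l)" and "\<And>l. skew \<phi> \<delta> (\<psi> l) = subst \<psi> (\<delta>' l)"
  shows "skew \<phi> \<delta> (subst \<psi> p) = subst \<psi> (skew \<phi>' \<delta>' p)"
proof (induction p rule: poly_mapping_induct_single)
  case (single w c)
  have "skew \<phi> \<delta> (prod_list (map \<psi> w)) = subst \<psi> (skew_word \<phi>' \<delta>' w)"
    by (induction w) (simp_all add: skew_mult subst_add subst_mult subst_single assms)
  then show ?case by (simp add: subst_single skew_single subst_mult)
qed (simp add: skew_add subst_add)


section \<open>Cubic relations\<close>

text \<open>The relators are functions of two arbitrary elements, so that linear changes of the
  generators and the exchange of u and v can be expressed by their arguments.\<close>

definition cubic1 :: "'k::field \<Rightarrow> 'k \<Rightarrow> ('k, 'g) free \<Rightarrow> ('k, 'g) free \<Rightarrow> ('k, 'g) free" where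
  "cubic1 \<alpha> \<beta> a b = b * b * a - const \<alpha> * (b * a * b) - const \<beta> * (a * b * b)"

definition cubic2 :: "'k::field \<Rightarrow> 'k \<Rightarrow> ('k, 'g) free \<Rightarrow> ('k, 'g) free \<Rightarrow> ('k, 'g) free" where
  "cubic2 \<alpha> \<beta> a b = b * a * a - const \<alpha> * (a * b * a) - const \<beta> * (a * a * b)"

lemma down_up_relations_cubic:
  "down_up_relations \<alpha> \<beta> = {cubic1 \<alpha> \<beta> (gen DU_u) (gen DU_v), cubic2 \<alpha> \<beta> (gen DU_u) (gen DU_v)}"
  by (simp add: down_up_relations_def cubic1_def cubic2_def Let_def mult.assoc)

definition lform :: "'k::field \<Rightarrow> 'k \<Rightarrow> ('k, down_up_gen) free" where
  "lform a b = const a * gen DU_u + const b * gen DU_v"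

fun sel :: "'k \<Rightarrow> 'k \<Rightarrow> down_up_gen \<Rightarrow> 'k" where
  "sel a b DU_u = a"
| "sel a b DU_v = b"

lemma lookup_const_mult [simp]:
  "Poly_Mapping.lookup (const c * p) w = c * Poly_Mapping.lookup p w"
proof -
  have "const c * p = Poly_Mapping.map ((*) c) p"
    by (simp add: mult_map_scale_conv_mult const_def zero_list_def)
  then show ?thesis by simp
qed

lemma lform_single: "lform a b = Poly_Mapping.single [DU_u] a + Poly_Mapping.single [DU_v] b"
  by (simp add: lform_def gen_def)



lemma lform_mult3:
  "lform a a' * lform b b' * lform c c' =
     Poly_Mapping.single [DU_u, DU_u, DU_u] (a * b * c) + Poly_Mapping.single [DU_u, DU_u, DU_v] (a * b * c') +
     Poly_Mapping.single [DU_u, DU_v, DU_u] (a * b' * c) + Poly_Mapping.single [DU_u, DU_v, DU_v] (a * b' * c') +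
     Poly_Mapping.single [DU_v, DU_u, DU_u] (a' * b * c) + Poly_Mapping.single [DU_v, DU_u, DU_v] (a' * b * c') +
     Poly_Mapping.single [DU_v, DU_v, DU_u] (a' * b' * c) + Poly_Mapping.single [DU_v, DU_v, DU_v] (a' * b' * c')"
  by (simp add: lform_single distrib_left distrib_right mult_single plus_list_def add_ac)

text \<open>Together with linearity this turns each coefficient comparison in degree three into a
  polynomial identity in the matrix entries.\<close>

lemma lookup_lform3:
  "Poly_Mapping.lookup (lform a a' * lform b b' * lform c c') w =
    (case w of [i, j, k] \<Rightarrow> sel a a' i * sel b b' j * sel c c' k | _ \<Rightarrow> 0)"
proof (cases "length w = 3")
  case True
  then obtain i j k where "w = [i, j, k]"
    by (auto simp: length_Suc_conv numeral_3_eq_3)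
  then show ?thesis
    by (cases i; cases j; cases k) (simp_all add: lform_mult3 lookup_add lookup_single)
next
  case False
  then have "[i, j, k] \<noteq> w" for i j k by auto
  then have "Poly_Mapping.lookup (lform a a' * lform b b' * lform c c') w = 0"
    by (simp add: lform_mult3 lookup_add lookup_single)
  moreover have "(case w of [i, j, k] \<Rightarrow> sel a a' i * sel b b' j * sel c c' k | _ \<Rightarrow> 0) = 0"
    using False by (auto split: list.split)
  ultimately show ?thesis by simp
qed

lemma gen_lform: "gen DU_u = lform 1 0" "gen DU_v = lform 0 1"
  by (simp_all add: lform_def)

text \<open>The relators are homogeneous of degree three, so the ideal contains nothing below that
  degree and only their span in it. The words v v u and v u u each occur in exactly one relator,
  with coefficient 1; the coefficients there are coordinates on the span and determine the other
  six.\<close>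

lemma down_up_relation_ideal_coeffs:
  assumes "p \<in> relation_ideal (down_up_relations \<alpha> \<beta>)"
  shows "length w < 3 \<Longrightarrow> Poly_Mapping.lookup p w = 0"
    and "Poly_Mapping.lookup p [DU_u, DU_u, DU_u] = 0"
    and "Poly_Mapping.lookup p [DU_v, DU_v, DU_v] = 0"
    and "Poly_Mapping.lookup p [DU_v, DU_u, DU_v] = - \<alpha> * Poly_Mapping.lookup p [DU_v, DU_v, DU_u]"
    and "Poly_Mapping.lookup p [DU_u, DU_v, DU_v] = - \<beta> * Poly_Mapping.lookup p [DU_v, DU_v, DU_u]"
    and "Poly_Mapping.lookup p [DU_u, DU_v, DU_u] = - \<alpha> * Poly_Mapping.lookup p [DU_v, DU_u, DU_u]"
    and "Poly_Mapping.lookup p [DU_u, DU_u, DU_v] = - \<beta> * Poly_Mapping.lookup p [DU_v, DU_u, DU_u]"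
proof -
  let ?P = "\<lambda>p. (\<forall>w. length w < 3 \<longrightarrow> Poly_Mapping.lookup p w = 0) \<and>
    Poly_Mapping.lookup p [DU_u, DU_u, DU_u] = 0 \<and>
    Poly_Mapping.lookup p [DU_v, DU_v, DU_v] = 0 \<and>
    Poly_Mapping.lookup p [DU_v, DU_u, DU_v] = - \<alpha> * Poly_Mapping.lookup p [DU_v, DU_v, DU_u] \<and>
    Poly_Mapping.lookup p [DU_u, DU_v, DU_v] = - \<beta> * Poly_Mapping.lookup p [DU_v, DU_v, DU_u] \<and>
    Poly_Mapping.lookup p [DU_u, DU_v, DU_u] = - \<alpha> * Poly_Mapping.lookup p [DU_v, DU_u, DU_u] \<and>
    Poly_Mapping.lookup p [DU_u, DU_u, DU_v] = - \<beta> * Poly_Mapping.lookup p [DU_v, DU_u, DU_u]"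
  have "?P p"
    using assms
  proof (induction rule: relation_ideal_induct)
    case (add p q)
    then show ?case by (simp add: lookup_add algebra_simps)
  next
    case (sandwich r v w c)
    have c1: "cubic1 \<alpha> \<beta> (gen DU_u) (gen DU_v) = Poly_Mapping.single [DU_v, DU_v, DU_u] 1
        - Poly_Mapping.single [DU_v, DU_u, DU_v] \<alpha> - Poly_Mapping.single [DU_u, DU_v, DU_v] \<beta>"
      by (simp add: cubic1_def gen_def mult_single plus_list_def)
    have c2: "cubic2 \<alpha> \<beta> (gen DU_u) (gen DU_v) = Poly_Mapping.single [DU_v, DU_u, DU_u] 1
        - Poly_Mapping.single [DU_u, DU_v, DU_u] \<alpha> - Poly_Mapping.single [DU_u, DU_u, DU_v] \<beta>"
      by (simp add: cubic2_def gen_def mult_single plus_list_def)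
    have "r = cubic1 \<alpha> \<beta> (gen DU_u) (gen DU_v) \<or> r = cubic2 \<alpha> \<beta> (gen DU_u) (gen DU_v)"
      using sandwich by (simp add: down_up_relations_cubic)
    then show ?case
    proof
      assume r: "r = cubic1 \<alpha> \<beta> (gen DU_u) (gen DU_v)"
      show ?case
        unfolding r c1
        \<comment> \<open>A nonempty outer word pushes every term to length at least four, so only
          empty \<open>v\<close> and \<open>w\<close> contribute.\<close>
        by (cases v; cases w) (auto simp: left_diff_distrib right_diff_distrib mult_single plus_list_def
          lookup_minus lookup_single when_def append_eq_Cons_conv)
    next
      assume r: "r = cubic2 \<alpha> \<beta> (gen DU_u) (gen DU_v)"
      show ?case
        unfolding r c2
        by (cases v; cases w) (auto simp: left_diff_distrib right_diff_distrib mult_single plus_list_def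
          lookup_minus lookup_single when_def append_eq_Cons_conv)
    qed
  qed simp
  then show "length w < 3 \<Longrightarrow> Poly_Mapping.lookup p w = 0"
    and "Poly_Mapping.lookup p [DU_u, DU_u, DU_u] = 0"
    and "Poly_Mapping.lookup p [DU_v, DU_v, DU_v] = 0"
    and "Poly_Mapping.lookup p [DU_v, DU_u, DU_v] = - \<alpha> * Poly_Mapping.lookup p [DU_v, DU_v, DU_u]"
    and "Poly_Mapping.lookup p [DU_u, DU_v, DU_v] = - \<beta> * Poly_Mapping.lookup p [DU_v, DU_v, DU_u]"
    and "Poly_Mapping.lookup p [DU_u, DU_v, DU_u] = - \<alpha> * Poly_Mapping.lookup p [DU_v, DU_u, DU_u]"
    and "Poly_Mapping.lookup p [DU_u, DU_u, DU_v] = - \<beta> * Poly_Mapping.lookup p [DU_v, DU_u, DU_u]"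
    by blast+
qed

section \<open>Skew derivations of the down-up algebra of degree zero\<close>

lemma subst_cubic:
  "subst \<phi> (cubic1 \<alpha> \<beta> a b) = cubic1 \<alpha> \<beta> (subst \<phi> a) (subst \<phi> b)"
  "subst \<phi> (cubic2 \<alpha> \<beta> a b) = cubic2 \<alpha> \<beta> (subst \<phi> a) (subst \<phi> b)"
  by (simp_all add: cubic1_def cubic2_def subst_diff subst_mult)

lemma skew_cubic:
  "skew (sel A B) (sel C D) (cubic1 \<alpha> \<beta> (gen DU_u) (gen DU_v)) =
    (B * B * C + B * D * lform 1 0 + D * lform 0 1 * lform 1 0)
    - const \<alpha> * (B * A * D + B * C * lform 0 1 + D * lform 1 0 * lform 0 1)
    - const \<beta> * (A * B * D + A * D * lform 0 1 + C * lform 0 1 * lform 0 1)"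
  "skew (sel A B) (sel C D) (cubic2 \<alpha> \<beta> (gen DU_u) (gen DU_v)) =
    (B * A * C + B * C * lform 1 0 + D * lform 1 0 * lform 1 0)
    - const \<alpha> * (A * B * C + A * D * lform 1 0 + C * lform 0 1 * lform 1 0)
    - const \<beta> * (A * A * D + A * C * lform 0 1 + C * lform 1 0 * lform 0 1)"
  by (simp_all add: cubic1_def cubic2_def skew_diff skew_mult subst_mult distrib_right distrib_left mult.assoc
      add_ac flip: gen_lform)

lemma lookup_lform3_eq_0:
  "length w \<noteq> 3 \<Longrightarrow> Poly_Mapping.lookup (lform a a' * lform b b' * lform c c') w = 0"
  unfolding lookup_lform3 by (auto split: list.split)

lemmas lookup_cubic = lookup_minus lookup_add lookup_const_mult lookup_lform3

text \<open>Write r1, r2 for \<open>cubic1\<close>, \<open>cubic2\<close> at the generators. The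
  coefficient of X(r2) at u u u says that 1/l is a root of T^2 - \<alpha> T - \<beta>; the other
  root is s/l. Comparing the coefficients of X(r1) at u v u and v u u then gives s^2 = \<omega>.
  Both equations read the same for a triangular G as for a diagonal one.\<close>

lemma skew_derivation_upper_triangular:
  fixes \<alpha> \<beta> :: "'k::field_char_0"
  assumes "l = \<omega> * \<mu>" "l \<noteq> 0" "q \<noteq> 0"
    and r: "\<And>r. r \<in> down_up_relations \<alpha> \<beta> \<Longrightarrow>
      skew (sel (lform l 0) (lform \<nu> \<mu>)) (sel (lform 0 0) (lform q 0)) r \<in> relation_ideal (down_up_relations \<alpha> \<beta>)"
  shows "\<exists>s. s ^ 2 = \<omega> \<and> \<alpha> = inverse l * (1 + s) \<and> \<beta> = - (inverse l ^ 2) * s"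
proof (intro exI conjI)
  define s where "s = \<alpha> * l - 1"
  note c1 = down_up_relation_ideal_coeffs[OF r[of "cubic1 \<alpha> \<beta> (gen DU_u) (gen DU_v)"]]
  note c2 = down_up_relation_ideal_coeffs[OF r[of "cubic2 \<alpha> \<beta> (gen DU_u) (gen DU_v)"]]
  have "q * (1 - \<alpha> * l - \<beta> * l * l) = 0"
    using c2(2) unfolding skew_cubic lookup_cubic by (simp add: down_up_relations_cubic algebra_simps)
  then have "1 - \<alpha> * l - \<beta> * l * l = 0"
    using \<open>q \<noteq> 0\<close> by (simp only: mult_eq_0_iff) simp
  then have b: "\<beta> * l * l = - s"
    unfolding s_def by Groebner_Basis.algebra
  have "q * (1 - \<beta> * l * \<mu>) = - \<alpha> * (q * (\<mu> - \<alpha> * l * \<mu>))"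
    using c1(6) unfolding skew_cubic lookup_cubic by (simp add: down_up_relations_cubic algebra_simps)
  then have "q * (1 - \<beta> * l * \<mu> - (- \<alpha> * (\<mu> - \<alpha> * l * \<mu>))) = 0"
    by (simp add: algebra_simps)
  then have "1 - \<beta> * l * \<mu> = - \<alpha> * (\<mu> - \<alpha> * l * \<mu>)"
    using \<open>q \<noteq> 0\<close> by (simp only: mult_eq_0_iff right_minus_eq) simp
  then have "\<omega> * (1 - \<beta> * l * \<mu>) = - \<alpha> * l * (1 - \<alpha> * l)"
    unfolding assms(1) by Groebner_Basis.algebra
  then have "\<omega> - \<beta> * l * l = (1 + s) * s"
    unfolding assms(1) s_def by Groebner_Basis.algebra
  then show "s ^ 2 = \<omega>" using b by Groebner_Basis.algebra
  show "\<alpha> = inverse l * (1 + s)" using \<open>l \<noteq> 0\<close> by (simp add: s_def field_simps)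
  show "\<beta> = - (inverse l ^ 2) * s"
    using b \<open>l \<noteq> 0\<close> by (simp add: power2_eq_square field_simps)
qed

text \<open>The mirror image, with X mapping u to a multiple of v. Now \<open>p4\<close> itself is a
  root of T^2 - \<alpha> T - \<beta>, the other root is p4 s, and comparing X(r2) with the second
  relator's companion coefficients at v u v and v v u gives p1 = p4 s^2.\<close>

lemma skew_derivation_lower_triangular:
  fixes \<alpha> \<beta> :: "'k::field_char_0"
  assumes "p4 = \<omega> * p1" "p4 \<noteq> 0" "q \<noteq> 0"
    and r: "\<And>r. r \<in> down_up_relations \<alpha> \<beta> \<Longrightarrow>
      skew (sel (lform p1 0) (lform 0 p4)) (sel (lform 0 q) (lform 0 0)) r \<in> relation_ideal (down_up_relations \<alpha> \<beta>)"
  shows "\<exists>s. s ^ 2 = inverse \<omega> \<and> \<alpha> = p4 * (1 + s) \<and> \<beta> = - (p4 ^ 2) * s"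
proof (intro exI conjI)
  define s where "s = \<alpha> / p4 - 1"
  have \<alpha>: "\<alpha> = p4 * (1 + s)" using assms by (simp add: s_def field_simps)
  note c1 = down_up_relation_ideal_coeffs[OF r[of "cubic1 \<alpha> \<beta> (gen DU_u) (gen DU_v)"]]
  note c2 = down_up_relation_ideal_coeffs[OF r[of "cubic2 \<alpha> \<beta> (gen DU_u) (gen DU_v)"]]
  have "q * (p4 * p4 - \<alpha> * p4 - \<beta>) = 0"
    using c1(3) unfolding skew_cubic lookup_cubic by (simp add: down_up_relations_cubic algebra_simps)
  then have "\<beta> = p4 * p4 - p4 * (1 + s) * p4"
    using \<open>q \<noteq> 0\<close> unfolding \<alpha> by simp
  then have \<beta>: "\<beta> = - (p4 ^ 2) * s" by (simp add: power2_eq_square algebra_simps)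
  have "q * (p4 * p1 - \<beta>) = - \<alpha> * (q * (p4 - \<alpha>))"
    using c2(4) unfolding skew_cubic lookup_cubic by (simp add: down_up_relations_cubic algebra_simps)
  then have "q * (p4 * p1 - \<beta> - (- \<alpha> * (p4 - \<alpha>))) = 0"
    by (simp add: algebra_simps)
  then have "p4 * p1 - \<beta> = - \<alpha> * (p4 - \<alpha>)"
    using \<open>q \<noteq> 0\<close> by (simp only: mult_eq_0_iff right_minus_eq) simp
  then have "p4 * (p1 - p4 * s ^ 2) = 0"
    unfolding \<alpha> \<beta> by (simp add: power2_eq_square algebra_simps)
  then have "\<omega> * (p1 * s ^ 2) = p1"
    using assms(1,2) by simp
  moreover have "p1 \<noteq> 0" "\<omega> \<noteq> 0" using assms by auto
  ultimately show "s ^ 2 = inverse \<omega>" by (simp add: field_simps)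
  show "\<alpha> = p4 * (1 + s)" "\<beta> = - (p4 ^ 2) * s" by (fact \<alpha> \<beta>)+
qed

text \<open>For these two choices of parameters all of \<open>GL\<^sub>2\<close> acts on the algebra.\<close>

lemma special_cubic:
  fixes \<alpha> \<beta> :: "'k::field_char_0"
  assumes "\<beta> = 1 \<and> \<alpha> = 0 \<or> \<beta> = -1 \<and> \<alpha> = 2" and "r \<in> down_up_relations \<alpha> \<beta>"
  shows "subst (sel (lform p1 p3) (lform p2 p4)) r \<in> relation_ideal (down_up_relations \<alpha> \<beta>)"
proof -
  let ?r1 = "cubic1 \<alpha> \<beta> (gen DU_u) (gen DU_v)" and ?r2 = "cubic2 \<alpha> \<beta> (gen DU_u) (gen DU_v)"
  let ?D = "p1 * p4 - p2 * p3"
  have cubic_eqI: "p = q"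
    if "\<And>i j k. Poly_Mapping.lookup p [i, j, k] = Poly_Mapping.lookup q [i, j, k]"
      and "\<And>w. length w \<noteq> 3 \<Longrightarrow> Poly_Mapping.lookup p w = Poly_Mapping.lookup q w" for p q :: "('k, down_up_gen) free"
  proof (rule poly_mapping_eqI)
    fix w :: "down_up_gen list"
    show "Poly_Mapping.lookup p w = Poly_Mapping.lookup q w"
    proof (cases "length w = 3")
      case True
      then obtain i j k where "w = [i, j, k]"
        by (auto simp: length_Suc_conv numeral_3_eq_3)
      then show ?thesis using that(1) by simp
    qed (rule that(2))
  qed
  \<comment> \<open>The two scalars are the coefficients of the left side at v v u and v u u. The
    determinant \<open>?D\<close> factors out of them because \<alpha> + \<beta> = 1 for both
    parameter pairs.\<close>
  have 1: "cubic1 \<alpha> \<beta> (lform p1 p3) (lform p2 p4) = const (p4 * ?D) * ?r1 + const (p2 * \<beta> * ?D) * ?r2"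
    (is "?l = ?r")
  proof (rule cubic_eqI)
    fix i j k :: down_up_gen
    show "Poly_Mapping.lookup ?l [i, j, k] = Poly_Mapping.lookup ?r [i, j, k]"
      unfolding cubic1_def cubic2_def gen_lform lookup_cubic using assms(1)
      by (cases i; cases j; cases k; elim disjE conjE; simp add: algebra_simps)
  qed (simp only: cubic1_def cubic2_def gen_lform lookup_minus lookup_add lookup_const_mult lookup_lform3_eq_0 not_False_eq_True mult_zero_right diff_zero add_0_right)
  have 2: "cubic2 \<alpha> \<beta> (lform p1 p3) (lform p2 p4) = const (p3 * \<beta> * ?D) * ?r1 + const (p1 * ?D) * ?r2"
    (is "?l = ?r")
  proof (rule cubic_eqI)
    fix i j k :: down_up_gen
    show "Poly_Mapping.lookup ?l [i, j, k] = Poly_Mapping.lookup ?r [i, j, k]"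
      unfolding cubic1_def cubic2_def gen_lform lookup_cubic using assms(1)
      by (cases i; cases j; cases k; elim disjE conjE; simp add: algebra_simps)
  qed (simp only: cubic1_def cubic2_def gen_lform lookup_minus lookup_add lookup_const_mult lookup_lform3_eq_0 not_False_eq_True mult_zero_right diff_zero add_0_right)
  have "?r1 \<in> relation_ideal (down_up_relations \<alpha> \<beta>)" "?r2 \<in> relation_ideal (down_up_relations \<alpha> \<beta>)"
    by (auto intro!: relation_idealI simp: down_up_relations_cubic)
  then have "cubic1 \<alpha> \<beta> (lform p1 p3) (lform p2 p4) \<in> relation_ideal (down_up_relations \<alpha> \<beta>)"
    "cubic2 \<alpha> \<beta> (lform p1 p3) (lform p2 p4) \<in> relation_ideal (down_up_relations \<alpha> \<beta>)"
    unfolding 1 2 by (simp_all add: relation_ideal_add relation_ideal_mult_left)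
  then show ?thesis
    using assms(2) by (auto simp: down_up_relations_cubic subst_cubic)
qed


lemma subst_sel_lform:
  "subst (sel (lform a b) (lform c d)) (lform p q) = lform (p * a + q * c) (p * b + q * d)"
  by (simp add: lform_def subst_add subst_mult algebra_simps)

lemma skew_sel_lform:
  "skew \<phi> (sel (lform a b) (lform c d)) (lform p q) = lform (p * a + q * c) (p * b + q * d)"
  by (simp add: lform_def skew_add algebra_simps)

text \<open>The change of generators is used in both directions: \<open>P\<close> carries the
  relators into the ideal, and \<open>P'\<close> brings the image under the skew derivation back, so
  that the triangular computation applies to the same algebra.\<close>

lemma skew_derivation_special:
  fixes \<alpha> \<beta> :: "'k::field_char_0"
  assumes special: "\<beta> = 1 \<and> \<alpha> = 0 \<or> \<beta> = -1 \<and> \<alpha> = 2"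
    and \<omega>: "\<omega> \<noteq> 1" and det: "p1 * p4 \<noteq> p2 * p3"
    and comm: "p1 * x1 + p2 * x3 = \<omega> * (x1 * p1 + x2 * p3)" "p1 * x2 - p2 * x1 = \<omega> * (x1 * p2 + x2 * p4)"
      "p3 * x1 + p4 * x3 = \<omega> * (x3 * p1 - x1 * p3)" "p3 * x2 - p4 * x1 = \<omega> * (x3 * p2 - x1 * p4)"
    and nil: "x1 * x1 + x2 * x3 = 0" "x1 \<noteq> 0 \<or> x2 \<noteq> 0 \<or> x3 \<noteq> 0"
    and r: "\<And>r. r \<in> down_up_relations \<alpha> \<beta> \<Longrightarrow>
      skew (sel (lform p1 p3) (lform p2 p4)) (sel (lform x1 x3) (lform x2 (- x1))) r
        \<in> relation_ideal (down_up_relations \<alpha> \<beta>)"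
    and g: "\<And>r. r \<in> down_up_relations \<alpha> \<beta> \<Longrightarrow>
      subst (sel (lform p1 p3) (lform p2 p4)) r \<in> relation_ideal (down_up_relations \<alpha> \<beta>)"
  shows False
proof -
  let ?I = "relation_ideal (down_up_relations \<alpha> \<beta>)"
  let ?G = "sel (lform p1 p3) (lform p2 p4)" and ?X = "sel (lform x1 x3) (lform x2 (- x1))"
  \<comment> \<open>In the basis \<open>a = X e\<close>, \<open>e\<close>, with \<open>e\<close> a vector not killed by \<open>X\<close>, the matrix of \<open>G\<close> is upper triangular.\<close>
  have no: "False" if l: "l = \<omega> * \<mu>" "l \<noteq> 0"
    and P: "\<And>j. subst ?G (P j) = subst P (sel (lform l 0) (lform \<nu> \<mu>) j)"
      "\<And>j. skew ?G ?X (P j) = subst P (sel (lform 0 0) (lform 1 0) j)"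
    and P': "\<And>j. subst P' (P j) = gen j" and PF: "P = sel (lform a a') (lform b b')"
    and P'F: "P' = sel (lform c c') (lform d d')"
    for l \<mu> \<nu> P P' a a' b b' c c' d d'
  proof -
    have "skew (sel (lform l 0) (lform \<nu> \<mu>)) (sel (lform 0 0) (lform 1 0)) r \<in> ?I" (is "?s \<in> _")
      if "r \<in> down_up_relations \<alpha> \<beta>" for r
    proof -
      have "subst P r \<in> ?I"
        unfolding PF using special that by (rule special_cubic)
      then have "skew ?G ?X (subst P r) \<in> ?I"
        by (rule skew_relation_ideal) (fact g r)+
      then have "subst P ?s \<in> ?I"
        by (subst (asm) skew_subst[OF P])
      then have "subst P' (subst P ?s) \<in> ?I"
        by (rule subst_relation_ideal) (unfold P'F, rule special_cubic[OF special])
      then show ?thesis by (simp add: subst_subst P' subst_id)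
    qed
    then obtain s where s: "s ^ 2 = \<omega>" "\<alpha> = inverse l * (1 + s)" "\<beta> = - (inverse l ^ 2) * s"
      using skew_derivation_upper_triangular[of l \<omega> \<mu> 1 \<alpha> \<beta> \<nu>] l by auto
    have "l * \<alpha> = 1 + s" "l ^ 2 * \<beta> = - s"
      using s(2,3) l(2) by (simp_all add: field_simps)
    \<comment> \<open>For (0, 1) the first equation gives s = -1. For (2, -1) eliminating
      \<open>l\<close> from 2 l = 1 + s and l^2 = s gives (s - 1)^2 = 0.\<close>
    then have "(s - 1) * (s + 1) = 0"
      using special
    proof (elim disjE conjE)
      assume "\<beta> = - 1" "\<alpha> = 2" "l * \<alpha> = 1 + s" "l ^ 2 * \<beta> = - s"
      then have "(s - 1) ^ 2 = 0" by Groebner_Basis.algebra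
      then show ?thesis by simp
    qed (simp add: add_eq_0_iff)
    then have "s = 1 \<or> s = - 1" by (simp add: eq_neg_iff_add_eq_0)
    then show False using s(1) \<omega> by auto
  qed
  show False
  proof (cases "x2 = 0")
    case False
    \<comment> \<open>Here e = v and a = X v = x2 u - x1 v. Writing G v = (p2 / x2) a + \<mu> v
      determines \<open>\<mu>\<close>, and the commutation relations give G a = \<omega> \<mu>
      a.\<close>
    define \<mu> where "\<mu> = (x1 * p2 + x2 * p4) / x2"
    have \<mu>: "\<mu> * x2 = x1 * p2 + x2 * p4" using False by (simp add: \<mu>_def)
    have l2: "x2 * p1 - x1 * p2 = \<omega> * \<mu> * x2"
      using comm(2) \<mu> by Groebner_Basis.algebra
    have "x2 * (x2 * p3 - x1 * p4 + \<omega> * \<mu> * x1) = 0"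
      using comm(4) \<mu> nil(1) by Groebner_Basis.algebra
    then have l1: "x2 * p3 - x1 * p4 = - (\<omega> * \<mu> * x1)"
      using False by (simp add: eq_neg_iff_add_eq_0)
    have l0: "\<omega> * \<mu> \<noteq> 0"
    proof
      assume "\<omega> * \<mu> = 0"
      then have "x2 * (p1 * p4 - p2 * p3) = 0" using l1 l2 by Groebner_Basis.algebra
      then show False using False det by simp
    qed
    have \<mu>': "p4 = \<mu> - p2 * x1 / x2" using False by (simp add: \<mu>_def field_simps)
    show False
    proof (rule no[OF refl l0])
      fix j :: down_up_gen
      show "subst ?G (sel (lform x2 (- x1)) (lform 0 1) j) =
          subst (sel (lform x2 (- x1)) (lform 0 1)) (sel (lform (\<omega> * \<mu>) 0) (lform (p2 / x2) \<mu>) j)"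
        using False l1 l2 \<mu>' by (cases j) (simp_all add: subst_sel_lform)
      show "skew ?G ?X (sel (lform x2 (- x1)) (lform 0 1) j) =
          subst (sel (lform x2 (- x1)) (lform 0 1)) (sel (lform 0 0) (lform 1 0) j)"
        using nil(1) by (cases j) (simp_all add: subst_sel_lform skew_sel_lform algebra_simps)
      show "subst (sel (lform (1 / x2) (x1 / x2)) (lform 0 1)) (sel (lform x2 (- x1)) (lform 0 1) j) = gen j"
        using False by (cases j) (simp_all add: subst_sel_lform gen_lform)
    qed (rule refl)+
  next
    case True
    \<comment> \<open>Now X kills v, so e = u and a = X u = x3 v.\<close>
    then have x: "x1 = 0" "x3 \<noteq> 0" using nil by auto
    have p: "p2 = 0" "p4 = \<omega> * p1" using comm(1,3) x True by auto
    have l0: "\<omega> * p1 \<noteq> 0" using det p by auto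
    show False
    proof (rule no[OF refl l0])
      fix j :: down_up_gen
      show "subst ?G (sel (lform 0 x3) (lform 1 0) j) =
          subst (sel (lform 0 x3) (lform 1 0)) (sel (lform (\<omega> * p1) 0) (lform (p3 / x3) p1) j)"
        using x p by (cases j) (simp_all add: subst_sel_lform ac_simps)
      show "skew ?G ?X (sel (lform 0 x3) (lform 1 0) j) =
          subst (sel (lform 0 x3) (lform 1 0)) (sel (lform 0 0) (lform 1 0) j)"
        using x True by (cases j) (simp_all add: subst_sel_lform skew_sel_lform)
      show "subst (sel (lform 0 1) (lform (1 / x3) 0)) (sel (lform 0 x3) (lform 1 0) j) = gen j"
        using x by (cases j) (simp_all add: subst_sel_lform gen_lform)
    qed (rule refl)+
  qed
qed

lemma skew_derivation_classification:
  fixes \<alpha> \<beta> :: "'k::field_char_0"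
  assumes "\<beta> \<noteq> 0" and \<omega>: "\<omega> \<noteq> 1" and det: "p1 * p4 \<noteq> p2 * p3"
    and comm: "p1 * x1 + p2 * x3 = \<omega> * (x1 * p1 + x2 * p3)" "p1 * x2 - p2 * x1 = \<omega> * (x1 * p2 + x2 * p4)"
      "p3 * x1 + p4 * x3 = \<omega> * (x3 * p1 - x1 * p3)" "p3 * x2 - p4 * x1 = \<omega> * (x3 * p2 - x1 * p4)"
    and nil: "x1 * x1 + x2 * x3 = 0" "x1 \<noteq> 0 \<or> x2 \<noteq> 0 \<or> x3 \<noteq> 0"
    and r: "\<And>r. r \<in> down_up_relations \<alpha> \<beta> \<Longrightarrow>
      skew (sel (lform p1 p3) (lform p2 p4)) (sel (lform x1 x3) (lform x2 (- x1))) r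
        \<in> relation_ideal (down_up_relations \<alpha> \<beta>)"
    and g: "\<And>r. r \<in> down_up_relations \<alpha> \<beta> \<Longrightarrow>
      subst (sel (lform p1 p3) (lform p2 p4)) r \<in> relation_ideal (down_up_relations \<alpha> \<beta>)"
  shows "p2 = 0 \<and> p3 = 0 \<and> x1 = 0 \<and>
    (x3 = 0 \<and> x2 \<noteq> 0 \<and> p1 = \<omega> * p4 \<and> (\<exists>s. s ^ 2 = \<omega> \<and> \<alpha> = inverse p1 * (1 + s) \<and> \<beta> = - (inverse p1 ^ 2) * s) \<or>
     x2 = 0 \<and> x3 \<noteq> 0 \<and> p4 = \<omega> * p1 \<and> (\<exists>s. s ^ 2 = inverse \<omega> \<and> \<alpha> = p4 * (1 + s) \<and> \<beta> = - (p4 ^ 2) * s))"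
proof -
  have mem: "cubic1 \<alpha> \<beta> (gen DU_u) (gen DU_v) \<in> down_up_relations \<alpha> \<beta>"
    "cubic2 \<alpha> \<beta> (gen DU_u) (gen DU_v) \<in> down_up_relations \<alpha> \<beta>"
    by (simp_all add: down_up_relations_cubic)
  note c1 = down_up_relation_ideal_coeffs[OF r[OF mem(1)]] and c2 = down_up_relation_ideal_coeffs[OF r[OF mem(2)]]
  have g1: "cubic1 \<alpha> \<beta> (lform p1 p3) (lform p2 p4) \<in> relation_ideal (down_up_relations \<alpha> \<beta>)"
    using g[OF mem(1)] by (simp add: subst_cubic)
  have g2: "cubic2 \<alpha> \<beta> (lform p1 p3) (lform p2 p4) \<in> relation_ideal (down_up_relations \<alpha> \<beta>)"
    using g[OF mem(2)] by (simp add: subst_cubic)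
  note d1 = down_up_relation_ideal_coeffs[OF g1, unfolded cubic1_def lookup_cubic, simplified]
    and d2 = down_up_relation_ideal_coeffs[OF g2, unfolded cubic2_def lookup_cubic, simplified]
  \<comment> \<open>The coefficient of G(r2) at u u u is p1^2 p2 (1 - \<alpha> - \<beta>), and that
    of G(r1) at v v v is p3 p4^2 (1 - \<alpha> - \<beta>). Both vanish, so an invertible G is
    diagonal or antidiagonal unless \<alpha> + \<beta> = 1.\<close>
  consider "p2 = 0" "p3 = 0" | "p1 = 0" "p4 = 0" "p2 \<noteq> 0" "p3 \<noteq> 0" |
    "\<alpha> + \<beta> = 1" "p2 \<noteq> 0 \<or> p3 \<noteq> 0"
  proof (cases "\<alpha> + \<beta> = 1")
    case False
    have "p1 * p1 * p2 * (1 - (\<alpha> + \<beta>)) = 0" using d2(2) by (simp add: algebra_simps)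
    then have "p1 = 0 \<or> p2 = 0" using False by simp
    moreover have "p3 * p4 * p4 * (1 - (\<alpha> + \<beta>)) = 0" using d1(3) by (simp add: algebra_simps)
    then have "p3 = 0 \<or> p4 = 0" using False by simp
    ultimately show thesis using that(1,2) det by auto
  qed (use that in blast)
  then show ?thesis
  proof cases
    case 1
    then have p: "p1 \<noteq> 0" "p4 \<noteq> 0" using det by auto
    have "p1 * x1 * (1 - \<omega>) = 0" using comm(1) 1 by (simp add: algebra_simps)
    then have x1: "x1 = 0" using p \<omega> by simp
    show ?thesis
    proof (cases "x2 = 0")
      case True
      then have x3: "x3 \<noteq> 0" using x1 nil by auto
      have p4: "p4 = \<omega> * p1" using comm(3) x1 x3 by simp
      from skew_derivation_lower_triangular[OF p4 p(2) x3, of \<alpha> \<beta>] r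
      show ?thesis using 1 x1 x3 True p4 by simp
    next
      case False
      then have x3: "x3 = 0" using x1 nil by auto
      have p1: "p1 = \<omega> * p4" using comm(2) x1 False by simp
      from skew_derivation_upper_triangular[OF p1 p(1) False, of \<alpha> \<beta> 0] r
      show ?thesis using 1 x1 x3 False p1 by simp
    qed
  next
    \<comment> \<open>Commutation forces \<omega> = -1, the coefficients of G(r1) and X(r1) force
      \<beta> = -1, and then X(r1) demands both x2 = - p2 x1 (at u u u) and x2 = p2 x1 (at u v u), a
      contradiction in characteristic zero.\<close>
    case 2
    have x1: "x1 \<noteq> 0"
    proof
      assume "x1 = 0"
      then show False using comm(1,4) nil 2 by auto
    qed
    have "x1 * p2 * (\<omega> + 1) = 0" using comm(2) 2 by (simp add: algebra_simps add_eq_0_iff)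
    then have \<omega>': "\<omega> = - 1" using x1 2 by (simp add: eq_neg_iff_add_eq_0)
    have px: "p2 * x3 = - p3 * x2" using comm(1) 2 \<omega>' by (simp add: algebra_simps)
    have \<beta>2: "\<beta> * \<beta> = 1" using d1(7) 2 by (simp add: algebra_simps)
    have "p2 * p2 * p3 * (\<alpha> * (1 + \<beta>)) = 0" using d1(6) 2 by Groebner_Basis.algebra
    then have \<alpha>\<beta>: "\<alpha> * (1 + \<beta>) = 0" using 2 by simp
    note c = c1[unfolded skew_cubic lookup_cubic, simplified]
    have uvv: "2 * \<beta> * x1 = - \<alpha> * p2 * (x3 - p3 * x1)" using c(5) 2 by (simp add: algebra_simps)
    then have "\<alpha> \<noteq> 0" using x1 \<open>\<beta> \<noteq> 0\<close> by auto
    then have \<beta>: "\<beta> = - 1" using \<alpha>\<beta> by (simp add: add_eq_0_iff)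
    have "p2 * (x2 + p2 * x1) = 0"
      using c(2) 2 by (simp add: algebra_simps)
    then have uuu: "x2 = - p2 * x1" using 2 by (simp add: eq_neg_iff_add_eq_0)
    have "x1 * (x1 - p2 * x3) = 0" using nil(1) uuu by Groebner_Basis.algebra
    then have x3: "p2 * x3 = x1" using x1 by simp
    have "x1 * (1 - p2 * p3) = 0" using px uuu x3 by Groebner_Basis.algebra
    then have pp: "p2 * p3 = 1" using x1 by simp
    have "x2 - p2 * x1 - \<alpha> * (p2 * p3 * x2) = - \<alpha> * (p2 * p3 * x2)"
      using c(6) 2 \<beta> by (simp add: algebra_simps)
    then have False using uuu x1 2 by simp
    then show ?thesis ..
  next
    case 3
    have D: "p1 * p4 - p2 * p3 \<noteq> 0" using det by simp
    have \<alpha>: "\<alpha> = 1 - \<beta>" using 3(1) by (simp add: eq_diff_eq)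
    \<comment> \<open>Once \<alpha> = 1 - \<beta> is inserted, these coefficient conditions are an
      off-diagonal entry times the determinant of G times an expression in the parameters
      alone.\<close>
    have "p2 * ((p1 * p4 - p2 * p3) * (1 - \<beta> ^ 2)) = 0" "p2 * ((p1 * p4 - p2 * p3) * (\<alpha> * (1 + \<beta>))) = 0"
      using d1(6,7) unfolding \<alpha> by Groebner_Basis.algebra+
    moreover have "p3 * ((p1 * p4 - p2 * p3) * (1 - \<beta> ^ 2)) = 0" "p3 * ((p1 * p4 - p2 * p3) * (\<alpha> * (1 + \<beta>))) = 0"
      using d2(4,5) unfolding \<alpha> by Groebner_Basis.algebra+
    ultimately have "1 - \<beta> ^ 2 = 0" "\<alpha> * (1 + \<beta>) = 0"
      using D 3(2) by auto
    then have "\<beta> = 1 \<and> \<alpha> = 0 \<or> \<beta> = - 1 \<and> \<alpha> = 2"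
      using \<alpha> by (auto simp: power2_eq_1_iff)
    from skew_derivation_special[OF this \<omega> det comm nil r g] show ?thesis by blast
  qed
qed

section \<open>The Taft algebra\<close>

interpretation tensor_scale: vector_space "\<lambda>c. Poly_Mapping.map ((*) c) :: ('a \<Rightarrow>\<^sub>0 'k::field) \<Rightarrow> _"
  by (rule vector_space_scale)

lemma taft_simps [simp]:
  "carrier (taft n \<omega>) = carrier (presented (taft_relations n \<omega>))"
  "mult (taft n \<omega>) = mult (presented (taft_relations n \<omega>))"
  "one (taft n \<omega>) = one (presented (taft_relations n \<omega>))"
  "zero (taft n \<omega>) = zero (presented (taft_relations n \<omega>))"
  "add (taft n \<omega>) = add (presented (taft_relations n \<omega>))"
  "smult (taft n \<omega>) = smult (presented (taft_relations n \<omega>))"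
  "comult (taft n \<omega>) h = (\<Union>p\<in>h. tensor_class (taft_algebra n \<omega>) (taft_algebra n \<omega>) (taft_comult_free n \<omega> p))"
  "counit (taft n \<omega>) h = the_elem (taft_counit_free ` h)"
  "antipode (taft n \<omega>) h = (\<Union>p\<in>h. cls (taft_relations n \<omega>) (taft_antipode_free n p))"
  by (simp_all add: taft_def Let_def taft_algebra_def)

lemma tensor_mult_lin:
  "tensor_mult V W s t = lin (\<lambda>c. Poly_Mapping.map ((*) c))
    (\<lambda>p. lin (\<lambda>c. Poly_Mapping.map ((*) c))
      (\<lambda>q. Poly_Mapping.single (fst p \<otimes>\<^bsub>V\<^esub> fst q, snd p \<otimes>\<^bsub>W\<^esub> snd q) (1::'k::field)) t) s"
  by (simp add: tensor_mult_def lin_def tensor_scale.scale_sum_right case_prod_beta)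

lemma tensor_mult_single:
  "tensor_mult V W (Poly_Mapping.single (a, b) r) (Poly_Mapping.single (c, d) r') =
    Poly_Mapping.single (a \<otimes>\<^bsub>V\<^esub> c, b \<otimes>\<^bsub>W\<^esub> d) (r * r' :: 'k::field)"
  by (simp add: tensor_mult_lin)

lemma tensor_mult_add_left:
  "tensor_mult V W (s + s') t = tensor_mult V W s t + tensor_mult V W s' (t :: _ \<Rightarrow>\<^sub>0 'k::field)"
  by (simp add: tensor_mult_lin tensor_scale.lin_add)

lemma taft_comult_free_lin:
  "taft_comult_free n \<omega> = lin (\<lambda>c. Poly_Mapping.map ((*) c)) (taft_comult_word n \<omega>)"
  by (simp add: fun_eq_iff taft_comult_free_def lin_def)

lemma self_in_tensor_class: "t \<in> tensor_class V W t"
  unfolding tensor_class_def using tensor_null.zero by force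

lemma taft_comult_free_in_comult:
  "taft_comult_free n \<omega> p \<in> comult (taft n \<omega>) (cls (taft_relations n \<omega>) p)"
  unfolding taft_simps by (rule UN_I[OF self_in_cls self_in_tensor_class])

text \<open>A Hopf action satisfies its product axiom at every representative of a coproduct, so
  this explicit one, and the next one for x, suffice to read off how g and x act on
  products.\<close>

lemma comult_taft_g:
  "Poly_Mapping.single (taft_g n \<omega>, taft_g n \<omega>) 1 \<in> comult (taft n \<omega>) (taft_g n \<omega>)"
proof -
  have "taft_comult_free n \<omega> (gen Taft_g) = Poly_Mapping.single (taft_g n \<omega>, taft_g n \<omega>) 1"
    by (simp add: taft_comult_free_lin gen_def tensor_mult_single taft_g_def taft_algebra_def presented_cls)
  then show ?thesis
    using taft_comult_free_in_comult[of n \<omega> "gen Taft_g"] by (simp only: taft_g_def)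
qed

lemma comult_taft_x:
  "Poly_Mapping.single (taft_g n \<omega>, taft_x n \<omega>) 1
     + Poly_Mapping.single (taft_x n \<omega>, \<one>\<^bsub>taft n \<omega>\<^esub>) 1 \<in> comult (taft n \<omega>) (taft_x n \<omega>)"
proof -
  have "taft_comult_free n \<omega> (gen Taft_x) = Poly_Mapping.single (taft_g n \<omega>, taft_x n \<omega>) 1
     + Poly_Mapping.single (taft_x n \<omega>, \<one>\<^bsub>taft n \<omega>\<^esub>) 1"
    by (simp add: taft_comult_free_lin gen_def tensor_mult_single tensor_mult_add_left taft_g_def taft_x_def
        taft_algebra_def presented_cls)
  then show ?thesis
    using taft_comult_free_in_comult[of n \<omega> "gen Taft_x"] by (simp only: taft_x_def)
qed

lemma taft_generators_in_carrier [simp]: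
  "taft_g n \<omega> \<in> carrier (presented (taft_relations n \<omega>))"
  "taft_x n \<omega> \<in> carrier (presented (taft_relations n \<omega>))"
  by (simp_all add: taft_g_def taft_x_def)

lemma finsum_lin_cls:
  "(\<Oplus>\<^bsub>presented R\<^esub>p\<in>Poly_Mapping.keys t. Poly_Mapping.lookup t p \<odot>\<^bsub>presented R\<^esub> cls R (f p))
    = cls R (lin (\<lambda>c p. const c * p) f t)"
  by (simp add: smult_presented finsum_presented lin_def)


section \<open>The counit on representatives\<close>

lemma taft_counit_free_lin: "taft_counit_free = lin (*) (\<lambda>w. prod_list (map taft_counit_gen w))"
  by (simp add: fun_eq_iff taft_counit_free_def lin_def)

lemmas scalar_lin [simp] = vector_space.lin_single[OF vector_space_mult] vector_space.lin_zero[OF vector_space_mult]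
  and scalar_lin_add = vector_space.lin_add[OF vector_space_mult]
  and scalar_lin_diff = vector_space.lin_diff[OF vector_space_mult]

lemma taft_counit_free_gen [simp]: "taft_counit_free (gen l) = taft_counit_gen l"
  by (simp add: taft_counit_free_lin gen_def)

lemma taft_counit_free_const [simp]: "taft_counit_free (const c) = c"
  by (simp add: taft_counit_free_lin const_def)

lemma taft_counit_free_one [simp]: "taft_counit_free 1 = 1"
  using taft_counit_free_const[of 1] by simp

lemma taft_counit_free_add: "taft_counit_free (p + q) = taft_counit_free p + taft_counit_free q"
  by (simp add: taft_counit_free_lin scalar_lin_add)

lemma taft_counit_free_diff: "taft_counit_free (p - q) = taft_counit_free p - taft_counit_free q"
  by (simp add: taft_counit_free_lin scalar_lin_diff)

lemma taft_counit_free_mult: "taft_counit_free (p * q) = taft_counit_free p * taft_counit_free q"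
proof (induction p rule: poly_mapping_induct_single)
  case (single v c)
  show ?case
    by (induction q rule: poly_mapping_induct_single)
      (simp_all add: mult_single plus_list_def taft_counit_free_lin scalar_lin_add ring_distribs)
qed (simp add: taft_counit_free_add ring_distribs)

lemma taft_counit_free_power: "taft_counit_free (p ^ m) = taft_counit_free p ^ m"
  by (induction m) (simp_all add: taft_counit_free_mult)

lemma taft_counit_free_relation_ideal:
  assumes "p \<in> relation_ideal (taft_relations n \<omega>)" and "n > 0"
  shows "taft_counit_free p = 0"
  using assms(1)
proof (induction rule: relation_ideal_induct)
  case (sandwich r v w c)
  then have "taft_counit_free r = 0"
    using \<open>n > 0\<close> by (auto simp: taft_relations_def Let_def taft_counit_free_diff taft_counit_free_mult taft_counit_free_power)
  then show ?case by (simp add: taft_counit_free_mult)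
qed (simp_all add: taft_counit_free_lin scalar_lin_add)

lemma counit_taft:
  assumes "n > 0"
  shows "counit (taft n \<omega>) (cls (taft_relations n \<omega>) p) = taft_counit_free p"
proof -
  have "taft_counit_free q = taft_counit_free p" if "q \<in> cls (taft_relations n \<omega>) p" for q
    using taft_counit_free_relation_ideal[of "q - p" n \<omega>] that assms
    by (simp add: in_cls_iff taft_counit_free_diff)
  then have "taft_counit_free ` cls (taft_relations n \<omega>) p = {taft_counit_free p}"
    using self_in_cls[of p] by blast
  then show ?thesis by simp
qed


section \<open>Hopf actions of the Taft algebra on presented algebras\<close>

locale taft_action =
  fixes n :: nat and \<omega> :: "'k::field" and R :: "('k, 'g) free set"
    and act :: "('k, taft_gen) free set \<Rightarrow> ('k, 'g) free set \<Rightarrow> ('k, 'g) free set"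
  assumes n_pos: "n > 0" and hopf_action: "hopf_action (taft n \<omega>) (presented R) act"
begin

abbreviation A where "A \<equiv> presented R"
abbreviation T where "T \<equiv> presented (taft_relations n \<omega>)"

lemma module_act: "left_module (taft n \<omega>) A act"
  using hopf_action by (simp only: hopf_action_def)

lemma act_closed: "h \<in> carrier T \<Longrightarrow> a \<in> carrier A \<Longrightarrow> act h a \<in> carrier A"
  and act_add: "h \<in> carrier T \<Longrightarrow> a \<in> carrier A \<Longrightarrow> b \<in> carrier A \<Longrightarrow> act h (a \<oplus>\<^bsub>A\<^esub> b) = act h a \<oplus>\<^bsub>A\<^esub> act h b"
  and act_smult: "h \<in> carrier T \<Longrightarrow> a \<in> carrier A \<Longrightarrow> act h (c \<odot>\<^bsub>A\<^esub> a) = c \<odot>\<^bsub>A\<^esub> act h a"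
  and add_act: "h \<in> carrier T \<Longrightarrow> k \<in> carrier T \<Longrightarrow> a \<in> carrier A \<Longrightarrow> act (h \<oplus>\<^bsub>T\<^esub> k) a = act h a \<oplus>\<^bsub>A\<^esub> act k a"
  and smult_act: "h \<in> carrier T \<Longrightarrow> a \<in> carrier A \<Longrightarrow> act (c \<odot>\<^bsub>T\<^esub> h) a = c \<odot>\<^bsub>A\<^esub> act h a"
  and mult_act: "h \<in> carrier T \<Longrightarrow> k \<in> carrier T \<Longrightarrow> a \<in> carrier A \<Longrightarrow> act (h \<otimes>\<^bsub>T\<^esub> k) a = act h (act k a)"
  and one_act: "a \<in> carrier A \<Longrightarrow> act \<one>\<^bsub>T\<^esub> a = a"
  using module_act unfolding left_module_def taft_simps by simp_all

lemma act_one: "h \<in> carrier T \<Longrightarrow> act h \<one>\<^bsub>A\<^esub> = counit (taft n \<omega>) h \<odot>\<^bsub>A\<^esub> \<one>\<^bsub>A\<^esub>"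
  using hopf_action unfolding hopf_action_def taft_simps(1) by (elim conjE) (erule bspec)

lemma act_mult:
  assumes "h \<in> carrier T" "a \<in> carrier A" "b \<in> carrier A" "t \<in> comult (taft n \<omega>) h"
  shows "act h (a \<otimes>\<^bsub>A\<^esub> b) = (\<Oplus>\<^bsub>A\<^esub>p\<in>Poly_Mapping.keys t.
             Poly_Mapping.lookup t p \<odot>\<^bsub>A\<^esub> (act (fst p) a \<otimes>\<^bsub>A\<^esub> act (snd p) b))"
proof -
  have "\<forall>h\<in>carrier T. \<forall>a\<in>carrier A. \<forall>b\<in>carrier A. \<forall>t\<in>comult (taft n \<omega>) h.
      act h (a \<otimes>\<^bsub>A\<^esub> b) = (\<Oplus>\<^bsub>A\<^esub>p\<in>Poly_Mapping.keys t.
             Poly_Mapping.lookup t p \<odot>\<^bsub>A\<^esub> (act (fst p) a \<otimes>\<^bsub>A\<^esub> act (snd p) b))"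
    using hopf_action unfolding hopf_action_def taft_simps(1) by (elim conjE)
  from this[rule_format, OF assms] show ?thesis .
qed

lemma act_mult_lin:
  assumes "h \<in> carrier T" "t \<in> comult (taft n \<omega>) h" "Poly_Mapping.keys t \<subseteq> carrier T \<times> carrier T"
    and a: "\<And>k. k \<in> carrier T \<Longrightarrow> act k (cls R a) = cls R (a' k)"
    and b: "\<And>k. k \<in> carrier T \<Longrightarrow> act k (cls R b) = cls R (b' k)"
  shows "act h (cls R (a * b)) = cls R (lin (\<lambda>c p. const c * p) (\<lambda>p. a' (fst p) * b' (snd p)) t)"
proof -
  interpret A: ring A by (rule ring_presented)
  have "act h (cls R (a * b)) = (\<Oplus>\<^bsub>A\<^esub>p\<in>Poly_Mapping.keys t.
             Poly_Mapping.lookup t p \<odot>\<^bsub>A\<^esub> (act (fst p) (cls R a) \<otimes>\<^bsub>A\<^esub> act (snd p) (cls R b)))"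
    using act_mult[OF assms(1) _ _ assms(2), of "cls R a" "cls R b"] by (simp add: presented_cls)
  also have "\<dots> = (\<Oplus>\<^bsub>A\<^esub>p\<in>Poly_Mapping.keys t.
             Poly_Mapping.lookup t p \<odot>\<^bsub>A\<^esub> cls R (a' (fst p) * b' (snd p)))"
    using assms(3) a b
    by (intro A.finsum_cong') (auto simp: presented_cls)
  finally show ?thesis by (simp add: finsum_lin_cls)
qed

text \<open>A choice of representatives uniform in the Taft element, so that the sum over a
  coproduct can be evaluated inside the free algebra.\<close>

lemma act_rep:
  obtains f where "\<And>k. k \<in> carrier T \<Longrightarrow> act k (cls R a) = cls R (f k)"
proof -
  have "\<forall>k\<in>carrier T. \<exists>q. act k (cls R a) = cls R q"
    using act_closed[OF _ cls_in_carrier, of _ a] by (meson carrier_presentedE)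
  then show thesis using that by metis
qed

lemma act_g_mult: "act (taft_g n \<omega>) (cls R (a * b)) = act (taft_g n \<omega>) (cls R a) \<otimes>\<^bsub>A\<^esub> act (taft_g n \<omega>) (cls R b)"
proof -
  obtain a' where a': "\<And>k. k \<in> carrier T \<Longrightarrow> act k (cls R a) = cls R (a' k)"
    using act_rep[of a] by blast
  obtain b' where b': "\<And>k. k \<in> carrier T \<Longrightarrow> act k (cls R b) = cls R (b' k)"
    using act_rep[of b] by blast
  show ?thesis
    using act_mult_lin[OF _ comult_taft_g _ a' b'] a' b' by (simp add: presented_cls)
qed

lemma act_x_mult: "act (taft_x n \<omega>) (cls R (a * b)) =
  act (taft_g n \<omega>) (cls R a) \<otimes>\<^bsub>A\<^esub> act (taft_x n \<omega>) (cls R b) \<oplus>\<^bsub>A\<^esub> act (taft_x n \<omega>) (cls R a) \<otimes>\<^bsub>A\<^esub> cls R b"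
proof -
  obtain a' where a': "\<And>k. k \<in> carrier T \<Longrightarrow> act k (cls R a) = cls R (a' k)"
    using act_rep[of a] by blast
  obtain b' where b': "\<And>k. k \<in> carrier T \<Longrightarrow> act k (cls R b) = cls R (b' k)"
    using act_rep[of b] by blast
  let ?t = "Poly_Mapping.single (taft_g n \<omega>, taft_x n \<omega>) 1
     + Poly_Mapping.single (taft_x n \<omega>, \<one>\<^bsub>T\<^esub>) (1::'k)"
  have one: "\<one>\<^bsub>T\<^esub> \<in> carrier T" by (simp add: one_presented)
  then have "Poly_Mapping.keys ?t \<subseteq> carrier T \<times> carrier T"
    using keys_add[of "Poly_Mapping.single (taft_g n \<omega>, taft_x n \<omega>) (1::'k)"] by fastforce
  \<comment> \<open>The unit in x tensor 1 acts through a chosen representative, which equals b only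
    as a class.\<close>
  moreover have "cls R b = cls R (b' \<one>\<^bsub>T\<^esub>)"
    using b'[OF one] one_act by simp
  ultimately show ?thesis
    using act_mult_lin[OF _ comult_taft_x _ a' b'] a' b'
    by (simp add: presented_cls(2-5) const_scale.lin_add one)
qed

lemma act_zero: "h \<in> carrier T \<Longrightarrow> act h (cls R 0) = cls R 0"
  using act_smult[of h "cls R 0" 0] act_closed[of h "cls R 0"]
  by (auto elim!: carrier_presentedE simp: smult_presented)

lemma act_g_one: "act (taft_g n \<omega>) (cls R 1) = cls R 1"
  using act_one[of "taft_g n \<omega>"] counit_taft[OF n_pos, of \<omega> "gen Taft_g"]
  by (simp only: taft_generators_in_carrier taft_g_def one_presented smult_presented cls_in_carrier) simp

lemma act_x_one: "act (taft_x n \<omega>) (cls R 1) = cls R 0"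
  using act_one[of "taft_x n \<omega>"] counit_taft[OF n_pos, of \<omega> "gen Taft_x"]
  by (simp only: taft_generators_in_carrier taft_x_def one_presented smult_presented cls_in_carrier) simp

lemma act_g_cls:
  assumes "\<And>l. act (taft_g n \<omega>) (cls R (gen l)) = cls R (G l)"
  shows "act (taft_g n \<omega>) (cls R p) = cls R (subst G p)"
proof (induction p rule: poly_mapping_induct_single)
  case (single w c)
  have "act (taft_g n \<omega>) (cls R (Poly_Mapping.single w 1)) = cls R (prod_list (map G w))"
    by (induction w) (simp_all add: single_Nil_one act_g_one single_Cons act_g_mult assms mult_presented)
  then show ?case
    using act_smult[of "taft_g n \<omega>" "cls R (Poly_Mapping.single w 1)" c]
    by (simp add: smult_presented subst_single)
next
  case (add p q)
  then show ?case
    using act_add[of "taft_g n \<omega>" "cls R p" "cls R q"] by (simp add: add_presented subst_add)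
qed

lemma act_x_cls:
  assumes G: "\<And>l. act (taft_g n \<omega>) (cls R (gen l)) = cls R (G l)"
    and X: "\<And>l. act (taft_x n \<omega>) (cls R (gen l)) = cls R (X l)"
  shows "act (taft_x n \<omega>) (cls R p) = cls R (skew G X p)"
proof (induction p rule: poly_mapping_induct_single)
  case (single w c)
  have "act (taft_x n \<omega>) (cls R (Poly_Mapping.single w 1)) = cls R (skew_word G X w)"
    by (induction w) (simp_all add: single_Nil_one act_x_one single_Cons act_x_mult G X presented_cls(2-5))
  then show ?case
    using act_smult[of "taft_x n \<omega>" "cls R (Poly_Mapping.single w 1)" c]
    by (simp add: smult_presented skew_single)
next
  case (add p q)
  then show ?case
    using act_add[of "taft_x n \<omega>" "cls R p" "cls R q"] by (simp add: add_presented skew_add)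
qed

lemma subst_g_relation_ideal:
  assumes "\<And>l. act (taft_g n \<omega>) (cls R (gen l)) = cls R (G l)" and "p \<in> relation_ideal R"
  shows "subst G p \<in> relation_ideal R"
proof -
  have "cls R p = cls R 0" using assms by (simp add: cls_eq_zero_iff)
  then have "cls R (subst G p) = act (taft_g n \<omega>) (cls R 0)"
    by (metis act_g_cls[OF assms(1)])
  then show ?thesis by (simp add: act_zero cls_eq_zero_iff)
qed

lemma skew_x_relation_ideal:
  assumes "\<And>l. act (taft_g n \<omega>) (cls R (gen l)) = cls R (G l)"
    and "\<And>l. act (taft_x n \<omega>) (cls R (gen l)) = cls R (X l)" and "p \<in> relation_ideal R"
  shows "skew G X p \<in> relation_ideal R"
proof -
  have "cls R p = cls R 0" using assms by (simp add: cls_eq_zero_iff)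
  then have "cls R (skew G X p) = act (taft_x n \<omega>) (cls R 0)"
    by (metis act_x_cls[OF assms(1,2)])
  then show ?thesis by (simp add: act_zero cls_eq_zero_iff)
qed

lemma act_power:
  assumes "\<And>p. act (cls (taft_relations n \<omega>) h) (cls R p) = cls R (f p)"
  shows "act (cls (taft_relations n \<omega>) (h ^ m)) (cls R p) = cls R ((f ^^ m) p)"
proof (induction m)
  case 0
  show ?case using one_act[of "cls R p"] by (simp add: one_presented)
next
  case (Suc m)
  then show ?case
    using mult_act[of "cls (taft_relations n \<omega>) h" "cls (taft_relations n \<omega>) (h ^ m)" "cls R p"]
    by (simp add: mult_presented assms)
qed

text \<open>The Taft relators become operator identities modulo the ideal of A. For the down-up
  algebra that ideal starts in degree three, so on linear forms they turn into exact matrix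
  identities.\<close>

lemma taft_relations_act:
  assumes G: "\<And>l. act (taft_g n \<omega>) (cls R (gen l)) = cls R (G l)"
    and X: "\<And>l. act (taft_x n \<omega>) (cls R (gen l)) = cls R (X l)"
  shows "(subst G ^^ n) p - p \<in> relation_ideal R"
    and "(skew G X ^^ n) p \<in> relation_ideal R"
    and "subst G (skew G X p) - const \<omega> * skew G X (subst G p) \<in> relation_ideal R"
proof -
  let ?c = "cls (taft_relations n \<omega>)" and ?I = "relation_ideal (taft_relations n \<omega>)"
  have g: "act (?c (gen Taft_g)) (cls R q) = cls R (subst G q)"
    and x: "act (?c (gen Taft_x)) (cls R q) = cls R (skew G X q)" for q
    using act_g_cls[OF G] act_x_cls[OF G X] by (simp_all add: taft_g_def taft_x_def)
  have rel: "gen Taft_g ^ n - 1 \<in> ?I" "gen Taft_x ^ n - 0 \<in> ?I"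
      "gen Taft_g * gen Taft_x - const \<omega> * gen Taft_x * gen Taft_g \<in> ?I"
    by (rule relation_idealI; simp add: taft_relations_def Let_def)+
  have "?c (gen Taft_g ^ n) = ?c 1" "?c (gen Taft_x ^ n) = ?c 0"
      "?c (gen Taft_g * gen Taft_x) = ?c (const \<omega> * (gen Taft_x * gen Taft_g))"
    using rel by (simp_all add: cls_eq_iff mult.assoc)
  moreover have "act (?c 1) (cls R p) = cls R p"
    using one_act[of "cls R p"] by (simp add: one_presented)
  moreover have "act (?c 0) (cls R p) = cls R 0"
    using smult_act[of "?c 0" "cls R p" 0] act_closed[of "?c 0" "cls R p"]
    by (auto elim!: carrier_presentedE simp: smult_presented)
  moreover have "act (?c (gen Taft_g * gen Taft_x)) (cls R p) = cls R (subst G (skew G X p))"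
    using mult_act[of "?c (gen Taft_g)" "?c (gen Taft_x)" "cls R p"] by (simp add: mult_presented g x)
  moreover have "act (?c (const \<omega> * (gen Taft_x * gen Taft_g))) (cls R p) = cls R (const \<omega> * skew G X (subst G p))"
    using mult_act[of "?c (gen Taft_x)" "?c (gen Taft_g)" "cls R p"]
      smult_act[of "?c (gen Taft_x * gen Taft_g)" "cls R p" \<omega>]
    by (simp add: mult_presented smult_presented g x)
  ultimately have "cls R ((subst G ^^ n) p) = cls R p" "cls R ((skew G X ^^ n) p) = cls R 0"
    "cls R (subst G (skew G X p)) = cls R (const \<omega> * skew G X (subst G p))"
    using act_power[OF g, of n p] act_power[OF x, of n p] by simp_all
  then show "(subst G ^^ n) p - p \<in> relation_ideal R"
    "(skew G X ^^ n) p \<in> relation_ideal R"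
    "subst G (skew G X p) - const \<omega> * skew G X (subst G p) \<in> relation_ideal R"
    by (simp_all add: cls_eq_iff)
qed

end

section \<open>Congruences, supports of formal tensors, and the ring structure of the Taft
  algebra\<close>

lemma cls_mult_cong:
  "cls R p = cls R p' \<Longrightarrow> cls R q = cls R q' \<Longrightarrow> cls R (p * q) = cls R (p' * q')"
  by (simp flip: mult_presented)

lemma cls_power_cong: "cls R p = cls R q \<Longrightarrow> cls R (p ^ m) = cls R (q ^ m)"
proof (induction m)
  case (Suc m)
  then show ?case unfolding power_Suc by (intro cls_mult_cong)
qed simp

lemma keys_lin:
  fixes f :: "'a \<Rightarrow> 'b \<Rightarrow>\<^sub>0 'k::field"
  shows "Poly_Mapping.keys (lin (\<lambda>c. Poly_Mapping.map ((*) c)) f t) \<subseteq> (\<Union>w\<in>Poly_Mapping.keys t. Poly_Mapping.keys (f w))"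
proof -
  have "Poly_Mapping.keys (Poly_Mapping.map ((*) (c::'k)) s) \<subseteq> Poly_Mapping.keys s" for c and s :: "'b \<Rightarrow>\<^sub>0 'k"
    by (auto simp: in_keys_iff)
  then show ?thesis
    unfolding lin_def by (intro order_trans[OF keys_sum] UN_mono) simp_all
qed

lemma keys_tensor_mult_subset:
  assumes "\<And>a b c d. (a, b) \<in> Poly_Mapping.keys s \<Longrightarrow> (c, d) \<in> Poly_Mapping.keys t \<Longrightarrow>
    (a \<otimes>\<^bsub>V\<^esub> c, b \<otimes>\<^bsub>W\<^esub> d) \<in> Z"
  shows "Poly_Mapping.keys (tensor_mult V W s (t :: _ \<Rightarrow>\<^sub>0 'k::field)) \<subseteq> Z"
  unfolding tensor_mult_lin
proof (intro order_trans[OF keys_lin] UN_least)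
  fix p q assume "p \<in> Poly_Mapping.keys s" "q \<in> Poly_Mapping.keys t"
  then show "Poly_Mapping.keys (Poly_Mapping.single (fst p \<otimes>\<^bsub>V\<^esub> fst q, snd p \<otimes>\<^bsub>W\<^esub> snd q) (1::'k)) \<subseteq> Z"
    using assms[of "fst p" "snd p" "fst q" "snd q"] by simp
qed

lemma underlying_algebra_taft: "underlying_algebra (taft n \<omega>) = taft_algebra n \<omega>"
  by (simp add: underlying_algebra_def module.truncate_def taft_def Let_def taft_algebra_def presented_def
      quotient_algebra_def)


lemma ring_taft: "ring (taft n \<omega>)"
proof -
  interpret T: ring "presented (taft_relations n \<omega>)" by (rule ring_presented)
  show ?thesis
  proof (rule ringI)
    show "abelian_group (taft n \<omega>)"
      by (rule abelian_groupI) (auto simp: T.a_ac intro: T.l_neg[OF _] T.a_inv_closed)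
    show "Group.monoid (taft n \<omega>)"
      by (rule monoidI) (simp_all add: T.m_assoc)
  qed (simp_all add: T.l_distr T.r_distr)
qed

lemma ideal_taftI:
  assumes "ideal I (presented (taft_relations n \<omega>))"
  shows "ideal I (taft n \<omega>)"
proof (rule idealI[OF ring_taft])
  have "subgroup I (add_monoid (presented (taft_relations n \<omega>)))"
    using assms by (simp add: ideal_def additive_subgroup_def)
  then show "subgroup I (add_monoid (taft n \<omega>))"
    by (simp add: subgroup_def m_inv_def)
qed (use ideal.I_l_closed[OF assms] ideal.I_r_closed[OF assms] in simp_all)


section \<open>Representations of free algebras\<close>

text \<open>One linear operator per generator makes a space into a module over the free algebra. The
  instances are a small Taft module, the free algebra in u and v, and a quantum plane. If all
  relators act by zero, any element that acts nontrivially lies outside their ideal.\<close>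

locale free_rep = vector_space scale
  for scale :: "'k::field \<Rightarrow> 'v::ab_group_add \<Rightarrow> 'v" +
  fixes A :: "'g \<Rightarrow> 'v \<Rightarrow> 'v"
  assumes A_add: "A l (f + h) = A l f + A l h" and A_scale: "A l (scale c f) = scale c (A l f)"
begin

definition rep :: "('k, 'g) free \<Rightarrow> 'v \<Rightarrow> 'v" where
  "rep p f = lin scale (\<lambda>w. foldr A w f) p"

lemma rep_add: "rep (p + q) f = rep p f + rep q f"
  by (simp add: rep_def lin_add)

lemma rep_diff: "rep (p - q) f = rep p f - rep q f"
  by (simp add: rep_def lin_diff)

lemma rep_zero [simp]: "rep 0 f = 0"
  by (simp add: rep_def)

lemma rep_single: "rep (Poly_Mapping.single w c) f = scale c (foldr A w f)"
  by (simp add: rep_def)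

lemma rep_const [simp]: "rep (const c) f = scale c f"
  by (simp add: rep_single const_def)

lemma rep_one [simp]: "rep 1 f = f"
  using rep_const[of 1] by simp

lemma rep_gen [simp]: "rep (gen l) f = A l f"
  by (simp add: rep_single gen_def)

lemma foldr_add: "foldr A w (f + h) = foldr A w f + foldr A w h"
  by (induction w) (simp_all add: A_add)

lemma foldr_scale: "foldr A w (scale c f) = scale c (foldr A w f)"
  by (induction w) (simp_all add: A_scale)

lemma rep_vector_add: "rep p (f + h) = rep p f + rep p h"
  by (simp add: rep_def foldr_add lin_fun_add)

lemma rep_vector_scale: "rep p (scale c f) = scale c (rep p f)"
  by (simp add: rep_def foldr_scale lin_def scale_sum_right mult.commute)

lemma rep_vector_zero [simp]: "rep p 0 = 0"
  using rep_vector_scale[of p 0 0] by simp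

lemma rep_gen_fun: "rep (gen l) = A l"
  by (simp add: fun_eq_iff)

lemma rep_mult: "rep (p * q) f = rep p (rep q f)"
proof (induction p rule: poly_mapping_induct_single)
  case (single v c)
  show ?case
    by (induction q rule: poly_mapping_induct_single)
      (simp_all add: mult_single plus_list_def rep_single foldr_scale rep_add foldr_add
        scale_right_distrib ring_distribs)
qed (simp add: rep_add ring_distribs)

lemma rep_power: "rep (p ^ m) f = (rep p ^^ m) f"
  by (induction m) (simp_all add: rep_mult)

lemma rep_relation_ideal:
  assumes "p \<in> relation_ideal R" and "\<And>r f. r \<in> R \<Longrightarrow> rep r f = 0"
  shows "rep p f = 0"
  using assms(1)
  by (induction rule: relation_ideal_induct) (simp_all add: rep_add rep_mult assms(2))

end

lemma vector_space_smult: "vector_space (Polynomial.smult :: 'k::field \<Rightarrow> 'k poly \<Rightarrow> 'k poly)"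
  by unfold_locales (simp_all add: smult_add_left smult_add_right)

text \<open>This makes the Hopf ideal generated by x nonzero, so that inner faithfulness says
  something about it.\<close>

lemma taft_x_not_in_relation_ideal:
  assumes "n \<ge> 2" and "\<omega> ^ n = 1"
  shows "gen Taft_x \<notin> relation_ideal (taft_relations n (\<omega>::'k::field))"
proof
  \<comment> \<open>The module with basis \<open>1, z\<close>, \<open>x z = 1\<close>, \<open>x 1 = 0\<close>, \<open>g 1 = \<omega> 1\<close>, \<open>g z = z\<close>; higher powers of \<open>z\<close> are harmless.\<close>
  define A :: "taft_gen \<Rightarrow> 'k poly \<Rightarrow> 'k poly" where
    "A l f = (case l of Taft_x \<Rightarrow> [:coeff f 1:] | Taft_g \<Rightarrow> f + [:(\<omega> - 1) * coeff f 0:])" for l f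
  interpret P: vector_space "Polynomial.smult :: 'k \<Rightarrow> 'k poly \<Rightarrow> 'k poly" by (rule vector_space_smult)
  interpret free_rep Polynomial.smult A
  proof
    show "A l (f + h) = A l f + A l h" for l f h
      by (cases l) (simp_all add: A_def algebra_simps)
    show "A l (Polynomial.smult c f) = Polynomial.smult c (A l f)" for l c f
      by (cases l) (simp_all add: A_def algebra_simps smult_add_right)
  qed
  have "(A Taft_g ^^ m) f = f + [:(\<omega> ^ m - 1) * coeff f 0:]" for m f
  proof (induction m)
    case (Suc m)
    have "(\<omega> ^ m - 1) * a + (\<omega> - 1) * (a + (\<omega> ^ m - 1) * a) = (\<omega> ^ Suc m - 1) * a" for a
      by (simp add: algebra_simps)
    with Suc show ?case by (simp add: A_def add.assoc)
  qed simp
  moreover have "(A Taft_x ^^ Suc (Suc m)) f = 0" for m f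
    by (induction m) (simp_all add: A_def)
  then have "(A Taft_x ^^ n) f = 0" for f
    using assms(1) by (metis le_Suc_ex add_2_eq_Suc)
  moreover have "A Taft_g (A Taft_x f) = Polynomial.smult \<omega> (A Taft_x (A Taft_g f))" for f
    by (simp add: A_def algebra_simps)
  ultimately have "rep r f = 0" if "r \<in> taft_relations n \<omega>" for r f
    using that assms(2)
    by (auto simp: taft_relations_def Let_def rep_diff rep_power rep_mult rep_gen_fun)
  moreover assume "gen Taft_x \<in> relation_ideal (taft_relations n \<omega>)"
  ultimately have "rep (gen Taft_x) [:0, 1:] = 0" using rep_relation_ideal by blast
  then show False by (simp add: A_def)
qed


section \<open>The Hopf ideal generated by x\<close>

context
  fixes n :: nat and \<omega> :: "'k::field"
  assumes n: "n > 0" and \<omega>: "\<omega> ^ n = 1"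
begin

private abbreviation "RT \<equiv> taft_relations n \<omega>"
private abbreviation "x \<equiv> gen Taft_x :: ('k, taft_gen) free"
private abbreviation "g \<equiv> gen Taft_g :: ('k, taft_gen) free"

lemma \<omega>_nz: "\<omega> \<noteq> 0" using n \<omega> by (auto simp: power_0_left)

lemma cls_taft_relations:
  "cls RT (g ^ n) = cls RT 1" "cls RT (x ^ n) = cls RT 0" "cls RT (g * x) = cls RT (const \<omega> * x * g)"
proof -
  have "g ^ n - 1 \<in> relation_ideal RT" "x ^ n - 0 \<in> relation_ideal RT"
      "g * x - const \<omega> * x * g \<in> relation_ideal RT"
    by (rule relation_idealI; simp add: taft_relations_def Let_def)+
  then show "cls RT (g ^ n) = cls RT 1" "cls RT (x ^ n) = cls RT 0" "cls RT (g * x) = cls RT (const \<omega> * x * g)"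
    by (simp_all only: cls_eq_iff)
qed

lemma cls_g_power_x: "cls RT (g ^ m * x) = cls RT (const (\<omega> ^ m) * x * g ^ m)"
proof (induction m)
  case (Suc m)
  have "cls RT (g * (g ^ m * x)) = cls RT (g * (const (\<omega> ^ m) * x * g ^ m))"
    by (rule cls_mult_cong[OF refl Suc])
  also have "\<dots> = cls RT (const (\<omega> ^ m) * (g * x * g ^ m))"
    by (simp only: mult.assoc const_left_commute[of g])
  also have "\<dots> = cls RT (const (\<omega> ^ m) * (const \<omega> * x * g * g ^ m))"
    by (intro cls_mult_cong refl cls_taft_relations)
  also have "const (\<omega> ^ m) * (const \<omega> * x * g * g ^ m) = const (\<omega> ^ Suc m) * x * g ^ Suc m"
    by (simp only: mult.assoc const_mult[symmetric] power_Suc power_Suc2[of _ m, symmetric]) (simp add: mult.assoc mult.commute)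
  finally show ?case by (simp add: mult.assoc)
qed simp

lemma cls_x_g_power: "cls RT (x * g ^ m) = cls RT (const (inverse \<omega> ^ m) * g ^ m * x)"
proof -
  have "cls RT (const (inverse \<omega> ^ m) * (g ^ m * x)) = cls RT (const (inverse \<omega> ^ m) * (const (\<omega> ^ m) * x * g ^ m))"
    by (intro cls_mult_cong refl cls_g_power_x)
  also have "const (inverse \<omega> ^ m) * (const (\<omega> ^ m) * x * g ^ m) = x * g ^ m"
    using \<omega>_nz by (simp add: mult.assoc flip: power_mult_distrib)
  finally show ?thesis by (simp add: mult.assoc)
qed

lemma antipode_lin: "taft_antipode_free n = lin (\<lambda>c p. const c * p) (\<lambda>w. prod_list (map (taft_antipode_gen n) (rev w)))"
  by (simp add: fun_eq_iff taft_antipode_free_def lin_def)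

lemma antipode_add: "taft_antipode_free n (p + q) = taft_antipode_free n p + (taft_antipode_free n q :: ('k, taft_gen) free)"
  by (simp add: antipode_lin const_scale.lin_add)

lemma antipode_diff: "taft_antipode_free n (p - q) = taft_antipode_free n p - (taft_antipode_free n q :: ('k, taft_gen) free)"
  by (simp add: antipode_lin const_scale.lin_diff)

lemma antipode_single: "taft_antipode_free n (Poly_Mapping.single w c)
    = const c * (prod_list (map (taft_antipode_gen n) (rev w)) :: ('k, taft_gen) free)"
  by (simp add: antipode_lin)

lemma antipode_gen [simp]: "taft_antipode_free n (gen l) = (taft_antipode_gen n l :: ('k, taft_gen) free)"
  by (simp add: antipode_single gen_def)

lemma antipode_const [simp]: "taft_antipode_free n (const c) = (const c :: ('k, taft_gen) free)"
  by (simp add: antipode_single const_def[of c])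

lemma antipode_one [simp]: "taft_antipode_free n 1 = (1 :: ('k, taft_gen) free)"
  using antipode_const[of 1] by simp

lemma antipode_zero [simp]: "taft_antipode_free n 0 = (0 :: ('k, taft_gen) free)"
  by (simp add: antipode_lin)

lemma antipode_mult: "taft_antipode_free n (p * q) = taft_antipode_free n q * (taft_antipode_free n p :: ('k, taft_gen) free)"
proof (induction p rule: poly_mapping_induct_single)
  case (single v c)
  show ?case
  proof (induction q rule: poly_mapping_induct_single)
    case (single w d)
    show ?case
      by (simp add: mult_single plus_list_def antipode_single const_mult_mult mult.commute[of c])
  qed (simp add: antipode_add ring_distribs)
qed (simp add: antipode_add ring_distribs)

lemma antipode_power: "taft_antipode_free n (p ^ m) = (taft_antipode_free n p ^ m :: ('k, taft_gen) free)"
  by (induction m) (simp_all add: antipode_mult power_commutes)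

text \<open>The antipode reverses products, so relators suffice. S(g)^n is a power of g^n, S(x)^n is
  a multiple of x^n up to powers of g, and the third relator reduces to g^(n-1) x = \<omega>^(n-1) x
  g^(n-1) together with \<omega>^n = 1.\<close>

lemma antipode_relation_ideal:
  assumes "p \<in> relation_ideal RT"
  shows "taft_antipode_free n p \<in> relation_ideal RT"
  using assms
proof (induction rule: relation_ideal_induct)
  case (sandwich r v w c)
  let ?S = "- (g ^ (n - 1) * x)"
  \<comment> \<open>The scalar stays unspecified: what counts is the factor x^m, which dies at m =
    n.\<close>
  have x: "\<exists>d. cls RT (?S ^ m) = cls RT (const d * g ^ ((n - 1) * m) * x ^ m)" for m
  proof (induction m)
    case 0
    show ?case by (intro exI[of _ 1]) simp
  next
    case (Suc m)
    let ?N = "(n - 1) * m"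
    obtain d where d: "cls RT (?S ^ m) = cls RT (const d * g ^ ?N * x ^ m)" using Suc by blast
    have "cls RT (?S ^ Suc m) = cls RT (?S * (const d * g ^ ?N * x ^ m))"
      unfolding power_Suc by (intro cls_mult_cong refl d)
    also have "?S * (const d * g ^ ?N * x ^ m) = const (- d) * g ^ (n - 1) * ((x * g ^ ?N) * x ^ m)"
      by (simp only: mult.assoc const_left_commute[of x] const_left_commute[of "g ^ (n - 1)"] const_minus mult_minus_left)
    also have "cls RT \<dots> = cls RT (const (- d) * g ^ (n - 1) * ((const (inverse \<omega> ^ ?N) * g ^ ?N * x) * x ^ m))"
      by (intro cls_mult_cong refl cls_x_g_power)
    also have "const (- d) * g ^ (n - 1) * ((const (inverse \<omega> ^ ?N) * g ^ ?N * x) * x ^ m)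
        = const (- d * inverse \<omega> ^ ?N) * g ^ ((n - 1) * Suc m) * x ^ Suc m"
      unfolding mult_Suc_right power_add power_Suc
      by (simp only: mult.assoc const_left_commute[of "g ^ (n - 1)"] const_mult)
    finally show ?case by blast
  qed
  have "cls RT (taft_antipode_free n r) = cls RT 0"
  proof -
    consider "r = g ^ n - 1" | "r = x ^ n" | "r = g * x - const \<omega> * x * g"
      using sandwich by (auto simp: taft_relations_def Let_def)
    then show ?thesis
    proof cases
      case 1
      have "cls RT ((g ^ n) ^ (n - 1)) = cls RT (1 ^ (n - 1))"
        by (intro cls_power_cong cls_taft_relations)
      then show ?thesis
        by (simp add: 1 antipode_diff antipode_power cls_eq_iff mult.commute flip: power_mult)
    next
      case 2
      obtain d where "cls RT (?S ^ n) = cls RT (const d * g ^ ((n - 1) * n) * x ^ n)" using x by blast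
      also have "\<dots> = cls RT (const d * g ^ ((n - 1) * n) * 0)"
        by (intro cls_mult_cong refl cls_taft_relations)
      finally show ?thesis by (simp add: 2 antipode_power)
    next
      case 3
      have "cls RT (const \<omega> * g ^ (n - 1) * (g ^ (n - 1) * x)) = cls RT (const \<omega> * g ^ (n - 1) * (const (\<omega> ^ (n - 1)) * x * g ^ (n - 1)))"
        by (intro cls_mult_cong refl cls_g_power_x)
      also have "const \<omega> * g ^ (n - 1) * (const (\<omega> ^ (n - 1)) * x * g ^ (n - 1)) = const (\<omega> * \<omega> ^ (n - 1)) * (g ^ (n - 1) * (x * g ^ (n - 1)))"
        by (simp only: mult.assoc const_left_commute[of "g ^ (n - 1)"] const_mult)
      also have "\<omega> * \<omega> ^ (n - 1) = 1" using n \<omega> by (simp flip: power_Suc)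
      finally show ?thesis
        by (simp add: 3 antipode_diff antipode_mult cls_eq_iff mult.assoc const_commute) 
    qed
  qed
  then have "taft_antipode_free n r \<in> relation_ideal RT" by (simp only: cls_eq_zero_iff)
  then show ?case
    unfolding antipode_mult by (intro relation_ideal_mult_left relation_ideal_mult_right)
qed (simp_all add: antipode_add relation_ideal_add)

lemma antipode_taft: "antipode (taft n \<omega>) (cls RT p) = cls RT (taft_antipode_free n p)"
proof -
  have "cls RT (taft_antipode_free n q) = cls RT (taft_antipode_free n p)" if "q \<in> cls RT p" for q
    using antipode_relation_ideal[of "q - p"] that by (simp add: in_cls_iff cls_eq_iff antipode_diff)
  moreover have "p \<in> cls RT p" by (rule self_in_cls)
  ultimately show ?thesis unfolding taft_simps by blast
qed

lemma keys_taft_comult_word: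
  "Poly_Mapping.keys (taft_comult_word n \<omega> w) \<subseteq> carrier (presented RT) \<times> carrier (presented RT)"
proof (induction w)
  case (Cons l w)
  have "Poly_Mapping.keys (taft_comult_gen n \<omega> l) \<subseteq> carrier (presented RT) \<times> carrier (presented RT)"
    using keys_add[of "Poly_Mapping.single (taft_g n \<omega>, taft_x n \<omega>) (1::'k)"]
    by (cases l) (fastforce simp: taft_algebra_def one_presented)+
  with Cons show ?case
    unfolding taft_comult_word.simps taft_algebra_def
    by (intro keys_tensor_mult_subset) (auto elim!: carrier_presentedE dest!: subsetD simp: mult_presented)
qed (simp add: taft_algebra_def one_presented)

text \<open>The coproduct of a class ranges over all its representatives, among them elements such
  as x + g^n - 1 that do not lie in the ideal generated by x in the free algebra. The supports of
  all their coproducts have to be controlled.\<close>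

lemma hopf_ideal_x: "hopf_ideal (taft n \<omega>) (cls RT ` relation_ideal {x})"
proof -
  let ?J = "cls RT ` relation_ideal {x}" and ?C = "carrier (presented RT)"
  let ?S = "?J \<times> ?C \<union> ?C \<times> ?J"
  have ideal: "ideal ?J (presented RT)"
    by (rule ideal_presentedI[OF ideal_relation_ideal])
  note J_left = ideal.I_l_closed[OF ideal] and J_right = ideal.I_r_closed[OF ideal]
  have C_mult: "a \<otimes>\<^bsub>presented RT\<^esub> b \<in> ?C" if "a \<in> ?C" "b \<in> ?C" for a b
    using that by (auto elim!: carrier_presentedE simp: mult_presented)
  have J_C: "a \<in> ?C" if "a \<in> ?J" for a using that by auto
  have x_J: "taft_x n \<omega> \<in> ?J" unfolding taft_x_def by (intro imageI relation_idealI) simp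
  note keys_C = keys_taft_comult_word
  have S_C: "Poly_Mapping.keys (tensor_mult (presented RT) (presented RT) s t) \<subseteq> ?S"
    if s: "Poly_Mapping.keys s \<subseteq> ?S" and t: "Poly_Mapping.keys t \<subseteq> ?C \<times> ?C" for s t :: "_ \<Rightarrow>\<^sub>0 'k"
  proof (rule keys_tensor_mult_subset)
    fix a b c d assume "(a, b) \<in> Poly_Mapping.keys s" "(c, d) \<in> Poly_Mapping.keys t"
    then have "a \<in> ?J \<and> b \<in> ?C \<or> a \<in> ?C \<and> b \<in> ?J" and cd: "c \<in> ?C" "d \<in> ?C"
      using s t by blast+
    then show "(a \<otimes>\<^bsub>presented RT\<^esub> c, b \<otimes>\<^bsub>presented RT\<^esub> d) \<in> ?S"
      using J_right[OF _ cd(1)] J_right[OF _ cd(2)] C_mult[OF _ cd(1)] C_mult[OF _ cd(2)] by blast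
  qed
  have C_S: "Poly_Mapping.keys (tensor_mult (presented RT) (presented RT) s t) \<subseteq> ?S"
    if s: "Poly_Mapping.keys s \<subseteq> ?C \<times> ?C" and t: "Poly_Mapping.keys t \<subseteq> ?S" for s t :: "_ \<Rightarrow>\<^sub>0 'k"
  proof (rule keys_tensor_mult_subset)
    fix a b c d assume "(a, b) \<in> Poly_Mapping.keys s" "(c, d) \<in> Poly_Mapping.keys t"
    then have "c \<in> ?J \<and> d \<in> ?C \<or> c \<in> ?C \<and> d \<in> ?J" and ab: "a \<in> ?C" "b \<in> ?C"
      using s t by blast+
    then show "(a \<otimes>\<^bsub>presented RT\<^esub> c, b \<otimes>\<^bsub>presented RT\<^esub> d) \<in> ?S"
      using J_left[OF _ ab(1)] J_left[OF _ ab(2)] C_mult[OF ab(1)] C_mult[OF ab(2)] by blast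
  qed
  \<comment> \<open>One letter x suffices: its coproduct is supported in \<open>?S\<close>, and
    multiplication by further coproducts on either side keeps the support there.\<close>
  have keys_S: "Poly_Mapping.keys (taft_comult_word n \<omega> w) \<subseteq> ?S" if "Taft_x \<in> set w" for w
    using that
  proof (induction w)
    case (Cons l w)
    show ?case
    proof (cases l)
      case Taft_x
      have "Poly_Mapping.keys (taft_comult_gen n \<omega> l) \<subseteq> ?S"
        using keys_add[of "Poly_Mapping.single (taft_g n \<omega>, taft_x n \<omega>) (1::'k)"] x_J
        unfolding Taft_x by (fastforce simp: taft_algebra_def one_presented)
      with keys_C[of w] show ?thesis
        unfolding taft_comult_word.simps taft_algebra_def by (intro S_C)
    next
      case Taft_g
      then have "Poly_Mapping.keys (taft_comult_word n \<omega> w) \<subseteq> ?S" using Cons by simp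
      moreover have "Poly_Mapping.keys (taft_comult_gen n \<omega> l) \<subseteq> ?C \<times> ?C" by (simp add: Taft_g)
      ultimately show ?thesis
        unfolding taft_comult_word.simps taft_algebra_def by (intro C_S)
    qed
  qed simp
  \<comment> \<open>Up to terms in \<open>J \<otimes> T + T \<otimes> J\<close> only the words in \<open>g\<close> contribute to the comultiplication. Their part \<open>D\<close>
    vanishes on the relations literally, so that the vanishing of \<open>(g \<otimes> x + x \<otimes> 1)\<^sup>n\<close> is not needed.\<close>
  define D where "D w = (if Taft_x \<in> set w then 0 else
    Poly_Mapping.single (cls RT (Poly_Mapping.single w 1), cls RT (Poly_Mapping.single w 1)) (1::'k))" for w
  define E where "E w = (if Taft_x \<in> set w then taft_comult_word n \<omega> w else 0)" for w
  have "taft_comult_word n \<omega> w = D w + E w" for w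
  proof -
    have "taft_comult_word n \<omega> w
        = Poly_Mapping.single (cls RT (Poly_Mapping.single w 1), cls RT (Poly_Mapping.single w 1)) 1"
      if "Taft_x \<notin> set w"
      using that
    proof (induction w)
      case (Cons l w)
      then have "l = Taft_g" by (cases l) auto
      then show ?case
        using Cons by (simp add: tensor_mult_single taft_algebra_def taft_g_def mult_presented single_Cons)
    qed (simp add: taft_algebra_def one_presented single_Nil_one)
    then show ?thesis by (simp add: D_def E_def)
  qed
  then have "taft_comult_word n \<omega> = (\<lambda>w. D w + E w)" by (rule ext)
  then have comult: "taft_comult_free n \<omega> p = lin (\<lambda>c. Poly_Mapping.map ((*) c)) D p + lin (\<lambda>c. Poly_Mapping.map ((*) c)) E p" for p
    by (simp add: taft_comult_free_lin tensor_scale.lin_fun_add)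
  have D_x: "lin (\<lambda>c. Poly_Mapping.map ((*) c)) D p = 0" if "p \<in> relation_ideal {x}" for p
    using that
    by (induction rule: relation_ideal_induct)
      (simp_all add: tensor_scale.lin_add gen_def mult_single plus_list_def D_def)
  have D_RT: "lin (\<lambda>c. Poly_Mapping.map ((*) c)) D p = 0" if "p \<in> relation_ideal RT" for p
    using that
  proof (induction rule: relation_ideal_induct)
    case (sandwich r v w c)
    consider "r = g ^ n - 1" | "r = x ^ n" | "r = g * x - const \<omega> * x * g"
      using sandwich by (auto simp: taft_relations_def Let_def)
    then show ?case
    proof cases
      case 1
      have "cls RT (Poly_Mapping.single v 1 * g ^ n * Poly_Mapping.single w 1)
          = cls RT (Poly_Mapping.single v 1 * 1 * Poly_Mapping.single w 1)"
        by (intro cls_mult_cong refl cls_taft_relations)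
      then have "D (v @ replicate n Taft_g @ w) = D (v @ w)"
        by (simp add: D_def gen_power mult_single plus_list_def)
      then show ?thesis
        by (simp add: 1 gen_power ring_distribs mult_single plus_list_def tensor_scale.lin_diff)
    next
      case 2
      then show ?thesis
        using n by (simp add: gen_power mult_single plus_list_def D_def)
    next
      case 3
      then show ?thesis
        by (simp add: gen_def ring_distribs mult_single plus_list_def tensor_scale.lin_diff D_def)
    qed
  qed (simp_all add: tensor_scale.lin_add)
  have keys_comult: "Poly_Mapping.keys (taft_comult_free n \<omega> p) \<subseteq> ?S" if "p \<in> cls RT q" "q \<in> relation_ideal {x}" for p q
  proof -
    have "lin (\<lambda>c. Poly_Mapping.map ((*) c)) D p = 0"
      using D_RT[of "p - q"] D_x[OF that(2)] that(1) by (simp add: in_cls_iff tensor_scale.lin_diff)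
    moreover have "Poly_Mapping.keys (E w) \<subseteq> ?S" for w
      using keys_S by (simp add: E_def)
    then have "Poly_Mapping.keys (lin (\<lambda>c. Poly_Mapping.map ((*) c)) E p) \<subseteq> ?S"
      using keys_lin[of E p] by blast
    ultimately show ?thesis by (simp add: comult)
  qed
  have "comult (taft n \<omega>) h \<subseteq> (\<Union>t\<in>{t. Poly_Mapping.keys t \<subseteq> ?S}. tensor_class (taft_algebra n \<omega>) (taft_algebra n \<omega>) t)"
    if h: "h \<in> ?J" for h
  proof -
    obtain q where q: "h = cls RT q" "q \<in> relation_ideal {x}" using h by blast
    show ?thesis
      unfolding taft_simps q(1)
    proof (rule UN_least)
      fix p assume "p \<in> cls RT q"
      then have "taft_comult_free n \<omega> p \<in> {t. Poly_Mapping.keys t \<subseteq> ?S}"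
        using keys_comult q(2) by simp
      then show "tensor_class (taft_algebra n \<omega>) (taft_algebra n \<omega>) (taft_comult_free n \<omega> p)
          \<subseteq> (\<Union>t\<in>{t. Poly_Mapping.keys t \<subseteq> ?S}. tensor_class (taft_algebra n \<omega>) (taft_algebra n \<omega>) t)"
        by (rule UN_upper)
    qed
  qed
  moreover have "counit (taft n \<omega>) h = 0" if h: "h \<in> ?J" for h
  proof -
    obtain q where q: "h = cls RT q" "q \<in> relation_ideal {x}" using h by blast
    have "taft_counit_free q = 0"
      using q(2)
      by (induction rule: relation_ideal_induct)
        (simp_all add: taft_counit_free_add taft_counit_free_mult, simp add: taft_counit_free_lin)
    then show ?thesis unfolding q(1) counit_taft[OF n] .
  qed
  moreover have "antipode (taft n \<omega>) h \<in> ?J" if h: "h \<in> ?J" for h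
  proof -
    obtain q where q: "h = cls RT q" "q \<in> relation_ideal {x}" using h by blast
    have "taft_antipode_free n q \<in> relation_ideal {x}"
      using q(2)
    proof (induction rule: relation_ideal_induct)
      case (sandwich r v w c)
      have "taft_antipode_free n x \<in> relation_ideal {x}"
        by (simp add: relation_ideal_minus_iff relation_ideal_mult_left relation_idealI)
      then show ?case
        using sandwich unfolding antipode_mult
        by (intro relation_ideal_mult_left relation_ideal_mult_right) (simp only: singleton_iff)
    qed (simp_all add: antipode_add relation_ideal_add)
    then show ?thesis unfolding q(1) antipode_taft by (rule imageI)
  qed
  moreover have "ideal ?J (taft n \<omega>)"
    by (rule ideal_taftI[OF ideal])
  ultimately show ?thesis
    unfolding hopf_ideal_def underlying_algebra_taft by simp
qed

end

section \<open>Classification of the actions\<close>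

lemma (in taft_action) inner_faithful_x_nonzero:
  assumes "n \<ge> 2" and "\<omega> ^ n = 1" and "inner_faithful (taft n \<omega>) A act"
  shows "\<exists>p. act (taft_x n \<omega>) (cls R p) \<noteq> cls R 0"
proof (rule ccontr)
  assume "\<not> ?thesis"
  then have x: "act (taft_x n \<omega>) (cls R p) = cls R 0" for p by blast
  let ?c = "cls (taft_relations n \<omega>)"
  let ?J = "?c ` relation_ideal {gen Taft_x}"
  have "hopf_ideal (taft n \<omega>) ?J"
    using hopf_ideal_x n_pos assms(2) .
  moreover have "?J \<noteq> {\<zero>\<^bsub>taft n \<omega>\<^esub>}"
  proof
    assume "?J = {\<zero>\<^bsub>taft n \<omega>\<^esub>}"
    moreover have "?c (gen Taft_x) \<in> ?J" by (intro imageI relation_idealI) simp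
    ultimately have "?c (gen Taft_x) = ?c 0" by (simp add: zero_presented)
    then show False
      using taft_x_not_in_relation_ideal[OF assms(1,2)] by (simp add: cls_eq_zero_iff)
  qed
  moreover have "act (?c q) (cls R p) = cls R 0" if "q \<in> relation_ideal {gen Taft_x}" for p q
    using that
  proof (induction rule: relation_ideal_induct)
    case zero
    show ?case
      using smult_act[of "?c 0" "cls R p" 0] act_closed[of "?c 0" "cls R p"]
      by (auto elim!: carrier_presentedE simp: smult_presented)
  next
    case (add q r)
    then show ?case using add_act[of "?c q" "?c r" "cls R p"] by (simp add: add_presented)
  next
    case (sandwich r v w c)
    obtain q where q: "act (?c (Poly_Mapping.single w 1)) (cls R p) = cls R q"
      using act_rep[of p] by (metis cls_in_carrier)
    have "?c (Poly_Mapping.single v c * r * Poly_Mapping.single w 1)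
      = ?c (Poly_Mapping.single v c) \<otimes>\<^bsub>T\<^esub> (taft_x n \<omega> \<otimes>\<^bsub>T\<^esub> ?c (Poly_Mapping.single w 1))"
      using sandwich by (simp add: taft_x_def mult_presented mult.assoc)
    moreover have "taft_x n \<omega> \<otimes>\<^bsub>T\<^esub> ?c (Poly_Mapping.single w 1) \<in> carrier T"
      by (simp add: taft_x_def mult_presented)
    ultimately show ?case by (simp add: mult_act q x act_zero)
  qed
  then have "\<forall>h\<in>?J. \<forall>a\<in>carrier A. act h a = \<zero>\<^bsub>A\<^esub>"
    by (auto elim!: carrier_presentedE simp: zero_presented)
  ultimately show False using assms(3) unfolding inner_faithful_def by blast
qed

section \<open>Linear forms in the down-up algebra and powers of a primitive root\<close>

lemma lookup_lform:
  "Poly_Mapping.lookup (lform a b) [DU_u] = a" "Poly_Mapping.lookup (lform a b) [DU_v] = b"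
  by (simp_all add: lform_single lookup_add lookup_single)

text \<open>The relators start in degree three. This is how matrix entries are read off from
  congruences.\<close>

lemma lform_relation_ideal:
  "lform a b \<in> relation_ideal (down_up_relations \<alpha> \<beta>) \<Longrightarrow> a = 0 \<and> b = 0"
  using down_up_relation_ideal_coeffs(1)[of "lform a b" \<alpha> \<beta> "[DU_u]"]
    down_up_relation_ideal_coeffs(1)[of "lform a b" \<alpha> \<beta> "[DU_v]"] by (simp add: lookup_lform)

lemma const_mult_lform: "const c * lform a b = lform (c * a) (c * b)"
  by (simp add: lform_single distrib_left)

lemma lform_diff: "lform a b - lform c d = lform (a - c) (b - d)"
  by (simp add: lform_single single_diff)

lemma down_up_grade_1:
  assumes "a \<in> down_up_grade \<alpha> \<beta> 1"
  shows "\<exists>c d. a = cls (down_up_relations \<alpha> \<beta>) (lform c d)"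
proof -
  obtain p where p: "a = cls (down_up_relations \<alpha> \<beta>) p" "\<forall>w\<in>Poly_Mapping.keys p. length w = 1"
    using assms by (auto simp: down_up_grade_def)
  have "p = lform (Poly_Mapping.lookup p [DU_u]) (Poly_Mapping.lookup p [DU_v])" (is "p = ?q")
  proof (rule poly_mapping_eqI)
    fix w
    show "Poly_Mapping.lookup p w = Poly_Mapping.lookup ?q w"
    proof (cases "length w = 1")
      case True
      then obtain l where "w = [l]" by (auto simp: length_Suc_conv)
      then show ?thesis by (cases l) (simp_all add: lookup_lform)
    next
      case False
      then have "Poly_Mapping.lookup p w = 0" using p(2) by (meson in_keys_iff)
      moreover have "[l] \<noteq> w" for l using False by auto
      ultimately show ?thesis by (simp add: lform_single lookup_add lookup_single)
    qed
  qed
  then show ?thesis using p(1) by metis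
qed

lemma has_matrix_iff:
  "has_matrix \<alpha> \<beta> T ((a, b), (c, d)) \<longleftrightarrow>
    T (cls (down_up_relations \<alpha> \<beta>) (gen DU_u)) = cls (down_up_relations \<alpha> \<beta>) (lform a c) \<and>
    T (cls (down_up_relations \<alpha> \<beta>) (gen DU_v)) = cls (down_up_relations \<alpha> \<beta>) (lform b d)"
  by (simp add: has_matrix_def Let_def down_up_def down_up_u_def down_up_v_def presented_cls lform_def)

lemma primitive_root_inj:
  assumes "primitive_root n (\<omega>::'k::field)"
  shows "inj_on (\<lambda>k. \<omega> ^ k) {..<n}"
proof (rule linorder_inj_onI)
  have \<omega>0: "\<omega> \<noteq> 0" using assms by (auto simp: primitive_root_def power_0_left)
  fix i j assume "i < j" "i \<in> {..<n}" "j \<in> {..<n}"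
  then have "\<omega> ^ j = \<omega> ^ i * \<omega> ^ (j - i)" "\<omega> ^ (j - i) \<noteq> 1"
    using assms by (auto simp: primitive_root_def simp flip: power_add)
  then show "\<omega> ^ i \<noteq> \<omega> ^ j" using \<omega>0 by auto
qed auto

text \<open>T^n - 1 has at most n roots, and the powers of \<omega> with exponent below n already
  provide n of them.\<close>

lemma primitive_root_powers:
  assumes "primitive_root n (\<omega>::'k::field)" and "z ^ n = 1"
  shows "\<exists>k\<le>n - 1. z = \<omega> ^ k"
proof -
  have n: "n > 0" and \<omega>n: "\<omega> ^ n = 1"
    using assms(1) by (auto simp: primitive_root_def)
  have inj: "inj_on (\<lambda>k. \<omega> ^ k) {..<n}" by (rule primitive_root_inj[OF assms(1)])
  define p :: "'k poly" where "p = Polynomial.monom 1 n - 1"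
  have pc: "coeff p n = 1" using n by (simp add: p_def)
  then have p0: "p \<noteq> 0" by auto
  have deg: "Polynomial.degree p \<le> n"
    unfolding p_def by (intro degree_diff_le) (simp_all add: degree_monom_le)
  have roots: "(\<lambda>k. \<omega> ^ k) ` {..<n} \<subseteq> {x. poly p x = 0}"
  proof
    fix x assume "x \<in> (\<lambda>k. \<omega> ^ k) ` {..<n}"
    then obtain k where "x = \<omega> ^ k" by auto
    then have "x ^ n = 1" using \<omega>n by (metis mult.commute power_mult power_one)
    then show "x \<in> {x. poly p x = 0}" by (simp add: p_def poly_monom)
  qed
  have fin: "finite {x. poly p x = 0}" by (rule poly_roots_finite[OF p0])
  have "card {x. poly p x = 0} \<le> card ((\<lambda>k. \<omega> ^ k) ` {..<n})"
    using card_poly_roots_bound[OF p0] deg card_image[OF inj] by simp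
  then have "(\<lambda>k. \<omega> ^ k) ` {..<n} = {x. poly p x = 0}"
    by (rule card_seteq[OF fin roots])
  moreover have "z \<in> {x. poly p x = 0}" using assms(2) by (simp add: p_def poly_monom)
  ultimately obtain k where "k < n" "z = \<omega> ^ k" by force
  then show ?thesis by (intro exI[of _ k]) auto
qed

lemma taft_action_down_up_classification:
  fixes \<omega> :: "'k::field_char_0"
  assumes n: "n \<ge> 2" and \<omega>: "primitive_root n \<omega>" and "\<beta> \<noteq> 0"
    and act: "taft_acts_on_down_up n \<omega> \<alpha> \<beta> act"
  shows "(\<exists>k\<le>n - 1. \<exists>q s. q \<noteq> 0 \<and> s ^ 2 = \<omega> \<and>
           has_matrix \<alpha> \<beta> (act (taft_g n \<omega>)) ((\<omega> ^ (k + 1), 0), (0, \<omega> ^ k)) \<and>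
           has_matrix \<alpha> \<beta> (act (taft_x n \<omega>)) ((0, q), (0, 0)) \<and>
           \<alpha> = \<omega> powi (- int (k + 1)) * (1 + s) \<and>
           \<beta> = - (\<omega> powi (- 2 * int (k + 1))) * s) \<or>
        (\<exists>k\<le>n - 1. \<exists>r s. r \<noteq> 0 \<and> s ^ 2 = inverse \<omega> \<and>
           has_matrix \<alpha> \<beta> (act (taft_g n \<omega>)) ((\<omega> ^ k, 0), (0, \<omega> ^ (k + 1))) \<and>
           has_matrix \<alpha> \<beta> (act (taft_x n \<omega>)) ((0, 0), (r, 0)) \<and>
           \<alpha> = \<omega> ^ (k + 1) * (1 + s) \<and>
           \<beta> = - (\<omega> ^ (2 * (k + 1))) * s)"
proof -
  let ?R = "down_up_relations \<alpha> \<beta>"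
  let ?I = "relation_ideal ?R"
  have \<omega>n: "\<omega> ^ n = 1" and \<omega>1: "\<omega> \<noteq> 1" and n0: "n > 0"
    using \<omega> n by (auto simp: primitive_root_def dest: spec[of _ 1])
  interpret taft_action n \<omega> ?R act
    using act n by unfold_locales (simp_all add: taft_acts_on_down_up_def down_up_def)
  have "gen l \<in> {p. \<forall>w\<in>Poly_Mapping.keys (p :: ('k, down_up_gen) free). length w = 1}" for l
    by (simp add: gen_def)
  then have "act h (cls ?R (gen l)) \<in> down_up_grade \<alpha> \<beta> 1" if "h \<in> carrier T" for h l
    using act that unfolding taft_acts_on_down_up_def homogeneous_action_def down_up_grade_def taft_simps by blast
  then have grade: "\<exists>c d. act h (cls ?R (gen l)) = cls ?R (lform c d)" if "h \<in> carrier T" for h l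
    using that by (intro down_up_grade_1)
  obtain p1 p3 where gu: "act (taft_g n \<omega>) (cls ?R (gen DU_u)) = cls ?R (lform p1 p3)" using grade by force
  obtain p2 p4 where gv: "act (taft_g n \<omega>) (cls ?R (gen DU_v)) = cls ?R (lform p2 p4)" using grade by force
  obtain x1 x3 where xu: "act (taft_x n \<omega>) (cls ?R (gen DU_u)) = cls ?R (lform x1 x3)" using grade by force
  obtain x2 x4 where xv: "act (taft_x n \<omega>) (cls ?R (gen DU_v)) = cls ?R (lform x2 x4)" using grade by force
  let ?G = "sel (lform p1 p3) (lform p2 p4)" and ?X = "sel (lform x1 x3) (lform x2 x4)"
  have G: "act (taft_g n \<omega>) (cls ?R (gen l)) = cls ?R (?G l)" for l using gu gv by (cases l) simp_all
  have X: "act (taft_x n \<omega>) (cls ?R (gen l)) = cls ?R (?X l)" for l using xu xv by (cases l) simp_all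
  note rel = taft_relations_act[OF G X]
  note lin = subst_sel_lform skew_sel_lform const_mult_lform lform_diff
  \<comment> \<open>The entries of G X = \<omega> X G, where (p1, p3) and (p2, p4) are the columns
    of G, and likewise for X.\<close>
  have comm: "p1 * x1 + p2 * x3 = \<omega> * (x1 * p1 + x2 * p3)" "p3 * x1 + p4 * x3 = \<omega> * (x3 * p1 + x4 * p3)"
    "p1 * x2 + p2 * x4 = \<omega> * (x1 * p2 + x2 * p4)" "p3 * x2 + p4 * x4 = \<omega> * (x3 * p2 + x4 * p4)"
    using lform_relation_ideal[OF rel(3)[of "lform 1 0", unfolded lin]]
      lform_relation_ideal[OF rel(3)[of "lform 0 1", unfolded lin]]
    by (simp_all add: mult.commute)
  have det: "p1 * p4 \<noteq> p2 * p3"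
  proof
    assume D: "p1 * p4 = p2 * p3"
    have kernel: "c = 0 \<and> d = 0" if "c * p1 + d * p2 = 0" "c * p3 + d * p4 = 0" for c d
    proof -
      obtain m where m: "n = Suc m" using n0 by (cases n) auto
      have "(subst ?G ^^ i) 0 = 0" for i by (induction i) simp_all
      then have "(subst ?G ^^ n) (lform c d) = 0"
        using that by (simp only: m funpow_Suc_right o_apply lin) (simp add: lform_def)
      then show ?thesis
        using rel(1)[of "lform c d"] by (auto simp: relation_ideal_minus_iff dest: lform_relation_ideal)
    qed
    \<comment> \<open>When the determinant vanishes, (p2, - p1) and (p4, - p3) lie in the kernel of
      G. The kernel is trivial by G^n = 1, so G would be zero, which again contradicts the
      triviality of the kernel.\<close>
    have "p2 = 0 \<and> - p1 = 0" by (rule kernel) (use D in \<open>simp_all add: algebra_simps\<close>)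
    moreover have "p4 = 0 \<and> - p3 = 0" by (rule kernel) (use D in \<open>simp_all add: algebra_simps\<close>)
    ultimately have "(1::'k) = 0 \<and> (1::'k) = 0" by (intro kernel) simp_all
    then show False by simp
  qed
  \<comment> \<open>the trace of \<open>adj(G) (G X - \<omega> X G)\<close>\<close>
  have "(p1 * p4 - p2 * p3) * ((1 - \<omega>) * (x1 + x4)) = 0"
    using comm by Groebner_Basis.algebra
  then have "x1 + x4 = 0" using det \<omega>1 by simp
  then have x4: "x4 = - x1" by (simp add: add_eq_0_iff)
  have nil: "x1 * x1 + x2 * x3 = 0"
  proof -
    let ?d = "x1 * x1 + x2 * x3"
    \<comment> \<open>\<open>X\<^sup>2 = - det X\<close> because \<open>X\<close> has trace zero\<close>
    have "(skew ?G ?X ^^ (m + m)) (lform 1 0) = lform (?d ^ m) 0" for m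
      by (induction m) (simp_all add: lin x4 algebra_simps)
    \<comment> \<open>Applying X^n to X^n u produces an even power of X, and even powers act on u by
      a scalar.\<close>
    then have "lform (?d ^ n) 0 \<in> ?I"
      using rel(2)[of "(skew ?G ?X ^^ n) (lform 1 0)"] by (simp add: funpow_add)
    then have "?d ^ n = 0" using lform_relation_ideal by blast
    then show ?thesis by simp
  qed
  have nz: "x1 \<noteq> 0 \<or> x2 \<noteq> 0 \<or> x3 \<noteq> 0"
  proof (rule ccontr)
    assume "\<not> ?thesis"
    then have "?X l = 0" for l using x4 by (cases l) (simp_all add: lform_def)
    then have "skew_word ?G ?X w = 0" for w by (induction w) simp_all
    then have "skew ?G ?X p = 0" for p by (induction p rule: poly_mapping_induct_single) (simp_all add: skew_single skew_add)
    then have "act (taft_x n \<omega>) (cls ?R p) = cls ?R 0" for p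
      using act_x_cls[OF G X, of p] by simp
    then show False
      using inner_faithful_x_nonzero[OF n \<omega>n] act by (auto simp: taft_acts_on_down_up_def down_up_def)
  qed
  have sk: "skew ?G ?X r \<in> ?I" and su: "subst ?G r \<in> ?I" if "r \<in> ?R" for r
    using skew_x_relation_ideal[OF G X relation_idealI[OF that]] subst_g_relation_ideal[OF G relation_idealI[OF that]] by simp_all
  have cases: "p2 = 0 \<and> p3 = 0 \<and> x1 = 0 \<and>
    (x3 = 0 \<and> x2 \<noteq> 0 \<and> p1 = \<omega> * p4 \<and> (\<exists>s. s ^ 2 = \<omega> \<and> \<alpha> = inverse p1 * (1 + s) \<and> \<beta> = - (inverse p1 ^ 2) * s) \<or>
     x2 = 0 \<and> x3 \<noteq> 0 \<and> p4 = \<omega> * p1 \<and> (\<exists>s. s ^ 2 = inverse \<omega> \<and> \<alpha> = p4 * (1 + s) \<and> \<beta> = - (p4 ^ 2) * s))"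
    by (rule skew_derivation_classification[OF \<open>\<beta> \<noteq> 0\<close> \<omega>1 det _ _ _ _ nil nz])
      (use comm sk su in \<open>simp_all add: x4\<close>)
  then have p0: "p2 = 0" "p3 = 0" "x1 = 0" by auto
  have "(subst ?G ^^ m) (lform c d) = lform (p1 ^ m * c) (p4 ^ m * d)" for m c d
    by (induction m) (simp_all add: lin p0 ac_simps)
  then have roots: "p1 ^ n = 1" "p4 ^ n = 1"
    using rel(1)[of "lform 1 1"] by (auto simp: lin dest: lform_relation_ideal)
  show ?thesis
    using cases
  proof (elim conjE disjE exE)
    fix s assume h: "x3 = 0" "x2 \<noteq> 0" "p1 = \<omega> * p4" "s ^ 2 = \<omega>" "\<alpha> = inverse p1 * (1 + s)" "\<beta> = - (inverse p1 ^ 2) * s"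
    obtain k where k: "k \<le> n - 1" "p4 = \<omega> ^ k" using primitive_root_powers[OF \<omega> roots(2)] by blast
    have p1: "p1 = \<omega> ^ (k + 1)" using h k by simp
    have "inverse p1 = \<omega> powi (- int (k + 1))"
      unfolding p1 power_int_minus by (simp only: power_int_of_nat)
    moreover have "inverse p1 ^ 2 = \<omega> powi (- 2 * int (k + 1))"
    proof -
      have "inverse p1 ^ 2 = \<omega> powi (- int (k + 1) * 2)"
        unfolding calculation by (simp only: power_int_mult power_int_numeral)
      then show ?thesis by (simp only: mult.commute mult_minus_left mult_minus_right)
    qed
    moreover have "has_matrix \<alpha> \<beta> (act (taft_g n \<omega>)) ((\<omega> ^ (k + 1), 0), (0, \<omega> ^ k))"
      "has_matrix \<alpha> \<beta> (act (taft_x n \<omega>)) ((0, x2), (0, 0))"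
      using G[of DU_u] G[of DU_v] X[of DU_u] X[of DU_v] p0 h(1) x4 p1 k(2) by (simp_all add: has_matrix_iff)
    ultimately show ?thesis using h k(1) by metis
  next
    fix s assume h: "x2 = 0" "x3 \<noteq> 0" "p4 = \<omega> * p1" "s ^ 2 = inverse \<omega>" "\<alpha> = p4 * (1 + s)" "\<beta> = - (p4 ^ 2) * s"
    obtain k where k: "k \<le> n - 1" "p1 = \<omega> ^ k" using primitive_root_powers[OF \<omega> roots(1)] by blast
    have p4: "p4 = \<omega> ^ (k + 1)" using h k by simp
    then have "p4 ^ 2 = \<omega> ^ (2 * (k + 1))" by (simp only: power_mult[symmetric] mult.commute)
    moreover have "has_matrix \<alpha> \<beta> (act (taft_g n \<omega>)) ((\<omega> ^ k, 0), (0, \<omega> ^ (k + 1)))"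
      "has_matrix \<alpha> \<beta> (act (taft_x n \<omega>)) ((0, 0), (x3, 0))"
      using G[of DU_u] G[of DU_v] X[of DU_u] X[of DU_v] p0 h(1) x4 p4 k(2) by (simp_all add: has_matrix_iff)
    ultimately show ?thesis using h k(1) p4 by metis
  qed
qed

section \<open>A normal form in the Taft algebra\<close>

text \<open>The spanning half of the normal form: g x = \<omega> x g moves the letters g to the
  right, then g^n = 1 and x^n = 0 cut down the exponents.\<close>

lemma taft_normal_form:
  assumes n: "n > 0" and \<omega>: "\<omega> ^ n = 1"
  shows "\<exists>c. cls (taft_relations n \<omega>) p = cls (taft_relations n \<omega>)
    (\<Sum>i<n. \<Sum>j<n. const (c i j) * (gen Taft_x ^ i * gen Taft_g ^ j))"
proof -
  let ?c = "cls (taft_relations n \<omega>)"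
  let ?x = "gen Taft_x :: ('a, taft_gen) free" and ?g = "gen Taft_g :: ('a, taft_gen) free"
  define N where "N c = (\<Sum>i<n. \<Sum>j<n. const (c i j) * (?x ^ i * ?g ^ j))" for c
  note rel = cls_taft_relations[OF n \<omega>]
  have monomial: "\<exists>c. ?c (const d * (?x ^ i * ?g ^ j)) = ?c (N c)" for d i j
  proof (cases "i < n")
    case True
    have "?c (?g ^ j) = ?c ((?g ^ n) ^ (j div n) * ?g ^ (j mod n))"
      by (simp flip: power_mult power_add)
    also have "\<dots> = ?c (1 ^ (j div n) * ?g ^ (j mod n))"
      by (intro cls_mult_cong cls_power_cong refl rel)
    finally have "?c (const d * (?x ^ i * ?g ^ j)) = ?c (const d * (?x ^ i * ?g ^ (j mod n)))"
      by (intro cls_mult_cong refl) simp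
    also have "const d * (?x ^ i * ?g ^ (j mod n)) = N (\<lambda>i' j'. if i' = i then if j' = j mod n then d else 0 else 0)"
    proof -
      have "(\<Sum>j'<n. const (if i' = i then if j' = j mod n then d else 0 else 0) * (?x ^ i' * ?g ^ j'))
          = (if i' = i then \<Sum>j'<n. if j' = j mod n then const d * (?x ^ i * ?g ^ (j mod n)) else 0 else 0)" for i'
      proof (cases "i' = i")
        case eq: True
        have "const (if j' = j mod n then d else 0) * (?x ^ i * ?g ^ j')
            = (if j' = j mod n then const d * (?x ^ i * ?g ^ (j mod n)) else 0)" for j'
          by simp
        then show ?thesis by (simp only: eq if_True refl)
      qed simp
      then have "N (\<lambda>i' j'. if i' = i then if j' = j mod n then d else 0 else 0)
          = (\<Sum>i'<n. if i' = i then (\<Sum>j'<n. if j' = j mod n then const d * (?x ^ i * ?g ^ (j mod n)) else 0) else 0)"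
        unfolding N_def by (simp only:)
      then show ?thesis using True n by simp
    qed
    finally show ?thesis by blast
  next
    case False
    then have "?c (const d * (?x ^ i * ?g ^ j)) = ?c (const d * (?x ^ n * (?x ^ (i - n) * ?g ^ j)))"
      by (simp add: mult.assoc[symmetric] flip: power_add)
    also have "\<dots> = ?c (const d * (0 * (?x ^ (i - n) * ?g ^ j)))"
      by (intro cls_mult_cong refl rel)
    finally have "?c (const d * (?x ^ i * ?g ^ j)) = ?c (N (\<lambda>i j. 0))" by (simp add: N_def)
    then show ?thesis by blast
  qed
  have g_x: "?c (?g * ?x ^ i) = ?c (const (\<omega> ^ i) * (?x ^ i * ?g))" for i
  proof (induction i)
    case (Suc i)
    have "?c (?g * ?x ^ Suc i) = ?c ((?g * ?x) * ?x ^ i)" by (simp add: mult.assoc)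
    also have "\<dots> = ?c ((const \<omega> * ?x * ?g) * ?x ^ i)" by (intro cls_mult_cong refl rel)
    also have "\<dots> = ?c (const \<omega> * ?x * (?g * ?x ^ i))" by (simp only: mult.assoc)
    also have "\<dots> = ?c (const \<omega> * ?x * (const (\<omega> ^ i) * (?x ^ i * ?g)))" by (intro cls_mult_cong refl Suc)
    also have "const \<omega> * ?x * (const (\<omega> ^ i) * (?x ^ i * ?g)) = const (\<omega> ^ Suc i) * (?x ^ Suc i * ?g)"
      by (simp only: mult.assoc const_left_commute[of ?x] power_Suc const_mult)
    finally show ?case .
  qed simp
  have word: "\<exists>d i j. ?c (Poly_Mapping.single w 1) = ?c (const d * (?x ^ i * ?g ^ j))" for w
  proof (induction w)
    case Nil
    show ?case by (intro exI[of _ 1] exI[of _ 0]) (simp add: single_Nil_one)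
  next
    case (Cons l w)
    obtain d i j where IH: "?c (Poly_Mapping.single w 1) = ?c (const d * (?x ^ i * ?g ^ j))" using Cons by blast
    have 1: "?c (Poly_Mapping.single (l # w) 1) = ?c (gen l * (const d * (?x ^ i * ?g ^ j)))"
      unfolding single_Cons by (intro cls_mult_cong refl IH)
    show ?case
    proof (cases l)
      case Taft_x
      have "?x * (const d * (?x ^ i * ?g ^ j)) = const d * (?x ^ Suc i * ?g ^ j)"
        by (simp only: mult.assoc const_left_commute[of ?x] power_Suc)
      then show ?thesis using 1 Taft_x by metis
    next
      case Taft_g
      have "?g * (const d * (?x ^ i * ?g ^ j)) = const d * ((?g * ?x ^ i) * ?g ^ j)"
        by (simp only: mult.assoc const_left_commute[of ?g])
      also have "?c \<dots> = ?c (const d * ((const (\<omega> ^ i) * (?x ^ i * ?g)) * ?g ^ j))"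
        by (intro cls_mult_cong refl g_x)
      also have "const d * ((const (\<omega> ^ i) * (?x ^ i * ?g)) * ?g ^ j) = const (d * \<omega> ^ i) * (?x ^ i * ?g ^ Suc j)"
        by (simp only: mult.assoc power_Suc const_mult)
      finally show ?thesis using 1 Taft_g by metis
    qed
  qed
  have "\<exists>c. ?c p = ?c (N c)"
  proof (induction p rule: poly_mapping_induct_single)
    case (single w e)
    obtain d i j where "?c (Poly_Mapping.single w 1) = ?c (const d * (?x ^ i * ?g ^ j))" using word by blast
    then have "?c (const e * Poly_Mapping.single w 1) = ?c (const e * (const d * (?x ^ i * ?g ^ j)))"
      by (intro cls_mult_cong refl)
    also have "const e * (const d * (?x ^ i * ?g ^ j)) = const (e * d) * (?x ^ i * ?g ^ j)"
      by (simp only: const_mult mult.assoc)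
    finally show ?case using monomial[of "e * d" i j] by simp
  next
    case (add p q)
    then obtain c d where cd: "?c p = ?c (N c)" "?c q = ?c (N d)" by blast
    have "?c (p + q) = ?c (N c + N d)" using cd by (simp flip: add_presented)
    also have "N c + N d = N (\<lambda>i j. c i j + d i j)"
      unfolding N_def by (simp only: const_add distrib_right sum.distrib)
    finally show ?case by blast
  qed
  then show ?thesis by (simp only: N_def)
qed

text \<open>These are the quantum integers [m] at \<omega>; telescoping gives (\<omega> - 1) [m] =
  \<omega>^m - 1.\<close>

lemma primitive_root_geometric_sum:
  assumes "primitive_root n (\<omega>::'k::field)" and "n \<ge> 2" and "m > 0"
  shows "m < n \<Longrightarrow> (\<Sum>i<m. \<omega> ^ i) \<noteq> 0" and "(\<Sum>i<n. \<omega> ^ i) = 0"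
proof -
  have \<omega>1: "\<omega> \<noteq> 1" using assms by (auto simp: primitive_root_def dest: spec[of _ 1])
  have geo: "(\<omega> - 1) * (\<Sum>i<j. \<omega> ^ i) = \<omega> ^ j - 1" for j
    by (rule power_diff_1_eq[symmetric])
  show "m < n \<Longrightarrow> (\<Sum>i<m. \<omega> ^ i) \<noteq> 0"
    using geo[of m] assms(1,3) by (auto simp: primitive_root_def)
  have "(\<omega> - 1) * (\<Sum>i<n. \<omega> ^ i) = 0" using geo[of n] assms(1) by (simp add: primitive_root_def)
  then show "(\<Sum>i<n. \<omega> ^ i) = 0" using \<omega>1 by simp
qed

text \<open>Invertibility of a Vandermonde matrix: the \<open>c j\<close> are the coefficients of a
  polynomial of degree below n that has n distinct roots.\<close>

lemma primitive_root_sum_eq_0: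
  assumes "primitive_root n (\<omega>::'k::field)"
    and "\<And>l. l < n \<Longrightarrow> (\<Sum>j<n. c j * (\<omega> ^ l) ^ j) = 0" and "j < n"
  shows "c j = 0"
proof -
  define p where "p = (\<Sum>j<n. Polynomial.monom (c j) j)"
  have coeff: "coeff p i = (if i < n then c i else 0)" for i
    by (simp add: p_def coeff_sum)
  have "p = 0"
  proof (rule ccontr)
    assume p0: "p \<noteq> 0"
    have "(\<lambda>k. \<omega> ^ k) ` {..<n} \<subseteq> {x. poly p x = 0}"
      using assms(2) by (auto simp: p_def poly_sum poly_monom)
    from card_mono[OF poly_roots_finite[OF p0] this]
    have "n \<le> card {x. poly p x = 0}"
      by (simp add: card_image[OF primitive_root_inj[OF assms(1)]])
    also have "\<dots> \<le> Polynomial.degree p" by (rule card_poly_roots_bound[OF p0])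
    finally have "coeff p (Polynomial.degree p) = 0" by (simp add: coeff)
    then show False using p0 by simp
  qed
  then show ?thesis using coeff[of j] assms(3) by simp
qed

section \<open>The skew derivation on the free algebra\<close>

lemma subst_const_mult: "subst \<phi> (const c * p) = const c * subst \<phi> p"
  by (simp add: subst_mult)

lemma skew_funpow_const: "(skew \<phi> \<delta> ^^ m) (const c * p) = const c * (skew \<phi> \<delta> ^^ m) p"
  by (induction m) simp_all

lemma skew_funpow_add: "(skew \<phi> \<delta> ^^ m) (p + q) = (skew \<phi> \<delta> ^^ m) p + (skew \<phi> \<delta> ^^ m) q"
  by (induction m) (simp_all add: skew_add)

lemma skew_funpow_zero [simp]: "(skew \<phi> \<delta> ^^ m) 0 = 0"
  by (induction m) simp_all

lemma gen_const: "gen l * (const c * p) = const c * (gen l * p)"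
  by (rule const_left_commute)

text \<open>The generators \<open>a\<close>, \<open>b\<close> are \<open>u\<close>, \<open>v\<close> in the first family of actions and \<open>v\<close>, \<open>u\<close> in the second.\<close>

locale taft_free_action =
  fixes n k :: nat and \<omega> q s :: "'k::field" and a b :: down_up_gen
  assumes n: "n \<ge> 2" and \<omega>: "primitive_root n \<omega>" and q: "q \<noteq> 0" and s: "s ^ 2 = \<omega>" and ab: "a \<noteq> b"
begin

text \<open>The inverse of the eigenvalue of g on \<open>a\<close>. With it, T^2 - \<alpha> T -
  \<beta> = (T - t)(T - t s).\<close>

abbreviation t :: 'k where "t \<equiv> inverse (\<omega> ^ (k + 1))"
abbreviation \<alpha> :: 'k where "\<alpha> \<equiv> t * (1 + s)"
abbreviation \<beta> :: 'k where "\<beta> \<equiv> - (t ^ 2) * s"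
definition R :: "('k, down_up_gen) free set" where
  "R = {cubic1 \<alpha> \<beta> (gen a) (gen b), cubic2 \<alpha> \<beta> (gen a) (gen b)}"

definition G :: "down_up_gen \<Rightarrow> ('k, down_up_gen) free" where
  "G l = (if l = a then const (\<omega> ^ (k + 1)) * gen a else const (\<omega> ^ k) * gen b)"

definition X :: "down_up_gen \<Rightarrow> ('k, down_up_gen) free" where
  "X l = (if l = a then 0 else const q * gen a)"

abbreviation "g \<equiv> subst G"
abbreviation "x \<equiv> skew G X"

lemma gen_cases: "l = a \<or> l = b"
  using ab by (cases a; cases b; cases l) simp_all

lemma GX [simp]:
  "G a = const (\<omega> ^ (k + 1)) * gen a" "G b = const (\<omega> ^ k) * gen b" "X a = 0" "X b = const q * gen a"
  using ab by (simp_all add: G_def X_def)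

lemma \<omega>_power_n: "\<omega> ^ n = 1" and \<omega>_nz: "\<omega> \<noteq> 0" and \<omega>_ne_1: "\<omega> \<noteq> 1" and s_ne_1: "s \<noteq> 1"
  using \<omega> n s by (auto simp: primitive_root_def power_0_left dest: spec[of _ 1])

lemma g_cubic:
  "g (cubic1 c d (gen a) (gen b)) = const (\<omega> ^ (k + 1) * \<omega> ^ k * \<omega> ^ k) * cubic1 c d (gen a) (gen b)"
  "g (cubic2 c d (gen a) (gen b)) = const (\<omega> ^ (k + 1) * \<omega> ^ (k + 1) * \<omega> ^ k) * cubic2 c d (gen a) (gen b)"
  by (simp_all add: cubic1_def cubic2_def subst_diff subst_mult gen_const mult.assoc right_diff_distrib ac_simps)

text \<open>The parameters are left free, which shows what they must satisfy: the three coefficients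
  of the first image have to be proportional to those of \<open>cubic2\<close>, and the coefficient
  of the second has to vanish.\<close>

lemma x_cubic:
  "x (cubic1 c d (gen a) (gen b)) =
    const (q * (1 - d * \<omega> ^ (k + 1) * \<omega> ^ k)) * (gen a * gen b * gen a)
    + const (q * (\<omega> ^ k - c * \<omega> ^ (k + 1) * \<omega> ^ k)) * (gen b * gen a * gen a)
    - const (q * (c + d * \<omega> ^ (k + 1))) * (gen a * gen a * gen b)"
  "x (cubic2 c d (gen a) (gen b)) =
    const (q * (1 - c * \<omega> ^ (k + 1) - d * \<omega> ^ (k + 1) * \<omega> ^ (k + 1))) * (gen a * gen a * gen a)"
proof -
  have *: "const (e * (f - h)) * p = const (e * f) * p - const (e * h) * p" 
    "const (e * (f + h)) * p = const (e * f) * p + const (e * h) * p" for e f h :: 'k and p :: "('k, down_up_gen) free"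
    by (simp_all add: algebra_simps)
  show "x (cubic1 c d (gen a) (gen b)) =
    const (q * (1 - d * \<omega> ^ (k + 1) * \<omega> ^ k)) * (gen a * gen b * gen a)
    + const (q * (\<omega> ^ k - c * \<omega> ^ (k + 1) * \<omega> ^ k)) * (gen b * gen a * gen a)
    - const (q * (c + d * \<omega> ^ (k + 1))) * (gen a * gen a * gen b)"
    unfolding * 
    by (simp add: cubic1_def skew_diff skew_mult subst_mult gen_const mult.assoc distrib_left distrib_right ac_simps)
  show "x (cubic2 c d (gen a) (gen b)) =
    const (q * (1 - c * \<omega> ^ (k + 1) - d * \<omega> ^ (k + 1) * \<omega> ^ (k + 1))) * (gen a * gen a * gen a)"
    unfolding *
    by (simp add: cubic2_def skew_diff skew_mult subst_mult gen_const mult.assoc distrib_left distrib_right ac_simps)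
qed

lemma g_relation: "r \<in> R \<Longrightarrow> g r \<in> relation_ideal R"
  unfolding R_def
  by (elim insertE emptyE; hypsubst; unfold g_cubic; intro relation_ideal_mult_left relation_idealI insertI1 insertI2)

lemma t_l: "t * \<omega> ^ (k + 1) = 1"
  using \<omega>_nz by (intro left_inverse) simp

text \<open>\<open>T\<close>, \<open>L\<close>, \<open>M\<close> stand for \<open>t\<close>,
  \<omega>^(k+1) and \<omega>^k; opaque letters leave a polynomial problem free of inverses and
  symbolic exponents. The identities say that x maps the first relator to a multiple of the second,
  and the second to zero.\<close>

lemma parameter_identities:
  fixes T L M :: 'k
  assumes "T * L = 1" "L = s ^ 2 * M"
  shows "1 - (- (T ^ 2) * s) * L * M = - (T * (1 + s)) * (M - T * (1 + s) * L * M)"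
    and "T * (1 + s) + - (T ^ 2) * s * L = - (T ^ 2) * s * (M - T * (1 + s) * L * M)"
    and "1 - T * (1 + s) * L - (- (T ^ 2) * s) * L * L = 0"
  using assms by Groebner_Basis.algebra+

lemma x_relation:
  assumes "r \<in> R" shows "x r \<in> relation_ideal R"
proof -
  let ?l = "\<omega> ^ (k + 1)" and ?m = "\<omega> ^ k"
  let ?e = "?m - \<alpha> * ?l * ?m"
  have l: "?l = s ^ 2 * ?m" using s by simp
  have collect: "const (q * (- c * e)) * (gen a * gen b * gen a) + const (q * e) * (gen b * gen a * gen a)
      - const (q * (d * e)) * (gen a * gen a * gen b) = const (q * e) * cubic2 c d (gen a) (gen b)" for c d e
    by (simp add: cubic2_def right_diff_distrib const_minus ac_simps)
  note params = parameter_identities[OF t_l l]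
  have "x (cubic1 \<alpha> \<beta> (gen a) (gen b)) = const (q * ?e) * cubic2 \<alpha> \<beta> (gen a) (gen b)"
    unfolding x_cubic(1) params(1,2) by (rule collect) 
  moreover have "x (cubic2 \<alpha> \<beta> (gen a) (gen b)) = 0"
    unfolding x_cubic(2) params(3) by simp
  moreover have "const (q * ?e) * cubic2 \<alpha> \<beta> (gen a) (gen b) \<in> relation_ideal R"
    unfolding R_def by (intro relation_ideal_mult_left relation_idealI) simp
  ultimately show ?thesis using assms by (auto simp: R_def)
qed

lemma g_relation_ideal: "p \<in> relation_ideal R \<Longrightarrow> g p \<in> relation_ideal R"
  by (rule subst_relation_ideal[OF _ g_relation])

lemma x_relation_ideal: "p \<in> relation_ideal R \<Longrightarrow> x p \<in> relation_ideal R"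
  by (rule skew_relation_ideal[OF _ g_relation x_relation])

text \<open>On generators this holds because the eigenvalue of g on \<open>a\<close> is \<omega>
  times that on \<open>b\<close>; the twisted product rule carries it over to words.\<close>

lemma g_x: "g (x p) = const \<omega> * x (g p)"
proof (induction p rule: poly_mapping_induct_single)
  case (single w c)
  have "g (x (Poly_Mapping.single w 1)) = const \<omega> * x (g (Poly_Mapping.single w 1))"
  proof (induction w)
    case (Cons l w)
    have gen: "g (X l) = const \<omega> * x (G l)" and G: "\<exists>d. G l = const d * gen l"
      using gen_cases[of l] by (auto simp: subst_const_mult ac_simps)
    show ?case
      unfolding single_Cons skew_mult subst_mult subst_gen skew_gen subst_add gen Cons distrib_left
      by (simp only: mult.assoc const_left_commute[of _ \<omega>])
  qed (simp add: single_Nil_one)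
  then have "const c * g (x (Poly_Mapping.single w 1)) = const c * (const \<omega> * x (g (Poly_Mapping.single w 1)))"
    by simp
  then show ?case
    by (subst (1 2) single_eq_const) (simp only: skew_const_mult subst_const_mult const_left_commute[of "const \<omega>" c])
qed (simp add: subst_add skew_add distrib_left)

lemma g_power_n: "(g ^^ n) p = p"
proof -
  have "(\<lambda>l. if l = a then gen a else gen b) = (gen :: _ \<Rightarrow> ('k, _) free)"
    using gen_cases by (auto simp: fun_eq_iff)
  then have id: "subst (\<lambda>l. if l = a then gen a else gen b) p = p" for p :: "('k, _) free"
    by (simp only: subst_id)
  have "(g ^^ m) p = subst (\<lambda>l. if l = a then const ((\<omega> ^ (k + 1)) ^ m) * gen a else const ((\<omega> ^ k) ^ m) * gen b) p" for m
  proof (induction m)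
    case 0
    show ?case unfolding power_0 const_one mult_1 id by simp
  next
    case (Suc m)
    show ?case
      unfolding funpow.simps o_apply Suc subst_subst
      by (intro arg_cong[of _ _ "\<lambda>\<phi>. subst \<phi> p"] ext) (auto simp: subst_const_mult ac_simps)
  qed
  moreover have "(\<omega> ^ (k + 1)) ^ n = 1" "(\<omega> ^ k) ^ n = 1"
    by (metis \<omega>_power_n mult.commute power_mult power_one)+
  ultimately have "(g ^^ n) p = subst (\<lambda>l. if l = a then const 1 * gen a else const 1 * gen b) p" by metis
  then show ?thesis unfolding const_one mult_1 id .
qed

lemma x_power_a: "(x ^^ m) (gen a * p) = const ((\<omega> ^ (k + 1)) ^ m) * (gen a * (x ^^ m) p)"
  by (induction m) (simp_all add: skew_mult subst_mult gen_const mult.assoc ac_simps)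

text \<open>Apart from \<open>q\<close> and a power of \<omega>^k this is the quantum integer
  [m + 1], a quantum binomial coefficient. Since x^2 kills b, the quantum Leibniz formula for
  x^(m+1) (b p) has only two terms, and \<open>C m\<close> belongs to the exponent m + 1; hence the
  one that vanishes is \<open>C (n - 1)\<close>.\<close>

definition C :: "nat \<Rightarrow> 'k" where "C m = q * (\<omega> ^ k) ^ m * (\<Sum>i<Suc m. \<omega> ^ i)"

lemma C_Suc: "C (Suc m) = q * (\<omega> ^ k) ^ Suc m + \<omega> ^ (k + 1) * C m"
proof -
  have "(\<Sum>i<Suc (Suc m). \<omega> ^ i) = 1 + \<omega> * (\<Sum>i<Suc m. \<omega> ^ i)"
    unfolding sum.lessThan_Suc_shift[of _ "Suc m"] sum_distrib_left by simp
  then show ?thesis unfolding C_def by (simp only: algebra_simps power_Suc power_add power_one_right mult_1_left)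
qed

lemma x_power_b: "(x ^^ Suc m) (gen b * p) =
  const ((\<omega> ^ k) ^ Suc m) * (gen b * (x ^^ Suc m) p) + const (C m) * (gen a * (x ^^ m) p)"
proof (induction m)
  case 0
  show ?case by (simp add: skew_mult mult.assoc C_def)
next
  case (Suc m)
  have "(x ^^ Suc (Suc m)) (gen b * p) =
      x (const ((\<omega> ^ k) ^ Suc m) * (gen b * (x ^^ Suc m) p) + const (C m) * (gen a * (x ^^ m) p))"
    by (simp only: funpow.simps o_apply Suc[unfolded funpow.simps o_apply])
  also have "\<dots> = const ((\<omega> ^ k) ^ Suc m) * (const (\<omega> ^ k) * gen b * (x ^^ Suc (Suc m)) p + const q * gen a * (x ^^ Suc m) p)
      + const (C m) * (const (\<omega> ^ (k + 1)) * gen a * (x ^^ Suc m) p)"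
    unfolding skew_add skew_const_mult
    by (simp only: skew_mult subst_gen skew_gen GX mult_zero_left add_0_right funpow.simps o_apply)
  also have "\<dots> = const ((\<omega> ^ k) ^ Suc (Suc m)) * (gen b * (x ^^ Suc (Suc m)) p) + const (C (Suc m)) * (gen a * (x ^^ Suc m) p)"
    unfolding C_Suc by (simp only: distrib_left distrib_right const_add const_mult mult.assoc power_Suc2 add.assoc) (simp add: ac_simps)
  finally show ?case .
qed

lemma C_last: "C (n - 1) = 0"
  using primitive_root_geometric_sum(2)[OF \<omega> n, of 1] n by (simp add: C_def)

lemma C_nz: "Suc m < n \<Longrightarrow> C m \<noteq> 0"
  using primitive_root_geometric_sum(1)[OF \<omega> n, of "Suc m"] q \<omega>_nz by (simp add: C_def)

lemma x_power_n: "(x ^^ n) p = 0"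
proof (induction p rule: poly_mapping_induct_single)
  case (single w c)
  obtain m where m: "n = Suc m" using n by (cases n) auto
  have "(x ^^ n) (Poly_Mapping.single w 1) = 0"
  proof (induction w)
    case Nil
    show ?case by (simp only: m funpow_Suc_right o_apply single_Nil_one skew_one) simp
  next
    case (Cons l w)
    have "C m = 0" using C_last m by simp
    then show ?case
      using gen_cases[of l] Cons
      by (auto simp only: single_Cons x_power_a x_power_b[of m, folded m] mult_zero_right const_zero mult_zero_left add_0_right)
  qed
  then show ?case by (subst single_eq_const) (simp only: skew_funpow_const mult_zero_right)
qed (simp add: skew_funpow_add)

text \<open>The free algebra in g and x acts on the free algebra in u and v. The Taft relators act
  there by zero exactly, before any quotient by \<open>R\<close> is taken.\<close>

sublocale free_rep "\<lambda>c p. const c * p" "case_taft_gen x g"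
proof
  show "case_taft_gen x g l (f + h) = case_taft_gen x g l f + case_taft_gen x g l h" for l and f h
    by (cases l) (simp_all add: skew_add subst_add)
  show "case_taft_gen x g l (const c * f) = const c * case_taft_gen x g l f" for l c f
    by (cases l) (simp_all add: subst_const_mult)
qed

lemma rep_taft: "rep (gen Taft_x) = x" "rep (gen Taft_g) = g"
  by (simp_all add: rep_gen_fun)

lemma rep_taft_relation_ideal:
  assumes "p \<in> relation_ideal (taft_relations n \<omega>)" shows "rep p f = 0"
proof (rule rep_relation_ideal[OF assms])
  fix r f assume "r \<in> taft_relations n \<omega>"
  then show "rep r f = 0"
    by (auto simp: taft_relations_def Let_def rep_diff rep_power rep_mult rep_gen_fun g_power_n x_power_n g_x)
qed

lemma foldr_relation_ideal:
  "f \<in> relation_ideal R \<Longrightarrow> foldr (case_taft_gen x g) w f \<in> relation_ideal R"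
proof (induction w)
  case (Cons l w)
  then show ?case by (cases l) (simp_all add: x_relation_ideal g_relation_ideal)
qed simp

lemma rep_down_up_relation_ideal:
  assumes "f \<in> relation_ideal R" shows "rep p f \<in> relation_ideal R"
  by (induction p rule: poly_mapping_induct_single)
    (simp_all add: rep_single rep_add relation_ideal_add relation_ideal_mult_left foldr_relation_ideal assms)

end

section \<open>The Hopf action\<close>

lemma lin_cong: "(\<And>w. w \<in> Poly_Mapping.keys t \<Longrightarrow> f w = h w) \<Longrightarrow> lin sc f t = lin sc h t"
  by (simp add: lin_def)

lemma (in vector_space) lin_map_scale:
  "lin scale f (Poly_Mapping.map ((*) c) t) = scale c (lin scale f t)"
proof (induction t rule: poly_mapping_induct_single)
  case (add p q)
  have "Poly_Mapping.map ((*) c) (p + q) = Poly_Mapping.map ((*) c) p + Poly_Mapping.map ((*) c) q"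
    by (rule tensor_scale.scale_right_distrib)
  then show ?case using add by (simp add: lin_add scale_right_distrib)
qed simp

lemma (in vector_space) lin_lin:
  "lin scale f (lin (\<lambda>c. Poly_Mapping.map ((*) c)) h t) = lin scale (\<lambda>w. lin scale f (h w)) t"
  by (induction t rule: poly_mapping_induct_single) (simp_all add: lin_map_scale tensor_scale.lin_add lin_add)

lemma (in vector_space) lin_linear:
  assumes "\<And>p q. L (p + q) = L p + L q" and "\<And>c p. L (scale c p) = scale c (L p)"
  shows "L (lin scale f t) = lin scale (\<lambda>w. L (f w)) t"
  by (induction t rule: poly_mapping_induct_single) (simp_all add: lin_add assms)

definition homogeneous :: "nat \<Rightarrow> ('k::field, 'g) free set" where
  "homogeneous i = {p. \<forall>w\<in>Poly_Mapping.keys p. length w = i}"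

lemma homogeneous_zero [simp]: "0 \<in> homogeneous i"
  by (simp add: homogeneous_def)

lemma homogeneous_add: "p \<in> homogeneous i \<Longrightarrow> q \<in> homogeneous i \<Longrightarrow> p + q \<in> homogeneous i"
  using keys_add[of p q] by (auto simp: homogeneous_def)

lemma homogeneous_mult: "p \<in> homogeneous i \<Longrightarrow> q \<in> homogeneous j \<Longrightarrow> p * q \<in> homogeneous (i + j)"
  using keys_mult[of p q] by (fastforce simp: homogeneous_def plus_list_def)

lemma homogeneous_single: "Poly_Mapping.single w c \<in> homogeneous (length w)"
  by (simp add: homogeneous_def)

lemma homogeneous_const_mult: "p \<in> homogeneous i \<Longrightarrow> const c * p \<in> homogeneous i"
  using homogeneous_mult[of "const c" 0 p i] homogeneous_single[of "[]" c] by (simp add: const_def)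

lemma homogeneous_lin:
  fixes f :: "'a \<Rightarrow> ('k::field, 'g) free"
  assumes "\<And>w. w \<in> Poly_Mapping.keys p \<Longrightarrow> f w \<in> homogeneous i"
  shows "lin (\<lambda>c p. const c * p) f p \<in> homogeneous i"
proof -
  have sum: "sum h S \<in> homogeneous i" if "\<And>w. w \<in> S \<Longrightarrow> h w \<in> homogeneous i" for h :: "_ \<Rightarrow> ('k, 'g) free" and S
    using that by (induction S rule: infinite_finite_induct) (auto intro: homogeneous_add)
  show ?thesis
    unfolding lin_def by (intro sum homogeneous_const_mult assms)
qed

context taft_free_action
begin

abbreviation "RT \<equiv> taft_relations n \<omega>"

text \<open>Any representative gives the same operator, because the ideal of Taft relators acts by
  zero on the free algebra in u and v.\<close>

definition rho :: "('k, taft_gen) free set \<Rightarrow> ('k, down_up_gen) free \<Rightarrow> ('k, down_up_gen) free" where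
  "rho h f = rep (SOME p. p \<in> h) f"

lemma rho_cls [simp]: "rho (cls RT p) f = rep p f"
proof -
  have "(SOME q. q \<in> cls RT p) \<in> cls RT p" by (rule someI[of _ p]) (rule self_in_cls)
  then have "rep ((SOME q. q \<in> cls RT p) - p) f = 0"
    by (intro rep_taft_relation_ideal) (simp add: in_cls_iff)
  then show ?thesis by (simp add: rho_def rep_diff)
qed

definition act :: "('k, taft_gen) free set \<Rightarrow> ('k, down_up_gen) free set \<Rightarrow> ('k, down_up_gen) free set" where
  "act h F = cls R (rho h (SOME f. f \<in> F))"

lemma act_rho: "act h (cls R f) = cls R (rho h f)"
proof -
  have "(SOME q. q \<in> cls R f) \<in> cls R f" by (rule someI[of _ f]) (rule self_in_cls)
  then have "rho h ((SOME q. q \<in> cls R f) - f) \<in> relation_ideal R"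
    unfolding rho_def by (intro rep_down_up_relation_ideal) (simp add: in_cls_iff)
  moreover have "rep p (f' - f) = rep p f' - rep p f" for p f'
    using rep_vector_add[of p "f' - f" f] by simp
  ultimately show ?thesis by (simp add: act_def cls_eq_iff rho_def)
qed

lemma act_cls: "act (cls RT p) (cls R f) = cls R (rep p f)"
  by (simp add: act_rho)

lemma left_module_act: "left_module (taft n \<omega>) (presented R) act"
  unfolding left_module_def
  by (auto elim!: carrier_presentedE
      simp: presented_cls act_cls rep_add rep_mult rep_vector_add rep_vector_scale)

abbreviation kernel :: "('k, down_up_gen) free \<Rightarrow> ('k, down_up_gen) free \<Rightarrow> ('k, taft_gen) free set \<times> ('k, taft_gen) free set \<Rightarrow> ('k, down_up_gen) free" where
  "kernel f h \<equiv> \<lambda>p. rho (fst p) f * rho (snd p) h"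

text \<open>The map sending (h1, h2) to the product of h1 f and h2 h is bilinear, so its linear
  extension descends to the tensor product. Hence the product axiom may be checked at a single
  representative of each coproduct.\<close>

lemma kernel_tensor_null:
  assumes "z \<in> tensor_null (presented RT) (presented RT)"
  shows "lin (\<lambda>c p. const c * p) (kernel f h) z = 0"
  using assms
  by (induction rule: tensor_null.induct)
    (auto elim!: carrier_presentedE
      simp: const_scale.lin_diff presented_cls rep_add rep_mult distrib_left distrib_right
        const_left_commute[of "rep _ _"] mult.assoc mult.commute[of _ "_ :: 'k"])

text \<open>Multiplying a coproduct on the left by that of one more letter amounts to applying the
  letter to a product: multiplicativity for g, the twisted product rule for x.\<close>

lemma kernel_comult_word:
  "lin (\<lambda>c p. const c * p) (kernel f h) (taft_comult_word n \<omega> w) = foldr (case_taft_gen x g) w (f * h)"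
proof (induction w)
  case Nil
  show ?case by (simp add: taft_algebra_def one_presented)
next
  case (Cons l w)
  let ?t = "taft_comult_word n \<omega> w"
  have n0: "n > 0" using n by simp
  note keys = keys_taft_comult_word[OF n0 \<omega>_power_n, of w]
  have step: "lin (\<lambda>c p. const c * p) (kernel f h)
      (tensor_mult (presented RT) (presented RT) (Poly_Mapping.single (cls RT p, cls RT q) 1) ?t)
    = lin (\<lambda>c p. const c * p) (\<lambda>z. rep p (rho (fst z) f) * rep q (rho (snd z) h)) ?t" for p q
  proof -
    have "lin (\<lambda>c p. const c * p) (kernel f h)
      (tensor_mult (presented RT) (presented RT) (Poly_Mapping.single (cls RT p, cls RT q) 1) ?t)
      = lin (\<lambda>c p. const c * p) (\<lambda>z. rho (cls RT p \<otimes>\<^bsub>presented RT\<^esub> fst z) f * rho (cls RT q \<otimes>\<^bsub>presented RT\<^esub> snd z) h) ?t"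
      by (simp add: tensor_mult_lin const_scale.lin_lin)
    also have "\<dots> = lin (\<lambda>c p. const c * p) (\<lambda>z. rep p (rho (fst z) f) * rep q (rho (snd z) h)) ?t"
    proof (rule lin_cong)
      \<comment> \<open>The product of the quotient is known on classes only, so the pairs in the
        support must come from the carrier.\<close>
      fix z assume "z \<in> Poly_Mapping.keys ?t"
      then have "fst z \<in> carrier (presented RT)" "snd z \<in> carrier (presented RT)"
        using keys by (auto dest!: subsetD)
      then show "rho (cls RT p \<otimes>\<^bsub>presented RT\<^esub> fst z) f * rho (cls RT q \<otimes>\<^bsub>presented RT\<^esub> snd z) h
        = rep p (rho (fst z) f) * rep q (rho (snd z) h)"
        by (elim carrier_presentedE) (simp add: mult_presented rep_mult)
    qed
    finally show ?thesis .
  qed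
  show ?case
  proof (cases l)
    case Taft_g
    have "g (lin (\<lambda>c p. const c * p) (kernel f h) ?t) = lin (\<lambda>c p. const c * p) (\<lambda>z. g (kernel f h z)) ?t"
      by (rule const_scale.lin_linear) (simp_all add: subst_add subst_const_mult)
    then show ?thesis
      using Cons step[of "gen Taft_g" "gen Taft_g"] 
      by (simp add: Taft_g taft_algebra_def taft_g_def rep_taft subst_mult)
  next
    case Taft_x
    have "x (lin (\<lambda>c p. const c * p) (kernel f h) ?t) = lin (\<lambda>c p. const c * p) (\<lambda>z. x (kernel f h z)) ?t"
      by (rule const_scale.lin_linear) (simp_all add: skew_add)
    then show ?thesis
      using Cons step[of "gen Taft_g" "gen Taft_x"] step[of "gen Taft_x" 1]
      by (simp add: Taft_x taft_algebra_def taft_g_def taft_x_def rep_taft skew_mult one_presented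
          tensor_mult_add_left const_scale.lin_add const_scale.lin_fun_add)
  qed
qed

lemma rep_one_vector: "rep p 1 = const (taft_counit_free p)"
proof -
  have "foldr (case_taft_gen x g) w 1 = const (prod_list (map taft_counit_gen w))" for w
  proof (induction w)
    case (Cons l w)
    then show ?case by (cases l) simp_all
  qed simp
  then show ?thesis
    by (induction p rule: poly_mapping_induct_single)
      (simp_all add: rep_single rep_add taft_counit_free_add const_add, simp add: taft_counit_free_lin const_mult)
qed

lemma hopf_action_act: "hopf_action (taft n \<omega>) (presented R) act"
  unfolding hopf_action_def
proof (intro conjI ballI left_module_act)
  fix h assume "h \<in> carrier (taft n \<omega>)"
  then obtain p where h: "h = cls RT p" by (auto elim: carrier_presentedE)
  have n0: "n > 0" using n by simp
  show "act h \<one>\<^bsub>presented R\<^esub> = counit (taft n \<omega>) h \<odot>\<^bsub>presented R\<^esub> \<one>\<^bsub>presented R\<^esub>"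
    unfolding h counit_taft[OF n0] by (simp add: presented_cls act_cls rep_one_vector)
  fix F H t assume "F \<in> carrier (presented R)" "H \<in> carrier (presented R)" and t: "t \<in> comult (taft n \<omega>) h"
  then obtain e f where F: "F = cls R e" and H: "H = cls R f" by (auto elim!: carrier_presentedE)
  from t obtain p' z where p': "p' \<in> cls RT p" and z: "z \<in> tensor_null (presented RT) (presented RT)"
    and t: "t = taft_comult_free n \<omega> p' + z"
    unfolding h taft_simps tensor_class_def taft_algebra_def by blast
  have "rep p' (e * f) = rep p (e * f)"
    using rep_taft_relation_ideal[of "p' - p"] p' by (simp add: in_cls_iff rep_diff)
  moreover have "lin (\<lambda>c p. const c * p) (kernel e f) (taft_comult_free n \<omega> p') = rep p' (e * f)"
    by (simp add: taft_comult_free_lin const_scale.lin_lin kernel_comult_word rep_def)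
  ultimately have "lin (\<lambda>c p. const c * p) (kernel e f) t = rep p (e * f)"
    unfolding t by (simp add: const_scale.lin_add kernel_tensor_null[OF z])
  then show "act h (F \<otimes>\<^bsub>presented R\<^esub> H) = (\<Oplus>\<^bsub>presented R\<^esub>p\<in>Poly_Mapping.keys t.
      Poly_Mapping.lookup t p \<odot>\<^bsub>presented R\<^esub> (act (fst p) F \<otimes>\<^bsub>presented R\<^esub> act (snd p) H))"
    unfolding h F H by (simp add: mult_presented act_cls act_rho finsum_lin_cls)
qed

lemma homogeneous_act:
  assumes "F \<in> cls R ` homogeneous i"
  shows "act h F \<in> cls R ` homogeneous i"
proof -
  obtain f where f: "F = cls R f" "f \<in> homogeneous i" using assms by blast
  have gen: "(gen l :: ('k, down_up_gen) free) \<in> homogeneous 1" for l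
    using homogeneous_single[of "[l]" 1] by (simp add: gen_def)
  have G: "G l \<in> homogeneous 1" and X: "X l \<in> homogeneous 1" for l
    using gen by (simp_all add: G_def X_def homogeneous_const_mult)
  have "prod_list (map G w) \<in> homogeneous (length w)" for w
  proof (induction w)
    case Nil
    show ?case using homogeneous_single[of "[]" 1] by (simp add: single_Nil_one)
  next
    case (Cons l w)
    then show ?case using homogeneous_mult[OF G] by fastforce
  qed
  then have g: "g p \<in> homogeneous i" if "p \<in> homogeneous i" for p
    using that unfolding subst_def by (intro homogeneous_lin) (auto simp: homogeneous_def)
  have "skew_word G X w \<in> homogeneous (length w)" for w
  proof (induction w)
    case (Cons l w)
    then show ?case
      using homogeneous_mult[OF G Cons] homogeneous_mult[OF X homogeneous_single[of w 1]]
      by (simp add: homogeneous_add)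
  qed simp
  then have x: "x p \<in> homogeneous i" if "p \<in> homogeneous i" for p
    using that unfolding skew_def by (intro homogeneous_lin) (auto simp: homogeneous_def)
  have "foldr (case_taft_gen x g) w f \<in> homogeneous i" for w
    using f(2) by (induction w) (auto intro: g x split: taft_gen.split)
  then have "rho h f \<in> homogeneous i"
    unfolding rho_def rep_def by (intro homogeneous_lin)
  then show ?thesis by (simp add: f(1) act_rho)
qed

end

section \<open>Faithfulness\<close>

context taft_free_action
begin

text \<open>Since x (a b) = \<omega>^(k+1) q a a and x (b a) = q a a, this twisted commutator is the
  combination of a b and b a that x kills.\<close>

definition y :: "('k, down_up_gen) free" where
  "y = gen a * gen b - const (\<omega> ^ (k + 1)) * (gen b * gen a)"

lemma x_y: "x y = 0"
  by (simp add: y_def skew_diff skew_mult subst_mult gen_const mult.assoc ac_simps)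

lemma g_y: "g y = const (\<omega> ^ (2 * k + 1)) * y"
proof -
  have "g y = const (\<omega> ^ (k + 1) * \<omega> ^ k) * (gen a * gen b) - const (\<omega> ^ (k + 1) * (\<omega> ^ (k + 1) * \<omega> ^ k)) * (gen b * gen a)"
    by (simp add: y_def subst_diff subst_mult gen_const mult.assoc ac_simps)
  also have "\<dots> = const (\<omega> ^ (2 * k + 1)) * y"
  proof -
    have "\<omega> ^ (2 * k + 1) = \<omega> ^ (k + 1) * \<omega> ^ k" by (simp add: mult_2 flip: power_add)
    then show ?thesis
      unfolding y_def right_diff_distrib const_scale.scale_scale by (simp only: ac_simps)
  qed
  finally show ?thesis .
qed

text \<open>Elements killed by \<open>x\<close>. The weights of \<open>a\<close> and \<open>y\<close> are \<open>\<omega>\<close> to the powers \<open>k + 1\<close> and \<open>2k + 1\<close>, and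
  \<open>2 (k + 1) + (n - 1) (2k + 1)\<close> is congruent to \<open>1\<close> modulo \<open>n\<close>, so that all weights occur.\<close>

definition hw :: "nat \<Rightarrow> ('k, down_up_gen) free" where
  "hw m = gen a ^ (2 * m) * y ^ ((n - 1) * m)"

lemma x_power_kernel: "x p = 0 \<Longrightarrow> x (p ^ m) = 0"
  by (induction m) (simp_all add: skew_mult)

lemma x_hw: "x (hw m) = 0"
proof -
  have "x (gen a ^ i) = 0" "x (y ^ i) = 0" for i
    using x_y by (intro x_power_kernel; simp)+
  then show ?thesis by (simp add: hw_def skew_mult)
qed

lemma const_mult_power: "(const c * p) ^ m = const (c ^ m) * p ^ m"
  by (induction m) (simp_all add: const_mult_mult)

lemma g_hw: "g (hw m) = const (\<omega> ^ m) * hw m"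
proof -
  have e: "(k + 1) * (2 * m) + (2 * k + 1) * ((n - 1) * m) = m + n * ((2 * k + 1) * m)"
    using n by (cases n) (simp_all add: algebra_simps)
  have "(\<omega> ^ (k + 1)) ^ (2 * m) * (\<omega> ^ (2 * k + 1)) ^ ((n - 1) * m) = \<omega> ^ m * (\<omega> ^ n) ^ ((2 * k + 1) * m)"
    unfolding power_mult[symmetric] power_add[symmetric] e ..
  then show ?thesis
    unfolding hw_def subst_mult subst_power g_y subst_gen GX const_mult_power const_mult_mult
    by (simp add: \<omega>_power_n)
qed

text \<open>On a vector killed by x, each application of x to b^j f trades one b for an a. The
  scalar is a quantum factorial up to powers of \<omega> and \<open>q\<close>. The two parts go
  through one induction because each step uses both the surviving term and the vanishing
  one.\<close>

lemma x_power_b_power: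
  assumes "x f = 0"
  shows "(x ^^ Suc j) (gen b ^ j * f) = 0"
    and "(x ^^ j) (gen b ^ j * f) = const (\<Prod>i<j. C i) * (gen a ^ j * f)"
proof (induction j)
  case 0
  { case 1 show ?case using assms by simp next case 2 show ?case by simp }
next
  case (Suc j)
  have 0: "(x ^^ Suc (Suc j)) (gen b ^ j * f) = 0"
    using Suc(1) by simp
  { case 1
    show ?case
      unfolding power_Suc mult.assoc x_power_b[of "Suc j"] Suc(1) 0 by simp
  next
    case 2
    have "(x ^^ Suc j) (gen b ^ Suc j * f) = const (C j) * (gen a * (const (\<Prod>i<j. C i) * (gen a ^ j * f)))"
      unfolding power_Suc mult.assoc x_power_b[of j] Suc(1) Suc(2) by simp
    then show ?case by (simp add: gen_const mult.assoc ac_simps) }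
qed

lemma a_power_hw_not_relation: "gen a ^ i * hw m \<notin> relation_ideal R"
proof
  assume mem: "gen a ^ i * hw m \<in> relation_ideal R"
  \<comment> \<open>\<open>\<tau>\<close> is a root of \<open>T\<^sup>2 - \<alpha> T - \<beta>\<close>, so the relations hold in the quantum plane \<open>b a = \<tau> a b\<close>, which acts on
    polynomials: \<open>a\<close> multiplies by the variable and \<open>b\<close> rescales it.\<close>
  define \<tau> where "\<tau> = t * s"
  define A :: "down_up_gen \<Rightarrow> 'k poly \<Rightarrow> 'k poly" where
    "A l f = (if l = a then [:0, 1:] * f else pcompose f [:0, \<tau>:])" for l f
  interpret P: vector_space "Polynomial.smult :: 'k \<Rightarrow> 'k poly \<Rightarrow> 'k poly" by (rule vector_space_smult)
  interpret Q: free_rep Polynomial.smult A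
    by unfold_locales (simp_all add: A_def pcompose_add pcompose_smult distrib_left)
  have A: "A a f = [:0, 1:] * f" "A b f = pcompose f [:0, \<tau>:]" for f
    using ab by (simp_all add: A_def)
  have \<tau>2: "\<tau> * \<tau> = \<alpha> * \<tau> + \<beta>" unfolding \<tau>_def by Groebner_Basis.algebra
  have b: "A b (A a f) = Polynomial.smult \<tau> (A a (A b f))" for f
    by (simp add: A pcompose_pCons)
  have "Q.rep (cubic1 c d (gen a) (gen b)) f = Polynomial.smult (\<tau> * \<tau> - c * \<tau> - d) (A a (A b (A b f)))"
    "Q.rep (cubic2 c d (gen a) (gen b)) f = Polynomial.smult (\<tau> * \<tau> - c * \<tau> - d) (A a (A a (A b f)))" for c d f
    unfolding cubic1_def cubic2_def
    by (simp_all add: Q.rep_diff Q.rep_mult b Q.A_scale smult_diff_left)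
  moreover have "\<tau> * \<tau> - \<alpha> * \<tau> - \<beta> = 0" using \<tau>2 by Groebner_Basis.algebra
  ultimately have "Q.rep r f = 0" if "r \<in> R" for r f
    using that unfolding R_def by (elim insertE emptyE) (simp_all only: P.scale_zero_left)
  then have 0: "Q.rep (gen a ^ i * hw m) 1 = 0"
    using Q.rep_relation_ideal[OF mem] by blast
  \<comment> \<open>Nonzero monomials are preserved by a and by y, so no cancellation can
    occur.\<close>
  define mono where "mono f \<longleftrightarrow> (\<exists>c j. c \<noteq> 0 \<and> f = Polynomial.monom c j)" for f :: "'k poly"
  have "\<tau> \<noteq> 0" using s \<omega>_nz by (auto simp: \<tau>_def)
  have a_mono: "mono (A a f)" if "mono f" for f
    using that by (auto simp: mono_def A simp flip: monom_Suc) blast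
  have y_mono: "mono (Q.rep y f)" if mf: "mono f" for f
  proof -
    obtain c j where c: "c \<noteq> 0" and f: "f = Polynomial.monom c j" using mf by (auto simp: mono_def)
    have "A b (Polynomial.monom c j) = Polynomial.monom (c * \<tau> ^ j) j"
      by (induction j) (simp_all add: A monom_Suc monom_0 pcompose_pCons smult_monom ac_simps)
    \<comment> \<open>In the quantum plane y acts as (1 - \<omega>^(k+1) \<tau>) a b, and
      \<omega>^(k+1) \<tau> = s. This is nonzero because s^2 = \<omega> and \<omega> differs from
      1.\<close>
    moreover have "Q.rep y f = Polynomial.smult (1 - s) (A a (A b f))"
    proof -
      have "\<omega> ^ (k + 1) * \<tau> = (t * \<omega> ^ (k + 1)) * s" unfolding \<tau>_def by (simp only: mult_ac)
      then have "\<omega> ^ (k + 1) * \<tau> = s" unfolding t_l by simp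
      then show ?thesis
        by (simp only: y_def Q.rep_diff Q.rep_mult Q.rep_gen Q.rep_const b P.scale_scale P.scale_left_diff_distrib P.scale_one)
    qed
    ultimately show ?thesis using c s_ne_1 \<open>\<tau> \<noteq> 0\<close>
      unfolding mono_def f by (intro exI[of _ "(1 - s) * (c * \<tau> ^ j)"] exI[of _ "Suc j"]) (simp add: A smult_monom flip: monom_Suc)
  qed
  have "mono (1 :: 'k poly)" unfolding mono_def by (intro exI[of _ 1] exI[of _ 0]) simp
  then have "mono ((Q.rep y ^^ j) 1)" for j by (induction j) (simp_all add: y_mono)
  moreover have "mono ((A a ^^ j) f)" if "mono f" for j f
    using that by (induction j) (simp_all add: a_mono)
  ultimately have "mono ((A a ^^ i) ((A a ^^ (2 * m)) ((Q.rep y ^^ ((n - 1) * m)) 1)))" by blast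
  then have "mono (Q.rep (gen a ^ i * hw m) 1)"
    by (simp only: hw_def Q.rep_mult Q.rep_power Q.rep_gen_fun)
  then show False unfolding 0 by (auto simp: mono_def)
qed

lemma weight_vector:
  obtains e where "g e = const (\<omega> ^ l) * e" and "(x ^^ (n - 1)) e \<notin> relation_ideal R"
proof
  \<comment> \<open>The power of b lets x^(n-1) act without vanishing. Its weight is \<omega>^(-k),
    which the shift of the index by \<open>k\<close> compensates.\<close>
  let ?e = "gen b ^ (n - 1) * hw (l + k)"
  have "\<omega> ^ (k * (n - 1)) * \<omega> ^ (l + k) = \<omega> ^ l * (\<omega> ^ n) ^ k"
    using n by (cases n) (simp_all add: algebra_simps flip: power_add power_mult)
  then show "g ?e = const (\<omega> ^ l) * ?e"
    unfolding subst_mult subst_power subst_gen GX const_mult_power g_hw const_mult_mult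
    by (simp add: \<omega>_power_n power_mult)
  have "(\<Prod>i<n - 1. C i) \<noteq> 0" using C_nz by simp
  then show "(x ^^ (n - 1)) ?e \<notin> relation_ideal R"
    unfolding x_power_b_power(2)[OF x_hw] using a_power_hw_not_relation by (simp add: relation_ideal_const_iff)
qed

text \<open>On a vector e of weight \<omega>^l the normal form acts as the sum of the d_i x^i, where
  d_i is the sum over j of c_ij \<omega>^(l j). Applying x^(n-1-i) kills the terms beyond i, and
  induction on i has removed those before it, so d_i x^(n-1) e is zero in the quotient and d_i = 0.
  As l varies, the Vandermonde argument gives c_ij = 0.\<close>

lemma faithful:
  assumes "\<And>f. rep p f \<in> relation_ideal R"
  shows "p \<in> relation_ideal RT"
proof -
  have n0: "n > 0" using n by simp
  obtain c where c: "cls RT p = cls RT (\<Sum>i<n. \<Sum>j<n. const (c i j) * (gen Taft_x ^ i * gen Taft_g ^ j))"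
    using taft_normal_form[OF n0 \<omega>_power_n] by blast
  let ?N = "\<Sum>i<n. \<Sum>j<n. const (c i j) * (gen Taft_x ^ i * gen Taft_g ^ j)"
  have "rep (p - ?N) f = 0" for f
    using c by (intro rep_taft_relation_ideal) (simp add: cls_eq_iff)
  then have N: "rep ?N f \<in> relation_ideal R" for f
    using assms[of f] by (simp add: rep_diff)
  have x_pow: "(x ^^ m) f \<in> relation_ideal R" if "f \<in> relation_ideal R" for m f
    using that by (induction m) (simp_all add: x_relation_ideal)
  have rep_sum: "rep (sum h S) f = (\<Sum>i\<in>S. rep (h i) f)" for h f and S :: "nat set"
    by (induction S rule: infinite_finite_induct) (simp_all add: rep_add)
  have "c i j = 0" if "i < n" "j < n" for i j
  proof -
    have "\<forall>j<n. c i j = 0" if "i < n" for i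
      using that
    proof (induction i rule: less_induct)
      case (less i)
      have "(\<Sum>j<n. c i j * (\<omega> ^ l) ^ j) = 0" for l
      proof -
        obtain e where e: "g e = const (\<omega> ^ l) * e" "(x ^^ (n - 1)) e \<notin> relation_ideal R"
          by (rule weight_vector)
        define d where "d i' = (\<Sum>j<n. c i' j * (\<omega> ^ l) ^ j)" for i'
        have ge: "(g ^^ j) e = const ((\<omega> ^ l) ^ j) * e" for j
          by (induction j) (simp_all add: subst_const_mult e(1) ac_simps)
        have const_sum: "const (sum h S) = (\<Sum>i\<in>S. const (h i))" for h :: "nat \<Rightarrow> 'k" and S
          by (induction S rule: infinite_finite_induct) (simp_all add: const_add)
        have "rep ?N e = (\<Sum>i'<n. const (d i') * (x ^^ i') e)"
          by (simp add: rep_sum rep_mult rep_power rep_gen_fun ge skew_funpow_const d_def const_sum sum_distrib_right)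
        then have "(x ^^ (n - 1 - i)) (\<Sum>i'<n. const (d i') * (x ^^ i') e) \<in> relation_ideal R"
          using N[of e] x_pow by simp
        moreover have "(x ^^ m) (sum h S) = (\<Sum>i\<in>S. (x ^^ m) (h i))" for m h and S :: "nat set"
          by (induction S rule: infinite_finite_induct) (simp_all add: skew_funpow_add)
        moreover have "(\<Sum>i'<n. (x ^^ (n - 1 - i)) (const (d i') * (x ^^ i') e))
            = (\<Sum>i'<n. if i' = i then const (d i) * (x ^^ (n - 1)) e else 0)"
        proof (intro sum.cong refl)
          fix i' assume "i' \<in> {..<n}"
          have eq: "(x ^^ (n - 1 - i)) (const (d i') * (x ^^ i') e) = const (d i') * (x ^^ (n - 1 - i + i')) e"
            by (simp add: skew_funpow_const funpow_add)
          consider "i' < i" | "i' = i" | "i' > i" by linarith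
          then show "(x ^^ (n - 1 - i)) (const (d i') * (x ^^ i') e) = (if i' = i then const (d i) * (x ^^ (n - 1)) e else 0)"
          proof cases
            case 1
            then have "d i' = 0" using less by (simp add: d_def)
            then show ?thesis using 1 by (simp add: eq)
          next
            case 2
            moreover have "n - 1 - i + i = n - 1" using less(2) by simp
            ultimately show ?thesis unfolding eq by simp
          next
            case 3
            then have "n - 1 - i + i' = n + (i' - i - 1)" using less(2) by linarith
            then have "(x ^^ (n - 1 - i + i')) e = 0" by (simp add: funpow_add x_power_n)
            then show ?thesis using 3 unfolding eq by simp
          qed
        qed
        ultimately have "const (d i) * (x ^^ (n - 1)) e \<in> relation_ideal R"
          using less(2) by simp
        then have "d i = 0" using e(2) relation_ideal_const_iff by blast
        then show ?thesis by (simp add: d_def)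
      qed
      then show ?case using primitive_root_sum_eq_0[OF \<omega>] by blast
    qed
    then show ?thesis using that by blast
  qed
  then have "?N = 0" by simp
  then show ?thesis using c by (simp add: cls_eq_zero_iff)
qed

lemma inner_faithful_act: "inner_faithful (taft n \<omega>) (presented R) act"
  unfolding inner_faithful_def
proof (intro notI, elim exE conjE)
  fix I assume I: "hopf_ideal (taft n \<omega>) I" "I \<noteq> {\<zero>\<^bsub>taft n \<omega>\<^esub>}"
    and zero: "\<forall>h\<in>I. \<forall>f\<in>carrier (presented R). act h f = \<zero>\<^bsub>presented R\<^esub>"
  have ideal: "ideal I (taft n \<omega>)" using I(1) by (simp add: hopf_ideal_def)
  have "h = \<zero>\<^bsub>taft n \<omega>\<^esub>" if h: "h \<in> I" for h
  proof -
    have "h \<in> carrier (presented RT)"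
      using ideal.Icarr[OF ideal h] by simp
    then obtain p where p: "h = cls RT p" by (rule carrier_presentedE)
    have "rep p f \<in> relation_ideal R" for f
      using zero h by (auto simp: p zero_presented act_cls cls_eq_zero_iff dest!: bspec[of _ _ "cls R f"])
    then show ?thesis using faithful by (simp add: p zero_presented cls_eq_zero_iff)
  qed
  moreover have "\<zero>\<^bsub>taft n \<omega>\<^esub> \<in> I"
    using additive_subgroup.zero_closed[OF ideal.axioms(1)[OF ideal]] .
  ultimately show False using I(2) by blast
qed

end


section \<open>Realisation of the actions\<close>

context taft_free_action
begin

text \<open>The hypothesis compares ideals and not sets of relators, because after the exchange of u
  and v the relators agree only up to nonzero scalars.\<close>

lemma taft_acts:
  assumes "relation_ideal (down_up_relations c d) = relation_ideal R"
  shows "taft_acts_on_down_up n \<omega> c d act"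
    and "act (taft_g n \<omega>) (cls (down_up_relations c d) (gen l)) = cls (down_up_relations c d) (G l)"
    and "act (taft_x n \<omega>) (cls (down_up_relations c d) (gen l)) = cls (down_up_relations c d) (X l)"
proof -
  have du: "down_up c d = presented R" by (simp add: down_up_def presented_def assms)
  have cls: "cls (down_up_relations c d) p = cls R p" for p by (simp add: cls_def assms)
  have "down_up_grade c d i = cls R ` homogeneous i" for i
    by (simp add: down_up_grade_def homogeneous_def cls)
  then show "taft_acts_on_down_up n \<omega> c d act"
    using hopf_action_act inner_faithful_act homogeneous_act
    by (simp add: taft_acts_on_down_up_def homogeneous_action_def du)
  show "act (taft_g n \<omega>) (cls (down_up_relations c d) (gen l)) = cls (down_up_relations c d) (G l)"
    "act (taft_x n \<omega>) (cls (down_up_relations c d) (gen l)) = cls (down_up_relations c d) (X l)"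
    by (simp_all add: cls taft_g_def taft_x_def act_cls rep_taft)
qed

end

lemma taft_action_upper:
  fixes \<omega> :: "'k::field"
  assumes "n \<ge> 2" "primitive_root n \<omega>" "q \<noteq> 0" "s ^ 2 = \<omega>"
    and \<alpha>: "\<alpha> = \<omega> powi (- int (k + 1)) * (1 + s)" and \<beta>: "\<beta> = - (\<omega> powi (- 2 * int (k + 1))) * s"
  shows "\<exists>act. taft_acts_on_down_up n \<omega> \<alpha> \<beta> act \<and>
           has_matrix \<alpha> \<beta> (act (taft_g n \<omega>)) ((\<omega> ^ (k + 1), 0), (0, \<omega> ^ k)) \<and>
           has_matrix \<alpha> \<beta> (act (taft_x n \<omega>)) ((0, q), (0, 0))"
proof -
  interpret taft_free_action n k \<omega> q s DU_u DU_v
    using assms by unfold_locales simp_all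
  have t: "\<omega> powi (- int (k + 1)) = inverse (\<omega> ^ (k + 1))"
    unfolding power_int_minus by (simp only: power_int_of_nat)
  have "- 2 * int (k + 1) = - int (k + 1) * 2" by simp
  then have "\<omega> powi (- 2 * int (k + 1)) = inverse (\<omega> ^ (k + 1)) ^ 2"
    by (simp only: power_int_mult power_int_numeral t)
  then have "down_up_relations \<alpha> \<beta> = R"
    unfolding down_up_relations_cubic R_def \<alpha> \<beta> t by simp
  then show ?thesis
    using taft_acts[of \<alpha> \<beta>] GX
    by (intro exI[of _ act]) (simp add: has_matrix_iff lform_def)
qed

lemma relation_ideal_eqI:
  assumes "\<And>r. r \<in> R \<Longrightarrow> r \<in> relation_ideal R'" and "\<And>r. r \<in> R' \<Longrightarrow> r \<in> relation_ideal R"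
  shows "relation_ideal R = relation_ideal R'"
  using assms by (intro equalityI relation_ideal_minimal ideal_relation_ideal subsetI)

text \<open>Exchanging the generators replaces the parameters \<open>\<alpha>, \<beta>\<close> by \<open>-\<alpha>/\<beta>, 1/\<beta>\<close>.\<close>

lemma cubic_swap:
  assumes "\<beta> \<noteq> 0" "\<alpha>' = - \<alpha> / \<beta>" "\<beta>' = 1 / \<beta>"
  shows "cubic1 \<alpha>' \<beta>' b a = const (- \<beta>') * cubic2 \<alpha> \<beta> a b"
    and "cubic2 \<alpha>' \<beta>' b a = const (- \<beta>') * cubic1 \<alpha> \<beta> a b"
proof -
  have 1: "- \<beta>' * \<alpha> = \<alpha>'" "- \<beta>' * \<beta> = - 1" using assms by simp_all
  show "cubic1 \<alpha>' \<beta>' b a = const (- \<beta>') * cubic2 \<alpha> \<beta> a b"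
    unfolding cubic1_def cubic2_def right_diff_distrib const_scale.scale_scale 1
    by (simp add: const_minus)
  show "cubic2 \<alpha>' \<beta>' b a = const (- \<beta>') * cubic1 \<alpha> \<beta> a b"
    unfolding cubic1_def cubic2_def right_diff_distrib const_scale.scale_scale 1
    by (simp add: const_minus)
qed

text \<open>This is the first family with u and v exchanged. For \<alpha> = l (1 + s) and \<beta> =
  - l^2 s the exchanged parameters - \<alpha> / \<beta> and 1 / \<beta> are l^(-1) (1 + s^(-1)) and
  - l^(-2) s^(-1), so the square root of \<omega> to insert is the inverse of
  \<open>s\<close>.\<close>

lemma taft_action_lower:
  fixes \<omega> :: "'k::field"
  assumes "n \<ge> 2" "primitive_root n \<omega>" "r \<noteq> 0" "s ^ 2 = inverse \<omega>"
    and \<alpha>: "\<alpha> = \<omega> ^ (k + 1) * (1 + s)" and \<beta>: "\<beta> = - (\<omega> ^ (2 * (k + 1))) * s"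
  shows "\<exists>act. taft_acts_on_down_up n \<omega> \<alpha> \<beta> act \<and>
           has_matrix \<alpha> \<beta> (act (taft_g n \<omega>)) ((\<omega> ^ k, 0), (0, \<omega> ^ (k + 1))) \<and>
           has_matrix \<alpha> \<beta> (act (taft_x n \<omega>)) ((0, 0), (r, 0))"
proof -
  interpret A: taft_free_action n k \<omega> r "inverse s" DU_v DU_u
    using assms by unfold_locales (simp_all add: power_inverse)
  let ?l = "\<omega> ^ (k + 1)"
  let ?\<alpha> = "inverse ?l * (1 + inverse s)" and ?\<beta> = "- (inverse ?l ^ 2) * inverse s"
  have s0: "s \<noteq> 0" using assms(4) A.\<omega>_nz by auto
  have l0: "?l \<noteq> 0" using A.\<omega>_nz by simp
  have \<beta>': "\<beta> = - (?l ^ 2) * s" unfolding \<beta> by (simp only: power_mult[symmetric] mult.commute[of 2])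
  have \<beta>0: "\<beta> \<noteq> 0" unfolding \<beta>' using s0 l0 by simp
  have swap: "?\<alpha> = - \<alpha> / \<beta>" "?\<beta> = 1 / \<beta>"
    unfolding \<alpha> \<beta>' using s0 l0 by (simp_all add: field_simps power2_eq_square del: power_Suc)
  have "?\<beta> \<noteq> 0" using \<beta>0 unfolding swap by simp
  then have iff: "const (- ?\<beta>) * p \<in> relation_ideal S \<longleftrightarrow> p \<in> relation_ideal S" for p :: "('k, down_up_gen) free" and S
    by (intro relation_ideal_const_iff) simp
  have "relation_ideal (down_up_relations \<alpha> \<beta>) = relation_ideal A.R"
  proof (rule relation_ideal_eqI)
    have "cubic1 ?\<alpha> ?\<beta> (gen DU_v) (gen DU_u) \<in> relation_ideal A.R" "cubic2 ?\<alpha> ?\<beta> (gen DU_v) (gen DU_u) \<in> relation_ideal A.R"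
      unfolding A.R_def by (intro relation_idealI insertI1 insertI2)+
    then show "p \<in> relation_ideal A.R" if "p \<in> down_up_relations \<alpha> \<beta>" for p
      using that unfolding down_up_relations_cubic cubic_swap[OF \<beta>0 swap] iff by blast
    have "cubic1 \<alpha> \<beta> (gen DU_u) (gen DU_v) \<in> relation_ideal (down_up_relations \<alpha> \<beta>)"
      "cubic2 \<alpha> \<beta> (gen DU_u) (gen DU_v) \<in> relation_ideal (down_up_relations \<alpha> \<beta>)"
      unfolding down_up_relations_cubic by (intro relation_idealI insertI1 insertI2)+
    then show "p \<in> relation_ideal (down_up_relations \<alpha> \<beta>)" if "p \<in> A.R" for p
      using that unfolding A.R_def cubic_swap[OF \<beta>0 swap] by (auto intro: relation_ideal_mult_left)
  qed
  then show ?thesis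
    using A.taft_acts[of \<alpha> \<beta>] A.GX
    by (intro exI[of _ A.act]) (simp add: has_matrix_iff lform_def)
qed

theorem theorem1p1:
  fixes n :: nat and \<omega> :: "'k::{alg_closed_field, field_char_0}"
  assumes "n \<ge> 2" and "primitive_root n \<omega>"
  shows
    "(\<forall>\<alpha> \<beta> act. \<beta> \<noteq> 0 \<and> taft_acts_on_down_up n \<omega> \<alpha> \<beta> act \<longrightarrow>
        (\<exists>k\<le>n - 1. \<exists>q s. q \<noteq> 0 \<and> s ^ 2 = \<omega> \<and>
           has_matrix \<alpha> \<beta> (act (taft_g n \<omega>)) ((\<omega> ^ (k + 1), 0), (0, \<omega> ^ k)) \<and>
           has_matrix \<alpha> \<beta> (act (taft_x n \<omega>)) ((0, q), (0, 0)) \<and>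
           \<alpha> = \<omega> powi (- int (k + 1)) * (1 + s) \<and>
           \<beta> = - (\<omega> powi (- 2 * int (k + 1))) * s) \<or>
        (\<exists>k\<le>n - 1. \<exists>r s. r \<noteq> 0 \<and> s ^ 2 = inverse \<omega> \<and>
           has_matrix \<alpha> \<beta> (act (taft_g n \<omega>)) ((\<omega> ^ k, 0), (0, \<omega> ^ (k + 1))) \<and>
           has_matrix \<alpha> \<beta> (act (taft_x n \<omega>)) ((0, 0), (r, 0)) \<and>
           \<alpha> = \<omega> ^ (k + 1) * (1 + s) \<and>
           \<beta> = - (\<omega> ^ (2 * (k + 1))) * s)) \<and>
     (\<forall>k q s \<alpha> \<beta>. k \<le> n - 1 \<and> q \<noteq> 0 \<and> s ^ 2 = \<omega> \<and>
        \<alpha> = \<omega> powi (- int (k + 1)) * (1 + s) \<and>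
        \<beta> = - (\<omega> powi (- 2 * int (k + 1))) * s \<longrightarrow>
        (\<exists>act. taft_acts_on_down_up n \<omega> \<alpha> \<beta> act \<and>
           has_matrix \<alpha> \<beta> (act (taft_g n \<omega>)) ((\<omega> ^ (k + 1), 0), (0, \<omega> ^ k)) \<and>
           has_matrix \<alpha> \<beta> (act (taft_x n \<omega>)) ((0, q), (0, 0)))) \<and>
     (\<forall>k r s \<alpha> \<beta>. k \<le> n - 1 \<and> r \<noteq> 0 \<and> s ^ 2 = inverse \<omega> \<and>
        \<alpha> = \<omega> ^ (k + 1) * (1 + s) \<and>
        \<beta> = - (\<omega> ^ (2 * (k + 1))) * s \<longrightarrow>
        (\<exists>act. taft_acts_on_down_up n \<omega> \<alpha> \<beta> act \<and>
           has_matrix \<alpha> \<beta> (act (taft_g n \<omega>)) ((\<omega> ^ k, 0), (0, \<omega> ^ (k + 1))) \<and>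
           has_matrix \<alpha> \<beta> (act (taft_x n \<omega>)) ((0, 0), (r, 0))))"
  by (intro conjI allI impI; elim conjE)
    (rule taft_action_down_up_classification[OF assms] taft_action_upper[OF assms]
      taft_action_lower[OF assms]; assumption)+

end
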